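(* Let $k$ be a field, let $B$ be a bialgebra over $k$, let $Y$ be a right $B$-comodule algebra, and let $X$ be a left $B$-module and a right $B$-comodule (no compatibility between action and coaction is assumed) such that $x_{(1)}x_{(0)}=x$ for all $x\in X$. Let $\mathbb{T}^a_*(Y,X)$, $\partial_j$, $\tau_n$, $\rho_R$, $\mathbb{PCM}^a_*(Y,X)$ and $\mathbb{CM}^a_*(Y,X)$ be as defined in the context. Then: (1) $\mathbb{T}^a_*(Y,X)$ with the maps $\partial_j$ is a pre-simplicial $k$-module, and together with the maps $\tau_n$ it satisfies all the axioms of a para-cyclic module except that the $\tau_n$ need not be invertible. (2) If $B$ is a Hopf algebra with bijective antipode $S$, then $X^{op}$ is $1$-stable, $\mathbb{T}^a_*(Y,X^{op})$ is a para-cyclic module, and $\mathbb{PCM}^a_*(Y,X^{op})$ is a para-cyclic $B$-comodule. (3) $\mathbb{CM}^a_*(Y,X)$ is a cyclic module, regardless of whether $B$ is a Hopf algebra. (4) If $B$ is a Hopf algebra with bijective antipode, then $\mathbb{CM}^a_*(Y,X)=\mathbb{PCM}^a_*(Y,X^{op})^B$.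
   Context: Sweedler notation: $y\mapsto y_{(0)}\otimes y_{(1)}\in Y\otimes B$ and $x\mapsto x_{(0)}\otimes x_{(1)}\in X\otimes B$ are the right coactions. A right $B$-comodule algebra is a unital algebra whose right coaction $Y\to Y\otimes B$ is a unital algebra map. A pre-simplicial $k$-module is a sequence $Z_n$ ($n\ge 0$) with $k$-linear maps $\partial_j:Z_n\to Z_{n-1}$ ($n\geq 1$, $0\le j\le n$) satisfying $\partial_i\partial_j=\partial_{j-1}\partial_i$ for $i<j$ (no degeneracies). It is para-cyclic if it also has invertible maps $\tau_n:Z_n\to Z_n$ with $\partial_j\tau_n=\tau_{n-1}\partial_{j-1}$ for $1\le j\le n$ and $\partial_0\tau_n=\partial_n$; it is cyclic if moreover $\tau_n^{n+1}=\mathrm{id}$ for all $n$. A para-cyclic $B$-comodule is a para-cyclic module with each $Z_n$ a $B$-comodule and all structure maps comodule maps. For a right $B$-comodule $(M,\rho)$, $M^B=\{m:\rho(m)=m\otimes 1\}$. Put $\mathbb{T}^a_n(Y,X)=Y^{\otimes n+1}\otimes X$, with $\partial_j(y^0\otimes\cdots\otimes y^n\otimes x)=\cdots\otimes y^jy^{j+1}\otimes\cdots\otimes x$ for $0\le j<n$, $\partial_n(y^0\otimes\cdots\otimes y^n\otimes x)=y^n_{(0)}y^0\otimes y^1\otimes\cdots\otimes y^{n-1}\otimes y^n_{(1)}x$, $\tau_n(y^0\otimes\cdots\otimes y^n\otimes x)=y^n_{(0)}\otimes y^0\otimes\cdots\otimes y^{n-1}\otimes y^n_{(1)}x$, and right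 $B$-coaction $\rho_R(y^0\otimes\cdots\otimes y^n\otimes x)=(y^0_{(0)}\otimes\cdots\otimes y^n_{(0)}\otimes x_{(0)})\otimes y^0_{(1)}\cdots y^n_{(1)}x_{(1)}$. For a bialgebra $B$, $\mathbb{PCM}^a_*(Y,X)=\bigcap_{j\ge 0}\ker\big(\rho_R\tau_*^j-(\tau_*^j\otimes \mathrm{id}_B)\rho_R\big)\subseteq\mathbb{T}^a_*(Y,X)$. $\mathbb{CM}^a_*(Y,X)$ is the graded submodule of those elements $v\in\mathbb{PCM}^a_*(Y,X)$ with $\rho_R(v)=v\otimes 1$, with structure maps the restrictions of $\partial_j,\tau_n$. When $B$ is a Hopf algebra with bijective antipode $S$: $X^{op}$ is $X$ with the same left action and the left $B$-coaction $x\mapsto S^{-1}(x_{(1)})\otimes x_{(0)}$. A left module and left comodule $X'$ with coaction $x\mapsto x_{(-1)}\otimes x_{(0)}$ is called $1$-stable if $S(x_{(-1)})x_{(0)}=x$ for all $x$. $\mathbb{T}^a_*(Y,X^{op})$ has the same underlying spaces and the same $\partial_j,\tau_n$ as $\mathbb{T}^a_*(Y,X)$, with coaction $\rho_R(y^0\otimes\cdots\otimes y^n\otimes x)=(y^0_{(0)}\otimes\cdots\otimes y^n_{(0)}\otimes x_{(0)})\otimes y^0_{(1)}\cdots y^n_{(1)}S(x_{(-1)})$, where $x_{(-1)}\otimes x_{(0)}$ is the left coaction of $X^{op}$ (this coincides with the $\rho_R$ above), and $\mathbb{PCM}^a_*(Y,X^{op})=\bigcap_{j\in\mathbb{Z}}\ker\big(\rho_R\tau_*^j-(\tau_*^j\otimes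 \mathrm{id}_B)\rho_R\big)$. *)

theory Defs
  imports "HOL-Algebra.Module" "HOL-Algebra.AbelCoset"
begin

section \<open>Linear algebra over a field\<close>

text \<open>
  Vector spaces are \<open>module\<close> records over a field \<open>K\<close>. The same record type carries a
  multiplication and a unit, so it is also used for \<open>K\<close>-algebras; on plain vector spaces
  the fields \<open>mult\<close> and \<open>one\<close> have no meaning.
\<close>

definition linear_map ::
  "'k ring \<Rightarrow> ('k, 'v) module \<Rightarrow> ('k, 'w) module \<Rightarrow> ('v \<Rightarrow> 'w) \<Rightarrow> bool" where
  "linear_map K V W f \<longleftrightarrow>
     f \<in> carrier V \<rightarrow> carrier W \<and>
     (\<forall>x\<in>carrier V. \<forall>y\<in>carrier V. f (x \<oplus>\<^bsub>V\<^esub> y) = f x \<oplus>\<^bsub>W\<^esub> f y) \<and>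
     (\<forall>c\<in>carrier K. \<forall>x\<in>carrier V. f (c \<odot>\<^bsub>V\<^esub> x) = c \<odot>\<^bsub>W\<^esub> f x)"

definition free_module :: "'k ring \<Rightarrow> 's set \<Rightarrow> ('k, 's \<Rightarrow> 'k) module" where
  "free_module K S =
     \<lparr>carrier = {f. (\<forall>s. f s \<in> carrier K) \<and> finite {s. f s \<noteq> \<zero>\<^bsub>K\<^esub>} \<and> {s. f s \<noteq> \<zero>\<^bsub>K\<^esub>} \<subseteq> S},
      mult = undefined, one = undefined,
      zero = (\<lambda>s. \<zero>\<^bsub>K\<^esub>), add = (\<lambda>f g s. f s \<oplus>\<^bsub>K\<^esub> g s),
      smult = (\<lambda>c f s. c \<otimes>\<^bsub>K\<^esub> f s)\<rparr>"

definition basis_vec :: "'k ring \<Rightarrow> 's \<Rightarrow> 's \<Rightarrow> 'k" where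
  "basis_vec K s = (\<lambda>t. if t = s then \<one>\<^bsub>K\<^esub> else \<zero>\<^bsub>K\<^esub>)"

definition gen_submodule :: "'k ring \<Rightarrow> ('k, 'v) module \<Rightarrow> 'v set \<Rightarrow> 'v set" where
  "gen_submodule K M R = \<Inter>{N. submodule N K M \<and> R \<subseteq> N}"

definition quot_module :: "('k, 'v) module \<Rightarrow> 'v set \<Rightarrow> ('k, 'v set) module" where
  "quot_module M N =
     \<lparr>carrier = a_rcosets\<^bsub>M\<^esub> N, mult = undefined, one = undefined,
      zero = N, add = set_add M,
      smult = (\<lambda>c A. \<Union>v\<in>A. N +>\<^bsub>M\<^esub> (c \<odot>\<^bsub>M\<^esub> v))\<rparr>"

text \<open>The vector space with generators \<open>S\<close> and relations \<open>R\<close>, and the class of a generator.\<close>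

definition presented :: "'k ring \<Rightarrow> 's set \<Rightarrow> ('s \<Rightarrow> 'k) set \<Rightarrow> ('k, ('s \<Rightarrow> 'k) set) module" where
  "presented K S R = quot_module (free_module K S) (gen_submodule K (free_module K S) R)"

definition gen_class :: "'k ring \<Rightarrow> 's set \<Rightarrow> ('s \<Rightarrow> 'k) set \<Rightarrow> 's \<Rightarrow> ('s \<Rightarrow> 'k) set" where
  "gen_class K S R s =
     gen_submodule K (free_module K S) R +>\<^bsub>free_module K S\<^esub> basis_vec K s"

text \<open>
  The linear map from a presented vector space to \<open>M\<close> which sends the class of each generator
  \<open>s\<close> to \<open>\<phi> s\<close>: the linear extension of \<open>\<phi>\<close> is evaluated at a representative of the coset. It
  is independent of the representative when the linear extension of \<open>\<phi>\<close> respects the relations.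
\<close>

definition lin_ext ::
  "'k ring \<Rightarrow> ('k, 'm) module \<Rightarrow> ('s \<Rightarrow> 'm) \<Rightarrow> ('s \<Rightarrow> 'k) set \<Rightarrow> 'm" where
  "lin_ext K M \<phi> A =
     (let f = (SOME f. f \<in> A) in \<Oplus>\<^bsub>M\<^esub>s\<in>{s. f s \<noteq> \<zero>\<^bsub>K\<^esub>}. f s \<odot>\<^bsub>M\<^esub> \<phi> s)"


section \<open>Tensor products\<close>

type_synonym ('k, 'v, 'w) tens = "('v \<times> 'w \<Rightarrow> 'k) set"

definition tensor_rels ::
  "'k ring \<Rightarrow> ('k, 'v) module \<Rightarrow> ('k, 'w) module \<Rightarrow> ('v \<times> 'w \<Rightarrow> 'k) set" where
  "tensor_rels K V W =
    (let F = free_module K (carrier V \<times> carrier W); e = basis_vec K in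
      {e (v \<oplus>\<^bsub>V\<^esub> v', w) \<ominus>\<^bsub>F\<^esub> (e (v, w) \<oplus>\<^bsub>F\<^esub> e (v', w)) | v v' w.
         v \<in> carrier V \<and> v' \<in> carrier V \<and> w \<in> carrier W} \<union>
      {e (v, w \<oplus>\<^bsub>W\<^esub> w') \<ominus>\<^bsub>F\<^esub> (e (v, w) \<oplus>\<^bsub>F\<^esub> e (v, w')) | v w w'.
         v \<in> carrier V \<and> w \<in> carrier W \<and> w' \<in> carrier W} \<union>
      {e (c \<odot>\<^bsub>V\<^esub> v, w) \<ominus>\<^bsub>F\<^esub> (c \<odot>\<^bsub>F\<^esub> e (v, w)) | c v w.
         c \<in> carrier K \<and> v \<in> carrier V \<and> w \<in> carrier W} \<union>
      {e (v, c \<odot>\<^bsub>W\<^esub> w) \<ominus>\<^bsub>F\<^esub> (c \<odot>\<^bsub>F\<^esub> e (v, w)) | c v w.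
         c \<in> carrier K \<and> v \<in> carrier V \<and> w \<in> carrier W})"

definition tensor ::
  "'k ring \<Rightarrow> ('k, 'v) module \<Rightarrow> ('k, 'w) module \<Rightarrow> ('k, ('k, 'v, 'w) tens) module" where
  "tensor K V W = presented K (carrier V \<times> carrier W) (tensor_rels K V W)"

definition pure ::
  "'k ring \<Rightarrow> ('k, 'v) module \<Rightarrow> ('k, 'w) module \<Rightarrow> 'v \<Rightarrow> 'w \<Rightarrow> ('k, 'v, 'w) tens" where
  "pure K V W v w = gen_class K (carrier V \<times> carrier W) (tensor_rels K V W) (v, w)"

text \<open>\<open>f \<otimes> g\<close>, as a map into \<open>V' \<otimes> W'\<close>.\<close>

definition tensor_map ::
  "'k ring \<Rightarrow> ('k, 'v2) module \<Rightarrow> ('k, 'w2) module \<Rightarrow> ('v \<Rightarrow> 'v2) \<Rightarrow> ('w \<Rightarrow> 'w2) \<Rightarrow>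
   ('k, 'v, 'w) tens \<Rightarrow> ('k, 'v2, 'w2) tens" where
  "tensor_map K V' W' f g = lin_ext K (tensor K V' W') (\<lambda>(v, w). pure K V' W' (f v) (g w))"

text \<open>The associativity isomorphism \<open>(U \<otimes> V) \<otimes> W \<rightarrow> U \<otimes> (V \<otimes> W)\<close>.\<close>

definition tensor_assoc ::
  "'k ring \<Rightarrow> ('k, 'u) module \<Rightarrow> ('k, 'v) module \<Rightarrow> ('k, 'w) module \<Rightarrow>
   ('k, ('k, 'u, 'v) tens, 'w) tens \<Rightarrow> ('k, 'u, ('k, 'v, 'w) tens) tens" where
  "tensor_assoc K U V W =
     lin_ext K (tensor K U (tensor K V W))
       (\<lambda>(t, w). lin_ext K (tensor K U (tensor K V W))
          (\<lambda>(u, v). pure K U (tensor K V W) u (pure K V W v w)) t)"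

text \<open>\<open>A \<otimes> B\<close> with the multiplication \<open>(a \<otimes> b)(a' \<otimes> b') = aa' \<otimes> bb'\<close>.\<close>

definition tensor_algebra ::
  "'k ring \<Rightarrow> ('k, 'a) module \<Rightarrow> ('k, 'b) module \<Rightarrow> ('k, ('k, 'a, 'b) tens) module" where
  "tensor_algebra K A B = (tensor K A B)
     \<lparr>mult := (\<lambda>s t. lin_ext K (tensor K A B)
                (\<lambda>(a, b). lin_ext K (tensor K A B)
                   (\<lambda>(a', b'). pure K A B (a \<otimes>\<^bsub>A\<^esub> a') (b \<otimes>\<^bsub>B\<^esub> b')) t) s),
      one := pure K A B \<one>\<^bsub>A\<^esub> \<one>\<^bsub>B\<^esub>\<rparr>"

text \<open>
  The space \<open>Y\<^sup>\<otimes>\<^sup>n \<otimes> X\<close>, with generators \<open>([y\<^sub>1, \<dots>, y\<^sub>n], x)\<close> and the relations of multilinearity.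
  All the spaces, for varying \<open>n\<close>, have elements of the same type.
\<close>

type_synonym ('k, 'y, 'x) mtens = "('y list \<times> 'x \<Rightarrow> 'k) set"

definition mtens_gens :: "('k, 'y) module \<Rightarrow> ('k, 'x) module \<Rightarrow> nat \<Rightarrow> ('y list \<times> 'x) set" where
  "mtens_gens Y X n = {ys. set ys \<subseteq> carrier Y \<and> length ys = n} \<times> carrier X"

definition mtens_rels ::
  "'k ring \<Rightarrow> ('k, 'y) module \<Rightarrow> ('k, 'x) module \<Rightarrow> nat \<Rightarrow> ('y list \<times> 'x \<Rightarrow> 'k) set" where
  "mtens_rels K Y X n =
    (let G = mtens_gens Y X n; F = free_module K G; e = basis_vec K in
      {e (ys[i := a \<oplus>\<^bsub>Y\<^esub> b], x) \<ominus>\<^bsub>F\<^esub> (e (ys[i := a], x) \<oplus>\<^bsub>F\<^esub> e (ys[i := b], x)) | ys i a b x.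
         (ys, x) \<in> G \<and> i < n \<and> a \<in> carrier Y \<and> b \<in> carrier Y} \<union>
      {e (ys[i := c \<odot>\<^bsub>Y\<^esub> a], x) \<ominus>\<^bsub>F\<^esub> (c \<odot>\<^bsub>F\<^esub> e (ys[i := a], x)) | ys i c a x.
         (ys, x) \<in> G \<and> i < n \<and> c \<in> carrier K \<and> a \<in> carrier Y} \<union>
      {e (ys, x \<oplus>\<^bsub>X\<^esub> x') \<ominus>\<^bsub>F\<^esub> (e (ys, x) \<oplus>\<^bsub>F\<^esub> e (ys, x')) | ys x x'.
         (ys, x) \<in> G \<and> (ys, x') \<in> G} \<union>
      {e (ys, c \<odot>\<^bsub>X\<^esub> x) \<ominus>\<^bsub>F\<^esub> (c \<odot>\<^bsub>F\<^esub> e (ys, x)) | ys c x.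
         (ys, x) \<in> G \<and> c \<in> carrier K})"

definition mtens ::
  "'k ring \<Rightarrow> ('k, 'y) module \<Rightarrow> ('k, 'x) module \<Rightarrow> nat \<Rightarrow> ('k, ('k, 'y, 'x) mtens) module" where
  "mtens K Y X n = presented K (mtens_gens Y X n) (mtens_rels K Y X n)"

definition mpure ::
  "'k ring \<Rightarrow> ('k, 'y) module \<Rightarrow> ('k, 'x) module \<Rightarrow> nat \<Rightarrow> 'y list \<Rightarrow> 'x \<Rightarrow> ('k, 'y, 'x) mtens" where
  "mpure K Y X n ys x = gen_class K (mtens_gens Y X n) (mtens_rels K Y X n) (ys, x)"


section \<open>Bialgebras, modules and comodules\<close>

locale unital_algebra = field K + A: ring A + A: module K A
  for K :: "'k ring" and A :: "('k, 'a) module" +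
  assumes smult_mult_left: "\<lbrakk>c \<in> carrier K; a \<in> carrier A; b \<in> carrier A\<rbrakk> \<Longrightarrow>
      (c \<odot>\<^bsub>A\<^esub> a) \<otimes>\<^bsub>A\<^esub> b = c \<odot>\<^bsub>A\<^esub> (a \<otimes>\<^bsub>A\<^esub> b)"
    and smult_mult_right: "\<lbrakk>c \<in> carrier K; a \<in> carrier A; b \<in> carrier A\<rbrakk> \<Longrightarrow>
      a \<otimes>\<^bsub>A\<^esub> (c \<odot>\<^bsub>A\<^esub> b) = c \<odot>\<^bsub>A\<^esub> (a \<otimes>\<^bsub>A\<^esub> b)"

locale coalgebra = field K + C: module K C
  for K :: "'k ring" and C :: "('k, 'c) module" +
  fixes \<Delta> :: "'c \<Rightarrow> ('k, 'c, 'c) tens" and \<epsilon> :: "'c \<Rightarrow> 'k"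
  assumes comult_linear: "linear_map K C (tensor K C C) \<Delta>"
    and counit_closed: "\<epsilon> \<in> carrier C \<rightarrow> carrier K"
    and counit_add: "\<lbrakk>a \<in> carrier C; b \<in> carrier C\<rbrakk> \<Longrightarrow> \<epsilon> (a \<oplus>\<^bsub>C\<^esub> b) = \<epsilon> a \<oplus>\<^bsub>K\<^esub> \<epsilon> b"
    and counit_smult: "\<lbrakk>c \<in> carrier K; a \<in> carrier C\<rbrakk> \<Longrightarrow> \<epsilon> (c \<odot>\<^bsub>C\<^esub> a) = c \<otimes>\<^bsub>K\<^esub> \<epsilon> a"
    and coassoc: "a \<in> carrier C \<Longrightarrow>
      tensor_assoc K C C C (tensor_map K (tensor K C C) C \<Delta> id (\<Delta> a)) =
      tensor_map K C (tensor K C C) id \<Delta> (\<Delta> a)"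
    and counit_left: "a \<in> carrier C \<Longrightarrow> lin_ext K C (\<lambda>(a1, a2). \<epsilon> a1 \<odot>\<^bsub>C\<^esub> a2) (\<Delta> a) = a"
    and counit_right: "a \<in> carrier C \<Longrightarrow> lin_ext K C (\<lambda>(a1, a2). \<epsilon> a2 \<odot>\<^bsub>C\<^esub> a1) (\<Delta> a) = a"

locale bialgebra = unital_algebra K B + coalgebra K B \<Delta> \<epsilon>
  for K :: "'k ring" and B :: "('k, 'b) module" and \<Delta> and \<epsilon> +
  assumes comult_hom: "\<Delta> \<in> ring_hom B (tensor_algebra K B B)"
    and counit_hom: "\<epsilon> \<in> ring_hom B K"

locale hopf_algebra = bialgebra K B \<Delta> \<epsilon>
  for K :: "'k ring" and B :: "('k, 'b) module" and \<Delta> and \<epsilon> +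
  fixes S :: "'b \<Rightarrow> 'b"
  assumes antipode_linear: "linear_map K B B S"
    and antipode_left: "b \<in> carrier B \<Longrightarrow>
      lin_ext K B (\<lambda>(b1, b2). S b1 \<otimes>\<^bsub>B\<^esub> b2) (\<Delta> b) = \<epsilon> b \<odot>\<^bsub>B\<^esub> \<one>\<^bsub>B\<^esub>"
    and antipode_right: "b \<in> carrier B \<Longrightarrow>
      lin_ext K B (\<lambda>(b1, b2). b1 \<otimes>\<^bsub>B\<^esub> S b2) (\<Delta> b) = \<epsilon> b \<odot>\<^bsub>B\<^esub> \<one>\<^bsub>B\<^esub>"

locale left_module = unital_algebra K B + X: module K X
  for K :: "'k ring" and B :: "('k, 'b) module" and X :: "('k, 'x) module" +
  fixes act :: "'b \<Rightarrow> 'x \<Rightarrow> 'x"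
  assumes act_linear_right: "b \<in> carrier B \<Longrightarrow> linear_map K X X (\<lambda>x. act b x)"
    and act_linear_left: "x \<in> carrier X \<Longrightarrow> linear_map K B X (\<lambda>b. act b x)"
    and act_one: "x \<in> carrier X \<Longrightarrow> act \<one>\<^bsub>B\<^esub> x = x"
    and act_mult: "\<lbrakk>a \<in> carrier B; b \<in> carrier B; x \<in> carrier X\<rbrakk> \<Longrightarrow>
      act (a \<otimes>\<^bsub>B\<^esub> b) x = act a (act b x)"

locale right_comodule = coalgebra K B \<Delta> \<epsilon> + M: module K M
  for K :: "'k ring" and B :: "('k, 'b) module" and \<Delta> and \<epsilon> and M :: "('k, 'm) module" +
  fixes \<rho> :: "'m \<Rightarrow> ('k, 'm, 'b) tens"
  assumes coact_linear: "linear_map K M (tensor K M B) \<rho>"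
    and coact_coassoc: "m \<in> carrier M \<Longrightarrow>
      tensor_assoc K M B B (tensor_map K (tensor K M B) B \<rho> id (\<rho> m)) =
      tensor_map K M (tensor K B B) id \<Delta> (\<rho> m)"
    and coact_counit: "m \<in> carrier M \<Longrightarrow> lin_ext K M (\<lambda>(m0, m1). \<epsilon> m1 \<odot>\<^bsub>M\<^esub> m0) (\<rho> m) = m"

locale left_comodule = coalgebra K B \<Delta> \<epsilon> + M: module K M
  for K :: "'k ring" and B :: "('k, 'b) module" and \<Delta> and \<epsilon> and M :: "('k, 'm) module" +
  fixes \<kappa> :: "'m \<Rightarrow> ('k, 'b, 'm) tens"
  assumes lcoact_linear: "linear_map K M (tensor K B M) \<kappa>"
    and lcoact_coassoc: "m \<in> carrier M \<Longrightarrow>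
      tensor_assoc K B B M (tensor_map K (tensor K B B) M \<Delta> id (\<kappa> m)) =
      tensor_map K B (tensor K B M) id \<kappa> (\<kappa> m)"
    and lcoact_counit: "m \<in> carrier M \<Longrightarrow> lin_ext K M (\<lambda>(b, m0). \<epsilon> b \<odot>\<^bsub>M\<^esub> m0) (\<kappa> m) = m"

locale right_comodule_algebra = bialgebra K B \<Delta> \<epsilon> + unital_algebra K Y + right_comodule K B \<Delta> \<epsilon> Y \<rho>
  for K :: "'k ring" and B :: "('k, 'b) module" and \<Delta> and \<epsilon>
    and Y :: "('k, 'y) module" and \<rho> :: "'y \<Rightarrow> ('k, 'y, 'b) tens" +
  assumes coact_hom: "\<rho> \<in> ring_hom Y (tensor_algebra K Y B)"

locale one_stable =
  hopf_algebra K B \<Delta> \<epsilon> S + left_module K B X act + left_comodule K B \<Delta> \<epsilon> X \<kappa>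
  for K :: "'k ring" and B :: "('k, 'b) module" and \<Delta> and \<epsilon> and S
    and X :: "('k, 'x) module" and act and \<kappa> +
  assumes stable: "x \<in> carrier X \<Longrightarrow> lin_ext K X (\<lambda>(xm1, x0). act (S xm1) x0) (\<kappa> x) = x"

definition coinvariants ::
  "'k ring \<Rightarrow> ('k, 'b) module \<Rightarrow> ('k, 'm) module \<Rightarrow> ('m \<Rightarrow> ('k, 'm, 'b) tens) \<Rightarrow> 'm set" where
  "coinvariants K B M \<rho> = {m \<in> carrier M. \<rho> m = pure K M B m \<one>\<^bsub>B\<^esub>}"

text \<open>
  For a subspace \<open>W\<close> of \<open>M\<close> the inclusion induces a map \<open>W \<otimes> B \<rightarrow> M \<otimes> B\<close>, injective over a
  field, but \<open>W \<otimes> B\<close> is not literally a subset of \<open>M \<otimes> B\<close> since the cosets are different. Hence a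
  coaction on \<open>M\<close> restricts to \<open>W\<close> if it maps \<open>W\<close> into the image of \<open>W \<otimes> B\<close>, and the restricted
  coaction takes values in \<open>W \<otimes> B\<close> itself.
\<close>

definition tensor_incl ::
  "'k ring \<Rightarrow> ('k, 'm) module \<Rightarrow> ('k, 'b) module \<Rightarrow> ('k, 'm, 'b) tens \<Rightarrow> ('k, 'm, 'b) tens" where
  "tensor_incl K M B = tensor_map K M B id id"

definition coaction_restricts ::
  "'k ring \<Rightarrow> ('k, 'b) module \<Rightarrow> ('k, 'm) module \<Rightarrow> ('m \<Rightarrow> ('k, 'm, 'b) tens) \<Rightarrow>
   'm set \<Rightarrow> bool" where
  "coaction_restricts K B M \<rho> W \<longleftrightarrow>
     \<rho> ` W \<subseteq> tensor_incl K M B ` carrier (tensor K (M\<lparr>carrier := W\<rparr>) B)"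

definition restrict_coaction ::
  "'k ring \<Rightarrow> ('k, 'b) module \<Rightarrow> ('k, 'm) module \<Rightarrow> ('m \<Rightarrow> ('k, 'm, 'b) tens) \<Rightarrow>
   'm set \<Rightarrow> 'm \<Rightarrow> ('k, 'm, 'b) tens" where
  "restrict_coaction K B M \<rho> W m =
     inv_into (carrier (tensor K (M\<lparr>carrier := W\<rparr>) B)) (tensor_incl K M B) (\<rho> m)"


section \<open>Para-cyclic modules\<close>

text \<open>
  \<open>d n j\<close> is the face map \<open>\<partial>\<^sub>j : Z\<^sub>n \<rightarrow> Z\<^sub>n\<^sub>-\<^sub>1\<close>, meaningful for \<open>n \<ge> 1\<close> and \<open>j \<le> n\<close>.
\<close>

definition pre_simplicial ::
  "'k ring \<Rightarrow> (nat \<Rightarrow> ('k, 'z) module) \<Rightarrow> (nat \<Rightarrow> nat \<Rightarrow> 'z \<Rightarrow> 'z) \<Rightarrow> bool" where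
  "pre_simplicial K Z d \<longleftrightarrow>
     (\<forall>n. module K (Z n)) \<and>
     (\<forall>n\<ge>1. \<forall>j\<le>n. linear_map K (Z n) (Z (n - 1)) (d n j)) \<and>
     (\<forall>n\<ge>2. \<forall>j\<le>n. \<forall>i<j. \<forall>z\<in>carrier (Z n).
        d (n - 1) i (d n j z) = d (n - 1) (j - 1) (d n i z))"

text \<open>All the axioms of a para-cyclic module except for the invertibility of the \<open>\<tau>\<^sub>n\<close>.\<close>

definition weak_para_cyclic ::
  "'k ring \<Rightarrow> (nat \<Rightarrow> ('k, 'z) module) \<Rightarrow> (nat \<Rightarrow> nat \<Rightarrow> 'z \<Rightarrow> 'z) \<Rightarrow> (nat \<Rightarrow> 'z \<Rightarrow> 'z) \<Rightarrow> bool"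
  where
  "weak_para_cyclic K Z d \<tau> \<longleftrightarrow>
     pre_simplicial K Z d \<and>
     (\<forall>n. linear_map K (Z n) (Z n) (\<tau> n)) \<and>
     (\<forall>n\<ge>1. \<forall>j\<in>{1..n}. \<forall>z\<in>carrier (Z n). d n j (\<tau> n z) = \<tau> (n - 1) (d n (j - 1) z)) \<and>
     (\<forall>n\<ge>1. \<forall>z\<in>carrier (Z n). d n 0 (\<tau> n z) = d n n z)"

definition para_cyclic ::
  "'k ring \<Rightarrow> (nat \<Rightarrow> ('k, 'z) module) \<Rightarrow> (nat \<Rightarrow> nat \<Rightarrow> 'z \<Rightarrow> 'z) \<Rightarrow> (nat \<Rightarrow> 'z \<Rightarrow> 'z) \<Rightarrow> bool"
  where
  "para_cyclic K Z d \<tau> \<longleftrightarrow>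
     weak_para_cyclic K Z d \<tau> \<and> (\<forall>n. bij_betw (\<tau> n) (carrier (Z n)) (carrier (Z n)))"

definition cyclic ::
  "'k ring \<Rightarrow> (nat \<Rightarrow> ('k, 'z) module) \<Rightarrow> (nat \<Rightarrow> nat \<Rightarrow> 'z \<Rightarrow> 'z) \<Rightarrow> (nat \<Rightarrow> 'z \<Rightarrow> 'z) \<Rightarrow> bool"
  where
  "cyclic K Z d \<tau> \<longleftrightarrow>
     para_cyclic K Z d \<tau> \<and> (\<forall>n. \<forall>z\<in>carrier (Z n). (\<tau> n ^^ (n + 1)) z = z)"

definition comodule_map ::
  "'k ring \<Rightarrow> ('k, 'b) module \<Rightarrow> ('k, 'm) module \<Rightarrow> ('m \<Rightarrow> ('k, 'm, 'b) tens) \<Rightarrow>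
   ('k, 'n) module \<Rightarrow> ('n \<Rightarrow> ('k, 'n, 'b) tens) \<Rightarrow> ('m \<Rightarrow> 'n) \<Rightarrow> bool" where
  "comodule_map K B M \<rho>M N \<rho>N f \<longleftrightarrow>
     linear_map K M N f \<and>
     (\<forall>m\<in>carrier M. \<rho>N (f m) = tensor_map K N B f id (\<rho>M m))"

definition para_cyclic_comodule ::
  "'k ring \<Rightarrow> ('k, 'b) module \<Rightarrow> ('b \<Rightarrow> ('k, 'b, 'b) tens) \<Rightarrow> ('b \<Rightarrow> 'k) \<Rightarrow>
   (nat \<Rightarrow> ('k, 'z) module) \<Rightarrow> (nat \<Rightarrow> 'z \<Rightarrow> ('k, 'z, 'b) tens) \<Rightarrow>
   (nat \<Rightarrow> nat \<Rightarrow> 'z \<Rightarrow> 'z) \<Rightarrow> (nat \<Rightarrow> 'z \<Rightarrow> 'z) \<Rightarrow> bool" where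
  "para_cyclic_comodule K B \<Delta> \<epsilon> Z \<rho> d \<tau> \<longleftrightarrow>
     para_cyclic K Z d \<tau> \<and>
     (\<forall>n. right_comodule K B \<Delta> \<epsilon> (Z n) (\<rho> n)) \<and>
     (\<forall>n\<ge>1. \<forall>j\<le>n. comodule_map K B (Z n) (\<rho> n) (Z (n - 1)) (\<rho> (n - 1)) (d n j)) \<and>
     (\<forall>n. comodule_map K B (Z n) (\<rho> n) (Z n) (\<rho> n) (\<tau> n))"


section \<open>The modules attached to a comodule algebra \<open>Y\<close> and a module-comodule \<open>X\<close>\<close>

definition TT ::
  "'k ring \<Rightarrow> ('k, 'y) module \<Rightarrow> ('k, 'x) module \<Rightarrow> nat \<Rightarrow> ('k, ('k, 'y, 'x) mtens) module" where
  "TT K Y X n = mtens K Y X (n + 1)"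

definition face ::
  "'k ring \<Rightarrow> ('k, 'y) module \<Rightarrow> ('y \<Rightarrow> ('k, 'y, 'b) tens) \<Rightarrow> ('k, 'x) module \<Rightarrow>
   ('b \<Rightarrow> 'x \<Rightarrow> 'x) \<Rightarrow> nat \<Rightarrow> nat \<Rightarrow> ('k, 'y, 'x) mtens \<Rightarrow> ('k, 'y, 'x) mtens" where
  "face K Y \<rho>Y X act n j =
     lin_ext K (TT K Y X (n - 1)) (\<lambda>(ys, x).
       if j < n
       then mpure K Y X n (take j ys @ [ys ! j \<otimes>\<^bsub>Y\<^esub> ys ! (j + 1)] @ drop (j + 2) ys) x
       else lin_ext K (TT K Y X (n - 1))
              (\<lambda>(y0, y1). mpure K Y X n ((y0 \<otimes>\<^bsub>Y\<^esub> hd ys) # tl (butlast ys)) (act y1 x))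
              (\<rho>Y (last ys)))"

definition cyc ::
  "'k ring \<Rightarrow> ('k, 'y) module \<Rightarrow> ('y \<Rightarrow> ('k, 'y, 'b) tens) \<Rightarrow> ('k, 'x) module \<Rightarrow>
   ('b \<Rightarrow> 'x \<Rightarrow> 'x) \<Rightarrow> nat \<Rightarrow> ('k, 'y, 'x) mtens \<Rightarrow> ('k, 'y, 'x) mtens" where
  "cyc K Y \<rho>Y X act n =
     lin_ext K (TT K Y X n) (\<lambda>(ys, x).
       lin_ext K (TT K Y X n)
         (\<lambda>(y0, y1). mpure K Y X (n + 1) (y0 # butlast ys) (act y1 x))
         (\<rho>Y (last ys)))"

text \<open>
  \<open>sweedler_list K B M \<rho> \<phi> [y\<^sub>1, \<dots>, y\<^sub>n]\<close> is the sum in \<open>M\<close> written in Sweedler notation as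
  \<open>\<phi> [y\<^sub>1\<^sub>(\<^sub>0\<^sub>), \<dots>, y\<^sub>n\<^sub>(\<^sub>0\<^sub>)] (y\<^sub>1\<^sub>(\<^sub>1\<^sub>) \<cdots> y\<^sub>n\<^sub>(\<^sub>1\<^sub>))\<close>.
\<close>

fun sweedler_list ::
  "'k ring \<Rightarrow> ('k, 'b) module \<Rightarrow> ('k, 'm) module \<Rightarrow> ('y \<Rightarrow> ('k, 'y, 'b) tens) \<Rightarrow>
   ('y list \<Rightarrow> 'b \<Rightarrow> 'm) \<Rightarrow> 'y list \<Rightarrow> 'm" where
  "sweedler_list K B M \<rho> \<phi> [] = \<phi> [] \<one>\<^bsub>B\<^esub>"
| "sweedler_list K B M \<rho> \<phi> (y # ys) =
     lin_ext K M
       (\<lambda>(y0, y1). sweedler_list K B M \<rho> (\<lambda>zs b. \<phi> (y0 # zs) (y1 \<otimes>\<^bsub>B\<^esub> b)) ys) (\<rho> y)"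

definition coact ::
  "'k ring \<Rightarrow> ('k, 'b) module \<Rightarrow> ('k, 'y) module \<Rightarrow> ('y \<Rightarrow> ('k, 'y, 'b) tens) \<Rightarrow>
   ('k, 'x) module \<Rightarrow> ('x \<Rightarrow> ('k, 'x, 'b) tens) \<Rightarrow>
   nat \<Rightarrow> ('k, 'y, 'x) mtens \<Rightarrow> ('k, ('k, 'y, 'x) mtens, 'b) tens" where
  "coact K B Y \<rho>Y X \<rho>X n =
     (let T = TT K Y X n; TB = tensor K T B in
      lin_ext K TB (\<lambda>(ys, x).
        sweedler_list K B TB \<rho>Y
          (\<lambda>zs b. lin_ext K TB
             (\<lambda>(x0, x1). pure K T B (mpure K Y X (n + 1) zs x0) (b \<otimes>\<^bsub>B\<^esub> x1)) (\<rho>X x)) ys))"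

text \<open>The left coaction of \<open>X\<^sup>o\<^sup>p\<close>; its action and its underlying space are those of \<open>X\<close>.\<close>

definition op_coaction ::
  "'k ring \<Rightarrow> ('k, 'b) module \<Rightarrow> ('b \<Rightarrow> 'b) \<Rightarrow> ('k, 'x) module \<Rightarrow> ('x \<Rightarrow> ('k, 'x, 'b) tens) \<Rightarrow>
   'x \<Rightarrow> ('k, 'b, 'x) tens" where
  "op_coaction K B S X \<rho>X x =
     lin_ext K (tensor K B X)
       (\<lambda>(x0, x1). pure K B X (inv_into (carrier B) S x1) x0) (\<rho>X x)"

text \<open>The coaction on \<open>T\<^sub>n(Y, X')\<close> for a left comodule \<open>X'\<close> with coaction \<open>\<kappa>\<close>.\<close>

definition coact_left ::
  "'k ring \<Rightarrow> ('k, 'b) module \<Rightarrow> ('b \<Rightarrow> 'b) \<Rightarrow> ('k, 'y) module \<Rightarrow> ('y \<Rightarrow> ('k, 'y, 'b) tens) \<Rightarrow>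
   ('k, 'x) module \<Rightarrow> ('x \<Rightarrow> ('k, 'b, 'x) tens) \<Rightarrow>
   nat \<Rightarrow> ('k, 'y, 'x) mtens \<Rightarrow> ('k, ('k, 'y, 'x) mtens, 'b) tens" where
  "coact_left K B S Y \<rho>Y X \<kappa> n =
     (let T = TT K Y X n; TB = tensor K T B in
      lin_ext K TB (\<lambda>(ys, x).
        sweedler_list K B TB \<rho>Y
          (\<lambda>zs b. lin_ext K TB
             (\<lambda>(xm1, x0). pure K T B (mpure K Y X (n + 1) zs x0) (b \<otimes>\<^bsub>B\<^esub> S xm1)) (\<kappa> x)) ys))"

definition equalizer ::
  "'k ring \<Rightarrow> ('k, 'b) module \<Rightarrow> ('k, 't) module \<Rightarrow> ('t \<Rightarrow> ('k, 't, 'b) tens) \<Rightarrow>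
   ('t \<Rightarrow> 't) \<Rightarrow> 't set" where
  "equalizer K B T \<rho> f =
     a_kernel T (tensor K T B) (\<lambda>v. \<rho> (f v) \<ominus>\<^bsub>tensor K T B\<^esub> tensor_map K T B f id (\<rho> v))"

definition int_iter :: "'t set \<Rightarrow> ('t \<Rightarrow> 't) \<Rightarrow> int \<Rightarrow> 't \<Rightarrow> 't" where
  "int_iter C f j = (if j \<ge> 0 then f ^^ nat j else inv_into C f ^^ nat (- j))"

definition PCM ::
  "'k ring \<Rightarrow> ('k, 'b) module \<Rightarrow> ('k, 'y) module \<Rightarrow> ('y \<Rightarrow> ('k, 'y, 'b) tens) \<Rightarrow>
   ('k, 'x) module \<Rightarrow> ('b \<Rightarrow> 'x \<Rightarrow> 'x) \<Rightarrow> ('x \<Rightarrow> ('k, 'x, 'b) tens) \<Rightarrow>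
   nat \<Rightarrow> ('k, 'y, 'x) mtens set" where
  "PCM K B Y \<rho>Y X act \<rho>X n =
     (\<Inter>j::nat. equalizer K B (TT K Y X n) (coact K B Y \<rho>Y X \<rho>X n) (cyc K Y \<rho>Y X act n ^^ j))"

definition CM ::
  "'k ring \<Rightarrow> ('k, 'b) module \<Rightarrow> ('k, 'y) module \<Rightarrow> ('y \<Rightarrow> ('k, 'y, 'b) tens) \<Rightarrow>
   ('k, 'x) module \<Rightarrow> ('b \<Rightarrow> 'x \<Rightarrow> 'x) \<Rightarrow> ('x \<Rightarrow> ('k, 'x, 'b) tens) \<Rightarrow>
   nat \<Rightarrow> ('k, 'y, 'x) mtens set" where
  "CM K B Y \<rho>Y X act \<rho>X n =
     {v \<in> PCM K B Y \<rho>Y X act \<rho>X n.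
        coact K B Y \<rho>Y X \<rho>X n v = pure K (TT K Y X n) B v \<one>\<^bsub>B\<^esub>}"

text \<open>The variant for a left comodule with coaction \<open>\<kappa>\<close>, where the \<open>\<tau>\<^sub>n\<close> are invertible.\<close>

definition PCM_left ::
  "'k ring \<Rightarrow> ('k, 'b) module \<Rightarrow> ('b \<Rightarrow> 'b) \<Rightarrow> ('k, 'y) module \<Rightarrow> ('y \<Rightarrow> ('k, 'y, 'b) tens) \<Rightarrow>
   ('k, 'x) module \<Rightarrow> ('b \<Rightarrow> 'x \<Rightarrow> 'x) \<Rightarrow> ('x \<Rightarrow> ('k, 'b, 'x) tens) \<Rightarrow>
   nat \<Rightarrow> ('k, 'y, 'x) mtens set" where
  "PCM_left K B S Y \<rho>Y X act \<kappa> n =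
     (\<Inter>j::int. equalizer K B (TT K Y X n) (coact_left K B S Y \<rho>Y X \<kappa> n)
        (int_iter (carrier (TT K Y X n)) (cyc K Y \<rho>Y X act n) j))"

definition PCM_left_coact ::
  "'k ring \<Rightarrow> ('k, 'b) module \<Rightarrow> ('b \<Rightarrow> 'b) \<Rightarrow> ('k, 'y) module \<Rightarrow> ('y \<Rightarrow> ('k, 'y, 'b) tens) \<Rightarrow>
   ('k, 'x) module \<Rightarrow> ('b \<Rightarrow> 'x \<Rightarrow> 'x) \<Rightarrow> ('x \<Rightarrow> ('k, 'b, 'x) tens) \<Rightarrow>
   nat \<Rightarrow> ('k, 'y, 'x) mtens \<Rightarrow> ('k, ('k, 'y, 'x) mtens, 'b) tens" where
  "PCM_left_coact K B S Y \<rho>Y X act \<kappa> n =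
     restrict_coaction K B (TT K Y X n) (coact_left K B S Y \<rho>Y X \<kappa> n)
       (PCM_left K B S Y \<rho>Y X act \<kappa> n)"

end

theory Submission
  imports Defs
begin

text \<open>
  Sweedler sums are evaluated by \<open>bnd\<close>, the linear extension of a bilinear map. The coaction on
  \<open>Y\<^sup>\<otimes>\<^sup>n \<otimes> X\<close> is a comodule structure for which the inner faces \<open>\<partial>\<^sub>j\<close>, \<open>j < n\<close>, are colinear, while
  \<open>\<tau>\<^sub>n\<close> need not be. Since \<open>\<partial>\<^sub>n = \<partial>\<^sub>0 \<tau>\<^sub>n\<close>, all simplicial identities follow from associativity,
  \<open>\<partial>\<^sub>j\<^sub>+\<^sub>1 \<tau>\<^sub>n = \<tau>\<^sub>n\<^sub>-\<^sub>1 \<partial>\<^sub>j\<close> and \<open>\<partial>\<^sub>0 \<tau>\<^sub>n\<^sup>2 = \<tau>\<^sub>n\<^sub>-\<^sub>1 \<partial>\<^sub>n\<^sub>-\<^sub>1\<close>. These also rewrite \<open>\<tau>\<^sup>l \<partial>\<^sub>j\<close> as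
  \<open>\<partial>\<^sub>i \<tau>\<^sup>k\<close> with an inner face \<open>\<partial>\<^sub>i\<close>, so that the vectors on which every power of \<open>\<tau>\<close> commutes with the
  coaction are stable under faces. The stability condition on \<open>X\<close> gives
  \<open>\<tau>\<^sub>n\<^sup>n\<^sup>+\<^sup>1 (v) = v\<^sub>(\<^sub>1\<^sub>) v\<^sub>(\<^sub>0\<^sub>)\<close>, where \<open>B\<close> acts on the factor \<open>X\<close>, hence \<open>\<tau>\<^sub>n\<^sup>n\<^sup>+\<^sup>1 = id\<close> on coinvariants.
  With an antipode, \<open>\<tau>\<^sub>n\<close> has the inverse
  \<open>y\<^sup>0 \<otimes> \<cdots> \<otimes> y\<^sup>n \<otimes> x \<mapsto> y\<^sup>1 \<otimes> \<cdots> \<otimes> y\<^sup>n \<otimes> y\<^sup>0\<^sub>(\<^sub>0\<^sub>) \<otimes> S(y\<^sup>0\<^sub>(\<^sub>1\<^sub>)) x\<close>.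
  Over a field a subspace \<open>W\<close> of \<open>M\<close> satisfies \<open>t \<in> W \<otimes> B\<close> as soon as \<open>(id \<otimes> \<xi>) t \<in> W\<close> for all
  functionals \<open>\<xi>\<close>, which by coassociativity shows that the coaction restricts to these vectors.
\<close>

section \<open>Linear maps and presented vector spaces\<close>

text \<open>The obstacle is that \<open>\<tau>\<close> fails to be colinear for two reasons. It
  carries the coefficient y_(1) of the last factor past the coefficients of all other factors, and B
  need not be commutative; and it replaces x by y_(1) x, on which the coaction of X is not
  controlled. So \<open>\<tau>\<close> and the last face are never colinear as maps, only at vectors
  whose whole orbit under \<open>\<tau>\<close> behaves well; this is why the kernels are taken over
  all powers. The inner faces are colinear everywhere, because they multiply neighbouring factors
  and the coaction of Y is multiplicative. On coinvariants natural and integer exponents impose the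
  same conditions, since \<tau>^(n+1) = id makes \<tau>^n the inverse; this is the bridge to the
  last claim. Tensor products are quotients of free modules and \<open>lin_ext\<close> evaluates a
  chosen representative, so every Sweedler sum carries a bilinearity obligation. For a subspace W,
  the space W \<otimes> B is a different quotient from M \<otimes> B, and injectivity of the
  comparison map has to be proved.\<close>

locale linear_algebra = field K for K :: "'k ring" (structure)
begin

text \<open>Closure is restated with \<open>module K V\<close> as a premise: modules built on the
  fly, such as iterated tensor products, then need no locale interpretation for the simplifier to
  settle membership.\<close>

lemma module_add_closed [simp]:
  "\<lbrakk>module K V; x \<in> carrier V; y \<in> carrier V\<rbrakk> \<Longrightarrow> x \<oplus>\<^bsub>V\<^esub> y \<in> carrier V"
  by (rule abelian_groupE(1)[OF module.axioms(2)])

lemma module_zero_closed [simp]: "module K V \<Longrightarrow> \<zero>\<^bsub>V\<^esub> \<in> carrier V"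
  by (rule abelian_groupE(2)[OF module.axioms(2)])

lemma module_smult_closed [simp]:
  "\<lbrakk>module K V; c \<in> carrier K; y \<in> carrier V\<rbrakk> \<Longrightarrow> c \<odot>\<^bsub>V\<^esub> y \<in> carrier V"
  by (rule module.smult_closed)

lemma module_minus_closed [simp]:
  "\<lbrakk>module K V; x \<in> carrier V; y \<in> carrier V\<rbrakk> \<Longrightarrow> x \<ominus>\<^bsub>V\<^esub> y \<in> carrier V"
  by (rule abelian_group.minus_closed[OF module.axioms(2)])

lemma linearI:
  assumes "\<And>x. x \<in> carrier V \<Longrightarrow> f x \<in> carrier W"
    and "\<And>x y. \<lbrakk>x \<in> carrier V; y \<in> carrier V\<rbrakk> \<Longrightarrow> f (x \<oplus>\<^bsub>V\<^esub> y) = f x \<oplus>\<^bsub>W\<^esub> f y"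
    and "\<And>c x. \<lbrakk>c \<in> carrier K; x \<in> carrier V\<rbrakk> \<Longrightarrow> f (c \<odot>\<^bsub>V\<^esub> x) = c \<odot>\<^bsub>W\<^esub> f x"
  shows "linear_map K V W f"
  using assms unfolding linear_map_def by auto

lemma linear_closed: "\<lbrakk>linear_map K V W f; x \<in> carrier V\<rbrakk> \<Longrightarrow> f x \<in> carrier W"
  unfolding linear_map_def by auto

lemma linear_add:
  "\<lbrakk>linear_map K V W f; x \<in> carrier V; y \<in> carrier V\<rbrakk> \<Longrightarrow> f (x \<oplus>\<^bsub>V\<^esub> y) = f x \<oplus>\<^bsub>W\<^esub> f y"
  unfolding linear_map_def by auto

lemma linear_smult:
  "\<lbrakk>linear_map K V W f; c \<in> carrier K; x \<in> carrier V\<rbrakk> \<Longrightarrow> f (c \<odot>\<^bsub>V\<^esub> x) = c \<odot>\<^bsub>W\<^esub> f x"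
  unfolding linear_map_def by auto

text \<open>\<open>linear_map\<close> sees only values on the carrier, and many operators below are
  controlled only there.\<close>

lemma linear_cong:
  assumes "linear_map K V W f" "module K V" "\<And>x. x \<in> carrier V \<Longrightarrow> g x = f x"
  shows "linear_map K V W g"
  using assms(1,3) module_add_closed[OF assms(2)] module_smult_closed[OF assms(2)]
  unfolding linear_map_def by auto

lemma linear_zero:
  assumes "linear_map K V W f" "module K V" "module K W"
  shows "f \<zero>\<^bsub>V\<^esub> = \<zero>\<^bsub>W\<^esub>"
proof -
  interpret V: module K V by fact
  interpret W: module K W by fact
  have "f (\<zero> \<odot>\<^bsub>V\<^esub> \<zero>\<^bsub>V\<^esub>) = \<zero> \<odot>\<^bsub>W\<^esub> f \<zero>\<^bsub>V\<^esub>"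
    using assms(1) by (intro linear_smult) auto
  then show ?thesis
    using linear_closed[OF assms(1), of "\<zero>\<^bsub>V\<^esub>"] by simp
qed

lemma linear_neg:
  assumes "linear_map K V W f" "module K V" "module K W" "x \<in> carrier V"
  shows "f (\<ominus>\<^bsub>V\<^esub> x) = \<ominus>\<^bsub>W\<^esub> f x"
proof -
  interpret V: module K V by fact
  interpret W: module K W by fact
  have "f (\<ominus>\<^bsub>V\<^esub> x) \<oplus>\<^bsub>W\<^esub> f x = \<zero>\<^bsub>W\<^esub>"
    using linear_add[OF assms(1), of "\<ominus>\<^bsub>V\<^esub> x" x] assms linear_zero[OF assms(1-3)]
    by (simp add: V.l_neg)
  then show ?thesis
    using linear_closed[OF assms(1)] assms(4) by (intro W.minus_equality[symmetric]) auto
qed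

lemma linear_minus:
  assumes "linear_map K V W f" "module K V" "module K W" "x \<in> carrier V" "y \<in> carrier V"
  shows "f (x \<ominus>\<^bsub>V\<^esub> y) = f x \<ominus>\<^bsub>W\<^esub> f y"
proof -
  interpret V: module K V by fact
  show ?thesis
    using assms linear_add[OF assms(1), of x "\<ominus>\<^bsub>V\<^esub> y"] linear_neg[OF assms(1-3)]
    by (simp add: a_minus_def)
qed

lemma linear_compose:
  assumes "linear_map K U V f" "linear_map K V W g"
  shows "linear_map K U W (\<lambda>u. g (f u))"
  using assms unfolding linear_map_def by (auto simp: Pi_iff)

lemma linear_ident: "linear_map K V V (\<lambda>v. v)" "linear_map K V V id"
  unfolding linear_map_def by auto

lemma linear_funpow:
  assumes "linear_map K V V f"
  shows "linear_map K V V (f ^^ k)"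
  by (induction k) (auto simp: linear_ident comp_def intro: linear_compose[OF _ assms])

text \<open>Extends a property from generators to everything they generate, once the property is
  written as a preimage of a submodule.\<close>

lemma submodule_linear_vimage:
  assumes "linear_map K V W f" "submodule N K W" "module K V" "module K W"
  shows "submodule {v \<in> carrier V. f v \<in> N} K V"
proof -
  interpret V: module K V by fact
  interpret W: module K W by fact
  note N = W.submoduleE[OF assms(2)]
  show ?thesis
  proof (rule V.submoduleI)
    have "f \<zero>\<^bsub>V\<^esub> = \<zero>\<^bsub>W\<^esub>"
      by (rule linear_zero[OF assms(1,3,4)])
    moreover have "\<zero>\<^bsub>W\<^esub> \<in> N"
      using subgroup.one_closed[OF submodule.axioms(1)[OF assms(2)]] by simp
    ultimately show "\<zero>\<^bsub>V\<^esub> \<in> {v \<in> carrier V. f v \<in> N}"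
      by simp
  qed (use N assms in \<open>auto simp: linear_add linear_smult linear_neg\<close>)
qed

lemma submodule_linear_eq:
  assumes "linear_map K V W f" "linear_map K V W g" "module K V" "module K W"
  shows "submodule {v \<in> carrier V. f v = g v} K V"
proof -
  interpret V: module K V by fact
  interpret W: module K W by fact
  show ?thesis
    by (rule V.submoduleI)
      (use assms in \<open>auto simp: linear_add[OF assms(1)] linear_add[OF assms(2)]
        linear_smult[OF assms(1)] linear_smult[OF assms(2)] linear_neg[OF assms(1)]
        linear_neg[OF assms(2)] linear_zero[OF assms(1)] linear_zero[OF assms(2)]\<close>)
qed

lemma submodule_zero: 
  assumes "module K V" shows "submodule {\<zero>\<^bsub>V\<^esub>} K V"
proof -
  interpret V: module K V by fact
  show ?thesis
    by (rule V.submoduleI) auto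
qed

lemma submodule_Inter:
  assumes "module K V" "\<And>N. N \<in> F \<Longrightarrow> submodule N K V" "F \<noteq> {}"
  shows "submodule (\<Inter>F) K V"
proof -
  interpret V: module K V by fact
  note E = V.submoduleE[OF assms(2)]
  show ?thesis
  proof (rule V.submoduleI)
    show "\<Inter>F \<subseteq> carrier V"
      using E(1) assms(3) by blast
    show "\<zero>\<^bsub>V\<^esub> \<in> \<Inter>F"
      using subgroup.one_closed[OF submodule.axioms(1)[OF assms(2)]] by auto
  qed (use E in auto)
qed

section \<open>Free vector spaces and linear extension from a basis\<close>

lemma free_module_simps:
  "carrier (free_module K S) =
     {f. (\<forall>s. f s \<in> carrier K) \<and> finite {s. f s \<noteq> \<zero>} \<and> {s. f s \<noteq> \<zero>} \<subseteq> S}"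
  "zero (free_module K S) = (\<lambda>s. \<zero>)"
  "add (free_module K S) f g = (\<lambda>s. f s \<oplus> g s)"
  "smult (free_module K S) c f = (\<lambda>s. c \<otimes> f s)"
  unfolding free_module_def by auto

lemma module_free_module: "module K (free_module K S)"
proof (rule moduleI)
  show "abelian_group (free_module K S)"
  proof (rule abelian_groupI, goal_cases)
    case (1 f g)
    have "{s. f s \<oplus> g s \<noteq> \<zero>} \<subseteq> {s. f s \<noteq> \<zero>} \<union> {s. g s \<noteq> \<zero>}"
      by auto
    with 1 show ?case
      unfolding free_module_simps by (auto intro: finite_subset)
  next
    case (6 f)
    then have "(\<lambda>s. \<ominus> f s) \<in> carrier (free_module K S)"
      unfolding free_module_simps by (auto elim: rev_finite_subset)
    moreover have "(\<lambda>s. \<ominus> f s \<oplus> f s) = (\<lambda>s. \<zero>)"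
      using 6 unfolding free_module_simps by (auto simp: l_neg)
    ultimately show ?case
      unfolding free_module_simps(2,3) by (intro bexI[of _ "\<lambda>s. \<ominus> f s"])
  qed (auto simp: free_module_simps a_ac)
next
  fix c f assume "c \<in> carrier K" "f \<in> carrier (free_module K S)"
  moreover from this have "{s. c \<otimes> f s \<noteq> \<zero>} \<subseteq> {s. f s \<noteq> \<zero>}"
    unfolding free_module_simps by auto
  ultimately show "c \<odot>\<^bsub>free_module K S\<^esub> f \<in> carrier (free_module K S)"
    unfolding free_module_simps by (auto intro: finite_subset)
qed (auto simp: free_module_simps l_distr r_distr m_assoc is_cring)

lemma basis_vec_closed: "s \<in> S \<Longrightarrow> basis_vec K s \<in> carrier (free_module K S)"
  unfolding free_module_simps basis_vec_def by auto

lemma free_module_induct [consumes 1, case_names zero single add]: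
  assumes f: "f \<in> carrier (free_module K S)"
    and zero: "P (\<lambda>s. \<zero>)"
    and single: "\<And>c s. \<lbrakk>c \<in> carrier K; s \<in> S\<rbrakk> \<Longrightarrow> P (c \<odot>\<^bsub>free_module K S\<^esub> basis_vec K s)"
    and add: "\<And>f g. \<lbrakk>f \<in> carrier (free_module K S); g \<in> carrier (free_module K S); P f; P g\<rbrakk>
      \<Longrightarrow> P (f \<oplus>\<^bsub>free_module K S\<^esub> g)"
  shows "P f"
proof -
  \<comment> \<open>The induction runs over a finite set containing the support, not over the
    support itself, so the hypothesis can also be used when the coefficient at the removed point is
    zero.\<close>
  have "P f" if "finite A" "f \<in> carrier (free_module K S)" "{s. f s \<noteq> \<zero>} \<subseteq> A" for A f
    using that
  proof (induction A arbitrary: f rule: finite_induct)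
    case empty
    then have "f = (\<lambda>s. \<zero>)" by auto
    with zero show ?case by simp
  next
    case (insert a A)
    show ?case
    proof (cases "f a = \<zero>")
      case True
      with insert show ?thesis by (intro insert.IH) auto
    next
      case False
      let ?g = "f(a := \<zero>)" and ?h = "f a \<odot>\<^bsub>free_module K S\<^esub> basis_vec K a"
      have "{s. ?g s \<noteq> \<zero>} \<subseteq> {s. f s \<noteq> \<zero>}" by auto
      with insert.prems(1) have g: "?g \<in> carrier (free_module K S)"
        unfolding free_module_simps by (auto intro: finite_subset)
      have a: "a \<in> S" "f a \<in> carrier K"
        using False insert.prems(1) unfolding free_module_simps by auto
      then have h: "?h \<in> carrier (free_module K S)"
        by (simp add: module_free_module basis_vec_closed)
      have "f = ?h \<oplus>\<^bsub>free_module K S\<^esub> ?g"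
        using insert.prems(1) unfolding free_module_simps basis_vec_def by (auto simp: fun_eq_iff)
      moreover have "P ?g"
        using insert.prems insert.hyps g by (intro insert.IH[OF g]) auto
      ultimately show ?thesis
        using add[OF h g single[OF a(2,1)]] by simp
    qed
  qed
  moreover have "finite {s. f s \<noteq> \<zero>}"
    using f unfolding free_module_simps by auto
  ultimately show ?thesis using f by blast
qed

text \<open>This is the sum inside \<open>lin_ext\<close> before a representative is chosen.
  Isolating it separates linearity on the free module from independence of the
  representative.\<close>

definition lsum :: "('k, 'm) module \<Rightarrow> ('s \<Rightarrow> 'm) \<Rightarrow> ('s \<Rightarrow> 'k) \<Rightarrow> 'm" where
  "lsum M \<phi> f = (\<Oplus>\<^bsub>M\<^esub>s\<in>{s. f s \<noteq> \<zero>}. f s \<odot>\<^bsub>M\<^esub> \<phi> s)"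

text \<open>The support changes with the vector; sums for different vectors can be compared only
  over a common index set.\<close>

lemma lsum_superset:
  assumes "module K M" "\<phi> \<in> S \<rightarrow> carrier M" "f \<in> carrier (free_module K S)"
    and "finite A" "{s. f s \<noteq> \<zero>} \<subseteq> A" "A \<subseteq> S"
  shows "lsum M \<phi> f = (\<Oplus>\<^bsub>M\<^esub>s\<in>A. f s \<odot>\<^bsub>M\<^esub> \<phi> s)"
proof -
  interpret M: module K M by fact
  have c: "\<phi> s \<in> carrier M" "f s \<in> carrier K" if "s \<in> A" for s
    using assms that unfolding free_module_simps by auto
  show ?thesis
    unfolding lsum_def
    by (rule M.add.finprod_mono_neutral_cong_left) (use assms c in auto)
qed

lemma lsum_linear:
  assumes "module K M" "\<phi> \<in> S \<rightarrow> carrier M"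
  shows "linear_map K (free_module K S) M (lsum M \<phi>)"
proof (rule linearI)
  interpret M: module K M by fact
  note ms = lsum_superset[OF assms]
  fix f assume f: "f \<in> carrier (free_module K S)"
  then show "lsum M \<phi> f \<in> carrier M"
    unfolding lsum_def by (intro M.finsum_closed) (use assms f in \<open>auto simp: free_module_simps\<close>)
  {
    fix g assume g: "g \<in> carrier (free_module K S)"
    let ?A = "{s. f s \<noteq> \<zero>} \<union> {s. g s \<noteq> \<zero>}"
    have A: "finite ?A" "?A \<subseteq> S"
      using f g unfolding free_module_simps by auto
    have fg: "f \<oplus>\<^bsub>free_module K S\<^esub> g \<in> carrier (free_module K S)"
      using f g by (simp add: module_free_module)
    have c: "\<phi> s \<in> carrier M" "f s \<in> carrier K" "g s \<in> carrier K" if "s \<in> ?A" for s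
      using assms f g A(2) that unfolding free_module_simps by auto
    have "lsum M \<phi> (f \<oplus>\<^bsub>free_module K S\<^esub> g) =
        (\<Oplus>\<^bsub>M\<^esub>s\<in>?A. (f \<oplus>\<^bsub>free_module K S\<^esub> g) s \<odot>\<^bsub>M\<^esub> \<phi> s)"
      using A by (intro ms fg) (auto simp: free_module_simps)
    also have "\<dots> = (\<Oplus>\<^bsub>M\<^esub>s\<in>?A. f s \<odot>\<^bsub>M\<^esub> \<phi> s \<oplus>\<^bsub>M\<^esub> g s \<odot>\<^bsub>M\<^esub> \<phi> s)"
      by (rule M.finsum_cong') (use c in \<open>auto simp: free_module_simps M.smult_l_distr\<close>)
    also have "\<dots> = (\<Oplus>\<^bsub>M\<^esub>s\<in>?A. f s \<odot>\<^bsub>M\<^esub> \<phi> s) \<oplus>\<^bsub>M\<^esub> (\<Oplus>\<^bsub>M\<^esub>s\<in>?A. g s \<odot>\<^bsub>M\<^esub> \<phi> s)"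
      by (rule M.finsum_addf) (use c in auto)
    also have "\<dots> = lsum M \<phi> f \<oplus>\<^bsub>M\<^esub> lsum M \<phi> g"
      using A by (subst (1 2) ms[where A = ?A]) (use f g in auto)
    finally show "lsum M \<phi> (f \<oplus>\<^bsub>free_module K S\<^esub> g) = lsum M \<phi> f \<oplus>\<^bsub>M\<^esub> lsum M \<phi> g" .
  }
  fix c assume c: "c \<in> carrier K"
  let ?A = "{s. f s \<noteq> \<zero>}"
  have A: "finite ?A" "?A \<subseteq> S"
    using f unfolding free_module_simps by auto
  have cl: "\<phi> s \<in> carrier M" "f s \<in> carrier K" if "s \<in> ?A" for s
    using assms f A(2) that unfolding free_module_simps by auto
  have cf: "c \<odot>\<^bsub>free_module K S\<^esub> f \<in> carrier (free_module K S)"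
    using f c by (simp add: module_free_module)
  have "lsum M \<phi> (c \<odot>\<^bsub>free_module K S\<^esub> f) =
      (\<Oplus>\<^bsub>M\<^esub>s\<in>?A. (c \<odot>\<^bsub>free_module K S\<^esub> f) s \<odot>\<^bsub>M\<^esub> \<phi> s)"
    using A c by (intro ms cf) (auto simp: free_module_simps)
  also have "\<dots> = (\<Oplus>\<^bsub>M\<^esub>s\<in>?A. c \<odot>\<^bsub>M\<^esub> (f s \<odot>\<^bsub>M\<^esub> \<phi> s))"
    by (rule M.finsum_cong') (use c cl in \<open>auto simp: free_module_simps M.smult_assoc1\<close>)
  also have "\<dots> = c \<odot>\<^bsub>M\<^esub> (\<Oplus>\<^bsub>M\<^esub>s\<in>?A. f s \<odot>\<^bsub>M\<^esub> \<phi> s)"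
    by (rule M.finsum_smult_ldistr[symmetric]) (use A c cl in auto)
  finally show "lsum M \<phi> (c \<odot>\<^bsub>free_module K S\<^esub> f) = c \<odot>\<^bsub>M\<^esub> lsum M \<phi> f"
    unfolding lsum_def .
qed

lemma lsum_basis_vec:
  assumes "module K M" "\<phi> s \<in> carrier M"
  shows "lsum M \<phi> (basis_vec K s) = \<phi> s"
proof -
  interpret M: module K M by fact
  have "{t. basis_vec K s t \<noteq> \<zero>} = {s}"
    unfolding basis_vec_def by auto
  then show ?thesis
    unfolding lsum_def using assms(2) by (simp add: basis_vec_def)
qed

lemma lsum_cong:
  assumes "module K M" "\<phi> \<in> S \<rightarrow> carrier M" "f \<in> carrier (free_module K S)"
    and "\<And>s. s \<in> S \<Longrightarrow> \<psi> s = \<phi> s"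
  shows "lsum M \<psi> f = lsum M \<phi> f"
proof -
  interpret M: module K M by fact
  show ?thesis
    unfolding lsum_def
    by (rule M.finsum_cong') (use assms in \<open>auto simp: free_module_simps Pi_iff\<close>)
qed

lemma submodule_gen_submodule:
  assumes "module K M" "R \<subseteq> carrier M"
  shows "submodule (gen_submodule K M R) K M"
  unfolding gen_submodule_def
  by (rule submodule_Inter) (use assms module.carrier_is_submodule in auto)

lemma gen_submodule_incl: "R \<subseteq> gen_submodule K M R"
  unfolding gen_submodule_def by auto

lemma gen_submodule_least: "\<lbrakk>submodule N K M; R \<subseteq> N\<rbrakk> \<Longrightarrow> gen_submodule K M R \<subseteq> N"
  unfolding gen_submodule_def by auto

end

section \<open>Quotient spaces as spaces of cosets\<close>

locale quotient_module = M: module K M for K :: "'k ring" (structure) and M :: "('k, 'v) module" +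
  fixes N
  assumes submodule: "submodule N K M"
begin

sublocale N: abelian_subgroup N M
  by (intro abelian_subgroupI3 additive_subgroup.intro submodule.axioms(1)[OF submodule])
    (rule M.abelian_group_axioms)

text \<open>\<open>quot_module\<close> multiplies by a scalar through a union over all
  representatives. All cosets in that union coincide, since scalars preserve
  \<open>N\<close>.\<close>

lemma coset_smult:
  assumes "c \<in> carrier K" "x \<in> carrier M"
  shows "c \<odot>\<^bsub>quot_module M N\<^esub> (N +>\<^bsub>M\<^esub> x) = N +>\<^bsub>M\<^esub> (c \<odot>\<^bsub>M\<^esub> x)"
proof -
  have "N +>\<^bsub>M\<^esub> (c \<odot>\<^bsub>M\<^esub> v) = N +>\<^bsub>M\<^esub> (c \<odot>\<^bsub>M\<^esub> x)" if v: "v \<in> N +>\<^bsub>M\<^esub> x" for v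
  proof -
    obtain n where n: "n \<in> N" "v = n \<oplus>\<^bsub>M\<^esub> x"
      using v unfolding a_r_coset_def' by auto
    then have "c \<odot>\<^bsub>M\<^esub> v = c \<odot>\<^bsub>M\<^esub> n \<oplus>\<^bsub>M\<^esub> c \<odot>\<^bsub>M\<^esub> x"
      using assms by (simp add: M.smult_r_distr)
    moreover have "c \<odot>\<^bsub>M\<^esub> n \<in> N"
      using n assms submodule.smult_closed[OF submodule] by auto
    ultimately have "c \<odot>\<^bsub>M\<^esub> v \<in> N +>\<^bsub>M\<^esub> (c \<odot>\<^bsub>M\<^esub> x)"
      unfolding a_r_coset_def' by auto
    from N.a_repr_independence'[OF this] show ?thesis
      using assms by simp
  qed
  moreover have "x \<in> N +>\<^bsub>M\<^esub> x"
    using assms N.a_rcos_self by auto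
  ultimately have "(\<Union>v\<in>N +>\<^bsub>M\<^esub> x. N +>\<^bsub>M\<^esub> (c \<odot>\<^bsub>M\<^esub> v)) = N +>\<^bsub>M\<^esub> (c \<odot>\<^bsub>M\<^esub> x)"
    by blast
  then show ?thesis
    by (simp add: quot_module_def)
qed

lemma coset_add:
  assumes "x \<in> carrier M" "y \<in> carrier M"
  shows "(N +>\<^bsub>M\<^esub> x) \<oplus>\<^bsub>quot_module M N\<^esub> (N +>\<^bsub>M\<^esub> y) = N +>\<^bsub>M\<^esub> (x \<oplus>\<^bsub>M\<^esub> y)"
  using assms N.a_rcos_sum unfolding quot_module_def by simp

lemma coset_zero: "\<zero>\<^bsub>quot_module M N\<^esub> = N +>\<^bsub>M\<^esub> \<zero>\<^bsub>M\<^esub>"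
  unfolding quot_module_def using N.a_rcos_const[of "\<zero>\<^bsub>M\<^esub>"] by simp

lemma coset_carrier: "carrier (quot_module M N) = (\<lambda>x. N +>\<^bsub>M\<^esub> x) ` carrier M"
  unfolding quot_module_def A_RCOSETS_def' by auto

lemma coset_eq:
  assumes "x \<in> carrier M" "y \<in> carrier M" "x \<ominus>\<^bsub>M\<^esub> y \<in> N"
  shows "N +>\<^bsub>M\<^esub> x = N +>\<^bsub>M\<^esub> y"
proof -
  have "x \<in> N +>\<^bsub>M\<^esub> y"
    using assms N.a_rcos_module_rev by (simp add: a_minus_def)
  then show ?thesis
    using N.a_repr_independence' assms(2) by auto
qed

lemma module_quot_module: "module K (quot_module M N)"
proof (rule moduleI)
  show "abelian_group (quot_module M N)"
  proof (rule abelian_groupI, goal_cases)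
    case (6 x)
    then obtain a where "a \<in> carrier M" "x = N +>\<^bsub>M\<^esub> a"
      unfolding coset_carrier by auto
    then show ?case
      unfolding coset_carrier
      by (auto simp: coset_add coset_zero M.l_neg intro!: bexI[of _ "\<ominus>\<^bsub>M\<^esub> a"])
  next
    case (4 x y)
    then show ?case
      by (auto simp: coset_carrier coset_add M.a_comm)
  qed (auto simp: coset_carrier coset_add coset_zero M.a_assoc)
qed (auto simp: coset_carrier coset_add coset_smult M.smult_l_distr M.smult_r_distr
  M.smult_assoc1 M.R.is_cring)

end

section \<open>Vector spaces given by generators and relations\<close>

locale presentation = linear_algebra K for K :: "'k ring" (structure) +
  fixes S :: "'s set" and R :: "('s \<Rightarrow> 'k) set"
  assumes relations: "R \<subseteq> carrier (free_module K S)"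
begin

abbreviation "F \<equiv> free_module K S"
abbreviation "P \<equiv> presented K S R"

sublocale quotient_module K F "gen_submodule K F R"
  by (intro quotient_module.intro quotient_module_axioms.intro module_free_module
      submodule_gen_submodule relations)

lemma module_presented: "module K P"
  using module_quot_module unfolding presented_def .

lemma coset_linear: "linear_map K F P (\<lambda>f. gen_submodule K F R +>\<^bsub>F\<^esub> f)"
  by (rule linearI) (auto simp: presented_def coset_carrier coset_add coset_smult)

lemma gen_class_closed: "s \<in> S \<Longrightarrow> gen_class K S R s \<in> carrier P"
  unfolding gen_class_def by (intro linear_closed[OF coset_linear] basis_vec_closed)

lemma presented_induct [consumes 1, case_names zero single add]:
  assumes t: "t \<in> carrier P"
    and zero: "Q \<zero>\<^bsub>P\<^esub>"
    and single: "\<And>c s. \<lbrakk>c \<in> carrier K; s \<in> S\<rbrakk> \<Longrightarrow> Q (c \<odot>\<^bsub>P\<^esub> gen_class K S R s)"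
    and add: "\<And>u v. \<lbrakk>u \<in> carrier P; v \<in> carrier P; Q u; Q v\<rbrakk> \<Longrightarrow> Q (u \<oplus>\<^bsub>P\<^esub> v)"
  shows "Q t"
proof -
  obtain f where f: "f \<in> carrier F" "t = gen_submodule K F R +>\<^bsub>F\<^esub> f"
    using t unfolding presented_def coset_carrier by auto
  have "Q (gen_submodule K F R +>\<^bsub>F\<^esub> f)"
    using f(1)
  proof (induction rule: free_module_induct)
    case zero
    then show ?case
      using assms(2) unfolding presented_def coset_zero by (simp add: free_module_simps)
  next
    case (single c s)
    then show ?case
      using assms(3)[OF single] unfolding gen_class_def
      by (simp add: linear_smult[OF coset_linear] basis_vec_closed)
  next
    case (add f g)
    then show ?case
      using linear_closed[OF coset_linear] assms(4)
      by (simp add: linear_add[OF coset_linear])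
  qed
  with f(2) show ?thesis by simp
qed

context
  fixes M :: "('k, 'm) module" and \<phi>
  assumes M: "module K M" and \<phi>: "\<phi> \<in> S \<rightarrow> carrier M"
    and kills: "\<And>r. r \<in> R \<Longrightarrow> lsum M \<phi> r = \<zero>\<^bsub>M\<^esub>"
begin

text \<open>The kernel of the linear extension is a submodule containing the relations, hence
  contains what they generate. The extension is therefore constant on cosets, and the choice made in
  \<open>lin_ext\<close> is harmless.\<close>

lemma lin_ext_coset:
  assumes "f \<in> carrier F"
  shows "lin_ext K M \<phi> (gen_submodule K F R +>\<^bsub>F\<^esub> f) = lsum M \<phi> f"
proof -
  interpret M: module K M by (rule M)
  let ?N = "gen_submodule K F R"
  note lin = lsum_linear[OF M \<phi>]
  have "submodule {v \<in> carrier F. lsum M \<phi> v \<in> {\<zero>\<^bsub>M\<^esub>}} K F"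
    by (rule submodule_linear_vimage[OF lin submodule_zero[OF M] module_free_module M])
  from gen_submodule_least[OF this] have N: "lsum M \<phi> n = \<zero>\<^bsub>M\<^esub>" if "n \<in> ?N" for n
    using that kills relations by blast
  have "lsum M \<phi> g = lsum M \<phi> f" if g: "g \<in> ?N +>\<^bsub>F\<^esub> f" for g
  proof -
    obtain n where n: "n \<in> ?N" "g = n \<oplus>\<^bsub>F\<^esub> f"
      using g unfolding a_r_coset_def' by auto
    with assms N show ?thesis
      using linear_closed[OF lin assms] by (simp add: linear_add[OF lin])
  qed
  moreover have "(SOME g. g \<in> ?N +>\<^bsub>F\<^esub> f) \<in> ?N +>\<^bsub>F\<^esub> f"
    using N.a_rcos_self[OF assms] by (rule someI[where P = "\<lambda>g. g \<in> ?N +>\<^bsub>F\<^esub> f"])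
  ultimately show ?thesis
    unfolding lin_ext_def Let_def lsum_def by blast
qed

lemma lin_ext_linear: "linear_map K P M (lin_ext K M \<phi>)"
proof (rule linearI)
  note lin = lsum_linear[OF M \<phi>]
  note coset = linear_add[OF coset_linear, symmetric] linear_smult[OF coset_linear, symmetric]
  fix x assume "x \<in> carrier P"
  then obtain f where f: "f \<in> carrier F" "x = gen_submodule K F R +>\<^bsub>F\<^esub> f"
    unfolding presented_def coset_carrier by auto
  show "lin_ext K M \<phi> x \<in> carrier M"
    using f linear_closed[OF lin] by (simp add: lin_ext_coset)
  show "lin_ext K M \<phi> (c \<odot>\<^bsub>P\<^esub> x) = c \<odot>\<^bsub>M\<^esub> lin_ext K M \<phi> x" if "c \<in> carrier K" for c
    using f that by (simp add: coset lin_ext_coset linear_smult[OF lin])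
  fix y assume "y \<in> carrier P"
  then obtain g where g: "g \<in> carrier F" "y = gen_submodule K F R +>\<^bsub>F\<^esub> g"
    unfolding presented_def coset_carrier by auto
  show "lin_ext K M \<phi> (x \<oplus>\<^bsub>P\<^esub> y) = lin_ext K M \<phi> x \<oplus>\<^bsub>M\<^esub> lin_ext K M \<phi> y"
    using f g by (simp add: coset lin_ext_coset linear_add[OF lin])
qed

lemma lin_ext_gen: "s \<in> S \<Longrightarrow> lin_ext K M \<phi> (gen_class K S R s) = \<phi> s"
  unfolding gen_class_def using \<phi>
  by (simp add: lin_ext_coset basis_vec_closed lsum_basis_vec[OF M] Pi_iff)

end

text \<open>Both sides evaluate the same chosen representative, whose support lies in
  \<open>S\<close>, so only the values on \<open>S\<close> enter.\<close>

lemma lin_ext_cong: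
  assumes "module K M" "\<phi> \<in> S \<rightarrow> carrier M" "t \<in> carrier P"
    and "\<And>s. s \<in> S \<Longrightarrow> \<psi> s = \<phi> s"
  shows "lin_ext K M \<psi> t = lin_ext K M \<phi> t"
proof -
  obtain f where f: "f \<in> carrier F" "t = gen_submodule K F R +>\<^bsub>F\<^esub> f"
    using assms(3) unfolding presented_def coset_carrier by auto
  then have "(SOME g. g \<in> t) \<in> t"
    using N.a_rcos_self[OF f(1)] someI[where P = "\<lambda>g. g \<in> t"] by blast
  with f have "(SOME g. g \<in> t) \<in> carrier F"
    using N.a_elemrcos_carrier by blast
  from lsum_cong[OF assms(1,2) this assms(4)] show ?thesis
    unfolding lin_ext_def lsum_def Let_def by simp
qed

end

section \<open>Multilinear calculus in tensor products\<close>

context linear_algebra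
begin

definition bilinear ::
  "('k, 'a) module \<Rightarrow> ('k, 'b) module \<Rightarrow> ('k, 'm) module \<Rightarrow> ('a \<Rightarrow> 'b \<Rightarrow> 'm) \<Rightarrow> bool" where
  "bilinear A B M \<phi> \<longleftrightarrow>
     (\<forall>a\<in>carrier A. linear_map K B M (\<lambda>b. \<phi> a b)) \<and> (\<forall>b\<in>carrier B. linear_map K A M (\<lambda>a. \<phi> a b))"

lemma bilinearI:
  assumes "\<And>a. a \<in> carrier A \<Longrightarrow> linear_map K B M (\<lambda>b. \<phi> a b)"
    and "\<And>b. b \<in> carrier B \<Longrightarrow> linear_map K A M (\<lambda>a. \<phi> a b)"
  shows "bilinear A B M \<phi>"
  using assms unfolding bilinear_def by auto

lemma bilinearD:
  assumes "bilinear A B M \<phi>"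
  shows "a \<in> carrier A \<Longrightarrow> linear_map K B M (\<lambda>b. \<phi> a b)"
    and "b \<in> carrier B \<Longrightarrow> linear_map K A M (\<lambda>a. \<phi> a b)"
  using assms unfolding bilinear_def by auto

lemma bilinear_closed:
  "\<lbrakk>bilinear A B M \<phi>; a \<in> carrier A; b \<in> carrier B\<rbrakk> \<Longrightarrow> \<phi> a b \<in> carrier M"
  by (rule linear_closed[OF bilinearD(1)])

text \<open>
  The body is cut off outside the carriers, so that the congruence rule below lets the simplifier
  use membership of the bound variables.
\<close>

definition bnd ::
  "('k, 'a) module \<Rightarrow> ('k, 'b) module \<Rightarrow> ('k, 'm) module \<Rightarrow> ('k, 'a, 'b) tens \<Rightarrow>
   ('a \<Rightarrow> 'b \<Rightarrow> 'm) \<Rightarrow> 'm" where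
  "bnd A B M t \<phi> =
     lin_ext K M (\<lambda>(a, b). if a \<in> carrier A \<and> b \<in> carrier B then \<phi> a b else \<zero>\<^bsub>M\<^esub>) t"

lemma bnd_cong [cong]:
  assumes "A = A'" "B = B'" "M = M'" "t = t'"
    and "\<And>a b. \<lbrakk>a \<in> carrier A'; b \<in> carrier B'\<rbrakk> \<Longrightarrow> \<phi> a b = \<psi> a b"
  shows "bnd A B M t \<phi> = bnd A' B' M' t' \<psi>"
proof -
  have "(\<lambda>(a, b). if a \<in> carrier A' \<and> b \<in> carrier B' then \<phi> a b else \<zero>\<^bsub>M'\<^esub>) =
      (\<lambda>(a, b). if a \<in> carrier A' \<and> b \<in> carrier B' then \<psi> a b else \<zero>\<^bsub>M'\<^esub>)"
    using assms(5) by (auto simp: fun_eq_iff)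
  then show ?thesis
    unfolding bnd_def assms(1-4) by simp
qed

section \<open>The universal property of the tensor product\<close>

lemma tensor_presentation:
  assumes "module K A" "module K B"
  shows "presentation K (carrier A \<times> carrier B) (tensor_rels K A B)"
proof unfold_locales
  show "tensor_rels K A B \<subseteq> carrier (free_module K (carrier A \<times> carrier B))"
    unfolding tensor_rels_def Let_def using assms
    by (auto simp: basis_vec_closed module_free_module)
qed

lemma module_tensor [simp]:
  "\<lbrakk>module K A; module K B\<rbrakk> \<Longrightarrow> module K (tensor K A B)"
  unfolding tensor_def by (intro presentation.module_presented tensor_presentation)

lemma pure_closed [simp]:
  "\<lbrakk>module K A; module K B; a \<in> carrier A; b \<in> carrier B\<rbrakk> \<Longrightarrow>
    pure K A B a b \<in> carrier (tensor K A B)"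
  unfolding tensor_def pure_def by (intro presentation.gen_class_closed tensor_presentation) auto

lemma bilinear_kills_tensor_rels:
  assumes "module K A" "module K B" "module K M" "bilinear A B M \<phi>" "r \<in> tensor_rels K A B"
  shows "lsum M (\<lambda>(a, b). \<phi> a b) r = \<zero>\<^bsub>M\<^esub>"
proof -
  interpret M: module K M by fact
  let ?S = "carrier A \<times> carrier B"
  note mods = module_free_module[of ?S] assms(3)
  interpret F: module K "free_module K ?S"
    by (rule module_free_module)
  have \<phi>: "(\<lambda>(a, b). \<phi> a b) \<in> ?S \<rightarrow> carrier M"
    using bilinear_closed[OF assms(4)] by auto
  note L = lsum_linear[OF assms(3) \<phi>]
  have e: "lsum M (\<lambda>(a, b). \<phi> a b) (basis_vec K (a, b)) = \<phi> a b" 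
    if "a \<in> carrier A" "b \<in> carrier B" for a b
    using lsum_basis_vec[OF assms(3), of "\<lambda>(a, b). \<phi> a b" "(a, b)"] that
      bilinear_closed[OF assms(4)] by simp
  have M0: "x \<in> carrier M \<Longrightarrow> x \<ominus>\<^bsub>M\<^esub> x = \<zero>\<^bsub>M\<^esub>" for x
    by (simp add: M.r_neg a_minus_def)
  show ?thesis
    using assms(1,2,5) unfolding tensor_rels_def Let_def
    by (auto simp: linear_minus[OF L mods] linear_add[OF L] linear_smult[OF L] basis_vec_closed e M0
        linear_add[OF bilinearD(1)[OF assms(4)]] linear_add[OF bilinearD(2)[OF assms(4)]]
        linear_smult[OF bilinearD(1)[OF assms(4)]] linear_smult[OF bilinearD(2)[OF assms(4)]]
        bilinear_closed[OF assms(4)])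
qed

lemma bilinear_cong:
  assumes "bilinear A B M \<phi>" "module K A" "module K B"
    and "\<And>a b. \<lbrakk>a \<in> carrier A; b \<in> carrier B\<rbrakk> \<Longrightarrow> \<psi> a b = \<phi> a b"
  shows "bilinear A B M \<psi>"
  by (rule bilinearI; rule linear_cong) (use assms bilinearD[OF assms(1)] in auto)

context
  fixes A :: "('k, 'a) module" and B :: "('k, 'b) module" and M :: "('k, 'm) module" and \<phi>
  assumes mods [simp]: "module K A" "module K B" "module K M" and bil: "bilinear A B M \<phi>"
begin

lemma bnd_linear_facts:
  shows bnd_linear: "linear_map K (tensor K A B) M (\<lambda>t. bnd A B M t \<phi>)"
    and bnd_pure: "\<lbrakk>a \<in> carrier A; b \<in> carrier B\<rbrakk> \<Longrightarrow> bnd A B M (pure K A B a b) \<phi> = \<phi> a b"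
proof -
  let ?\<phi> = "\<lambda>a b. if a \<in> carrier A \<and> b \<in> carrier B then \<phi> a b else \<zero>\<^bsub>M\<^esub>"
  have bil': "bilinear A B M ?\<phi>"
    by (rule bilinear_cong[OF bil]) auto
  note facts = tensor_presentation[OF mods(1,2)] mods(3)
  have eq: "(\<lambda>(a, b). ?\<phi> a b) \<in> carrier A \<times> carrier B \<rightarrow> carrier M"
    using bilinear_closed[OF bil] by auto
  show "linear_map K (tensor K A B) M (\<lambda>t. bnd A B M t \<phi>)"
    unfolding bnd_def tensor_def
    by (rule presentation.lin_ext_linear[OF facts eq bilinear_kills_tensor_rels[OF mods bil']])
  show "bnd A B M (pure K A B a b) \<phi> = \<phi> a b" if "a \<in> carrier A" "b \<in> carrier B"
    using presentation.lin_ext_gen[OF facts eq bilinear_kills_tensor_rels[OF mods bil'], of "(a, b)"]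
      that unfolding bnd_def pure_def by simp
qed

lemmas bnd_closed = linear_closed[OF bnd_linear]

text \<open>The passage from the raw \<open>lin_ext\<close> of the definitions to
  \<open>bnd\<close>. Separate \<open>\<psi>\<close> and \<open>\<phi>\<close> allow the integrand,
  which may itself contain a \<open>lin_ext\<close>, to be rewritten in the same step.\<close>

lemma lin_ext_eq_bnd:
  assumes "t \<in> carrier (tensor K A B)"
    and "\<And>a b. \<lbrakk>a \<in> carrier A; b \<in> carrier B\<rbrakk> \<Longrightarrow> \<psi> a b = \<phi> a b"
  shows "lin_ext K M (\<lambda>(a, b). \<psi> a b) t = bnd A B M t \<phi>"
  unfolding bnd_def
  by (rule presentation.lin_ext_cong[OF tensor_presentation[OF mods(1,2)] mods(3)])
    (use assms bilinear_closed[OF bil] in \<open>auto simp: tensor_def\<close>)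

end

text \<open>Each law says that two vectors of the free module have the same coset, and their
  difference is literally one of the relations.\<close>

lemma pure_bilinear:
  assumes [simp]: "module K A" "module K B"
  shows "bilinear A B (tensor K A B) (pure K A B)"
proof -
  let ?S = "carrier A \<times> carrier B"
  interpret T: presentation K ?S "tensor_rels K A B"
    by (rule tensor_presentation) auto
  have eq: "T.P = tensor K A B"
    unfolding tensor_def ..
  note L = T.coset_linear[unfolded eq]
  define q where "q = (\<lambda>f. gen_submodule K (free_module K ?S) (tensor_rels K A B) +>\<^bsub>free_module K ?S\<^esub> f)"
  have p: "pure K A B a b = q (basis_vec K (a, b))" for a b
    unfolding pure_def gen_class_def q_def ..
  have q: "q f = q g" if "f \<ominus>\<^bsub>free_module K ?S\<^esub> g \<in> tensor_rels K A B"
    "f \<in> carrier (free_module K ?S)" "g \<in> carrier (free_module K ?S)" for f g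
    unfolding q_def using that(2,3) subsetD[OF gen_submodule_incl that(1)] by (rule T.coset_eq)
  note Lq = L[folded q_def]
  note ls = linear_add[OF Lq, symmetric] linear_smult[OF Lq, symmetric] basis_vec_closed
    module_free_module
  show ?thesis
  proof (rule bilinearI; rule linearI)
    fix a b assume "a \<in> carrier A" "b \<in> carrier B"
    then show "pure K A B a b \<in> carrier (tensor K A B)" by simp
    show "pure K A B a b \<in> carrier (tensor K A B)" by (simp add: \<open>a \<in> _\<close> \<open>b \<in> _\<close>)
  next
    fix a b b' assume *: "a \<in> carrier A" "b \<in> carrier B" "b' \<in> carrier B"
    show "pure K A B a (b \<oplus>\<^bsub>B\<^esub> b') = pure K A B a b \<oplus>\<^bsub>tensor K A B\<^esub> pure K A B a b'"
      unfolding p using * by (simp add: ls, intro q)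
        (auto simp: basis_vec_closed module_free_module tensor_rels_def Let_def)
  next
    fix a b c assume *: "a \<in> carrier A" "b \<in> carrier B" "c \<in> carrier K"
    show "pure K A B a (c \<odot>\<^bsub>B\<^esub> b) = c \<odot>\<^bsub>tensor K A B\<^esub> pure K A B a b"
      unfolding p using * by (simp add: ls, intro q)
        (auto simp: basis_vec_closed module_free_module tensor_rels_def Let_def)
  next
    fix a a' b assume *: "a \<in> carrier A" "b \<in> carrier B" "a' \<in> carrier A"
    show "pure K A B (a \<oplus>\<^bsub>A\<^esub> a') b = pure K A B a b \<oplus>\<^bsub>tensor K A B\<^esub> pure K A B a' b"
      unfolding p using * by (simp add: ls, intro q)
        (auto simp: basis_vec_closed module_free_module tensor_rels_def Let_def)
  next
    fix a b c assume *: "a \<in> carrier A" "b \<in> carrier B" "c \<in> carrier K"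
    show "pure K A B (c \<odot>\<^bsub>A\<^esub> a) b = c \<odot>\<^bsub>tensor K A B\<^esub> pure K A B a b"
      unfolding p using * by (simp add: ls, intro q)
        (auto simp: basis_vec_closed module_free_module tensor_rels_def Let_def)
  qed
qed

text \<open>Zero and scalar multiples of pure tensors are again pure, because the scalar can be
  absorbed into the left factor; so pure tensors and sums are the only cases.\<close>

lemma tensor_induct [consumes 3, case_names pure add]:
  assumes [simp]: "module K A" "module K B" and t: "t \<in> carrier (tensor K A B)"
    and pure: "\<And>a b. \<lbrakk>a \<in> carrier A; b \<in> carrier B\<rbrakk> \<Longrightarrow> Q (pure K A B a b)"
    and add: "\<And>u v. \<lbrakk>u \<in> carrier (tensor K A B); v \<in> carrier (tensor K A B); Q u; Q v\<rbrakk>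
      \<Longrightarrow> Q (u \<oplus>\<^bsub>tensor K A B\<^esub> v)"
  shows "Q t"
proof -
  interpret T: presentation K "carrier A \<times> carrier B" "tensor_rels K A B"
    by (rule tensor_presentation) auto
  note bil = bilinearD[OF pure_bilinear[OF assms(1,2)]]
  show ?thesis
  proof (rule T.presented_induct[of t Q, folded tensor_def])
    have "pure K A B \<zero>\<^bsub>A\<^esub> \<zero>\<^bsub>B\<^esub> = \<zero>\<^bsub>tensor K A B\<^esub>"
      by (rule linear_zero[OF bil(1)]) auto
    then show "Q \<zero>\<^bsub>tensor K A B\<^esub>"
      using pure[of "\<zero>\<^bsub>A\<^esub>" "\<zero>\<^bsub>B\<^esub>"] by simp
  next
    fix c s assume *: "c \<in> carrier K" "s \<in> carrier A \<times> carrier B"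
    then obtain a b where ab: "s = (a, b)" "a \<in> carrier A" "b \<in> carrier B" by auto
    have "c \<odot>\<^bsub>tensor K A B\<^esub> pure K A B a b = pure K A B (c \<odot>\<^bsub>A\<^esub> a) b"
      using linear_smult[OF bil(2)] * ab by simp
    with * ab pure show "Q (c \<odot>\<^bsub>tensor K A B\<^esub> gen_class K (carrier A \<times> carrier B) (tensor_rels K A B) s)"
      by (simp add: pure_def)
  qed (use t add in auto)
qed

lemma tensor_ext:
  assumes "module K A" "module K B" "t \<in> carrier (tensor K A B)"
    and "linear_map K (tensor K A B) M f" "linear_map K (tensor K A B) M g"
    and "\<And>a b. \<lbrakk>a \<in> carrier A; b \<in> carrier B\<rbrakk> \<Longrightarrow> f (pure K A B a b) = g (pure K A B a b)"
  shows "f t = g t"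
  using assms(1-3)
proof (induction rule: tensor_induct)
  case (pure a b)
  then show ?case using assms by blast
next
  case (add u v)
  then show ?case by (simp add: linear_add[OF assms(4)] linear_add[OF assms(5)])
qed

lemma linear_pure:
  assumes "module K A" "module K B"
  shows linear_pure_left: "\<lbrakk>linear_map K V A f; b \<in> carrier B\<rbrakk> \<Longrightarrow>
      linear_map K V (tensor K A B) (\<lambda>v. pure K A B (f v) b)"
    and linear_pure_right: "\<lbrakk>linear_map K V B g; a \<in> carrier A\<rbrakk> \<Longrightarrow>
      linear_map K V (tensor K A B) (\<lambda>v. pure K A B a (g v))"
  using bilinearD[OF pure_bilinear[OF assms]] by (auto intro: linear_compose)

lemma linear_sum:
  assumes "linear_map K V M f" "linear_map K V M g" "module K M"
  shows "linear_map K V M (\<lambda>v. f v \<oplus>\<^bsub>M\<^esub> g v)"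
proof -
  interpret M: module K M by fact
  show ?thesis
    by (rule linearI)
      (use assms in \<open>auto simp: linear_closed linear_add linear_smult M.a_ac M.smult_r_distr\<close>)
qed

lemma linear_scale:
  assumes "linear_map K V M f" "module K M" "c \<in> carrier K"
  shows "linear_map K V M (\<lambda>v. c \<odot>\<^bsub>M\<^esub> f v)"
proof -
  interpret M: module K M by fact
  show ?thesis
    by (rule linearI)
      (use assms in \<open>auto simp: linear_closed linear_add linear_smult M.smult_r_distr
        M.smult_assoc1[symmetric] m_comm\<close>)
qed

lemma linear_bnd_arg:
  assumes "module K A" "module K B" "module K M" "linear_map K V (tensor K A B) f" "bilinear A B M \<phi>"
  shows "linear_map K V M (\<lambda>v. bnd A B M (f v) \<phi>)"
  by (rule linear_compose[OF assms(4) bnd_linear[OF assms(1-3,5)]])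

text \<open>Here the tensor is fixed and the integrand depends on a parameter. With
  \<open>linear_bnd_arg\<close>, where the tensor varies, this makes bilinearity of nested Sweedler
  sums a matter of simplification. The proof is an induction on the tensor.\<close>

lemma linear_bnd_body:
  assumes mods [simp]: "module K V" "module K A" "module K B" "module K M"
    and t: "t \<in> carrier (tensor K A B)"
    and bil: "\<And>v. v \<in> carrier V \<Longrightarrow> bilinear A B M (\<lambda>a b. \<phi> v a b)"
    and lin: "\<And>a b. \<lbrakk>a \<in> carrier A; b \<in> carrier B\<rbrakk> \<Longrightarrow> linear_map K V M (\<lambda>v. \<phi> v a b)"
  shows "linear_map K V M (\<lambda>v. bnd A B M t (\<lambda>a b. \<phi> v a b))"
  using mods(2,3) t
proof (induction rule: tensor_induct)
  case (pure a b)
  show ?case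
    by (rule linear_cong[OF lin[OF pure]]) (use pure bil in \<open>auto simp: bnd_pure\<close>)
next
  case (add s t)
  show ?case
    by (rule linear_cong[OF linear_sum[OF add(3,4)]])
      (use add bil in \<open>auto simp: linear_add[OF bnd_linear]\<close>)
qed

text \<open>A linear map passes through a Sweedler sum: both sides are linear in the tensor and
  agree on pure tensors. Nearly all computations below rest on this.\<close>

lemma linear_image_bnd:
  assumes mods [simp]: "module K A" "module K B" "module K M" "module K N"
    and g: "linear_map K M N g" and bil: "bilinear A B M \<phi>" and t: "t \<in> carrier (tensor K A B)"
  shows "g (bnd A B M t \<phi>) = bnd A B N t (\<lambda>a b. g (\<phi> a b))"
proof -
  have bil': "bilinear A B N (\<lambda>a b. g (\<phi> a b))"
    by (rule bilinearI; rule linear_compose[OF _ g]) (use bilinearD[OF bil] in auto)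
  show ?thesis
    by (rule tensor_ext[OF mods(1,2) t linear_compose[OF bnd_linear g] bnd_linear])
      (use bil bil' in \<open>auto simp: bnd_pure\<close>)
qed

lemmas linear_rules = linear_ident linear_pure linear_sum linear_scale linear_bnd_arg linear_bnd_body

text \<open>Two Sweedler sums over independent tensors commute. On a pure tensor \<open>t\<close>
  both sides reduce to the same single sum over \<open>s\<close>.\<close>

lemma bnd_swap:
  assumes mods [simp]: "module K A" "module K B" "module K C" "module K D" "module K M"
    and t: "t \<in> carrier (tensor K A B)" and s: "s \<in> carrier (tensor K C D)"
    and 1: "\<And>a b. \<lbrakk>a \<in> carrier A; b \<in> carrier B\<rbrakk> \<Longrightarrow> bilinear C D M (\<lambda>c d. \<phi> a b c d)"
    and 2: "\<And>c d. \<lbrakk>c \<in> carrier C; d \<in> carrier D\<rbrakk> \<Longrightarrow> bilinear A B M (\<lambda>a b. \<phi> a b c d)"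
  shows "bnd A B M t (\<lambda>a b. bnd C D M s (\<lambda>c d. \<phi> a b c d)) =
    bnd C D M s (\<lambda>c d. bnd A B M t (\<lambda>a b. \<phi> a b c d))"
proof -
  have 3: "bilinear A B M (\<lambda>a b. bnd C D M s (\<lambda>c d. \<phi> a b c d))"
    by (rule bilinearI; rule linear_bnd_body) (use s 1 bilinearD[OF 2] in auto)
  have "bilinear C D M (\<lambda>c d. bnd A B M t (\<lambda>a b. \<phi> a b c d))"
    if "t \<in> carrier (tensor K A B)" for t
    by (rule bilinearI; rule linear_bnd_body) (use that 2 bilinearD[OF 1] in auto)
  note 4 = this
  have lin: "linear_map K (tensor K A B) M (\<lambda>t. bnd C D M s (\<lambda>c d. bnd A B M t (\<lambda>a b. \<phi> a b c d)))"
    by (rule linear_bnd_body) (use s 4 bnd_linear[OF mods(1,2,5) 2] in auto)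
  show ?thesis
    by (rule tensor_ext[OF mods(1,2) t bnd_linear[OF mods(1,2,5) 3] lin])
      (use 1 2 3 in \<open>simp add: bnd_pure\<close>)
qed

lemma tensor_map_eq_bnd:
  assumes [simp]: "module K V" "module K W" "module K V'" "module K W'"
    and "linear_map K V V' f" "linear_map K W W' g" "t \<in> carrier (tensor K V W)"
  shows "tensor_map K V' W' f g t = bnd V W (tensor K V' W') t (\<lambda>v w. pure K V' W' (f v) (g w))"
  unfolding tensor_map_def
  by (rule lin_ext_eq_bnd)
    (use assms(5-) in \<open>auto intro!: bilinearI linear_pure intro: linear_closed\<close>)

lemma tensor_assoc_eq_bnd:
  assumes [simp]: "module K U" "module K V" "module K W"
    and "t \<in> carrier (tensor K (tensor K U V) W)"
  defines "N \<equiv> tensor K U (tensor K V W)"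
  shows "tensor_assoc K U V W t =
    bnd (tensor K U V) W N t (\<lambda>s w. bnd U V N s (\<lambda>u v. pure K U (tensor K V W) u (pure K V W v w)))"
proof -
  have [simp]: "module K N"
    unfolding N_def by simp
  have b: "bilinear U V N (\<lambda>u v. pure K U (tensor K V W) u (pure K V W v w))"
    if "w \<in> carrier W" for w
    unfolding N_def using that by (intro bilinearI linear_rules) auto
  have c: "linear_map K W N (\<lambda>w. pure K U (tensor K V W) u (pure K V W v w))"
    if "u \<in> carrier U" "v \<in> carrier V" for u v
    unfolding N_def using that by (intro linear_rules) auto
  show ?thesis
    unfolding tensor_assoc_def N_def[symmetric]
  proof (rule lin_ext_eq_bnd)
    show "bilinear (tensor K U V) W N
      (\<lambda>s w. bnd U V N s (\<lambda>u v. pure K U (tensor K V W) u (pure K V W v w)))"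
      by (rule bilinearI; (rule linear_bnd_body | rule linear_bnd_arg))
        (use b c in \<open>auto intro: linear_ident\<close>)
  next
    fix s w assume "s \<in> carrier (tensor K U V)" "w \<in> carrier W"
    then show "lin_ext K N (\<lambda>(u, v). pure K U (tensor K V W) u (pure K V W v w)) s =
        bnd U V N s (\<lambda>u v. pure K U (tensor K V W) u (pure K V W v w))"
      using b by (intro lin_ext_eq_bnd) auto
  qed (use assms in auto)
qed

end

section \<open>Multilinear maps on iterated tensor products\<close>

context linear_algebra
begin

text \<open>The factors from Y sit in a list of fixed length, so linearity in one slot is linearity
  under updating one position.\<close>

definition multilinear ::
  "('k, 'y) module \<Rightarrow> ('k, 'x) module \<Rightarrow> ('k, 'm) module \<Rightarrow> nat \<Rightarrow> ('y list \<Rightarrow> 'x \<Rightarrow> 'm) \<Rightarrow> bool"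
  where
  "multilinear Y X M n \<phi> \<longleftrightarrow>
     (\<forall>ys. set ys \<subseteq> carrier Y \<and> length ys = n \<longrightarrow>
       linear_map K X M (\<phi> ys) \<and>
       (\<forall>i<n. \<forall>x\<in>carrier X. linear_map K Y M (\<lambda>y. \<phi> (ys[i := y]) x)))"

lemma multilinearI:
  assumes "\<And>ys. \<lbrakk>set ys \<subseteq> carrier Y; length ys = n\<rbrakk> \<Longrightarrow> linear_map K X M (\<lambda>x. \<phi> ys x)"
    and "\<And>ys i x. \<lbrakk>set ys \<subseteq> carrier Y; length ys = n; i < n; x \<in> carrier X\<rbrakk> \<Longrightarrow>
      linear_map K Y M (\<lambda>y. \<phi> (ys[i := y]) x)"
  shows "multilinear Y X M n \<phi>"
  using assms unfolding multilinear_def by auto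

lemma multilinearD:
  assumes "multilinear Y X M n \<phi>" "set ys \<subseteq> carrier Y" "length ys = n"
  shows "linear_map K X M (\<lambda>x. \<phi> ys x)"
    and "\<lbrakk>i < n; x \<in> carrier X\<rbrakk> \<Longrightarrow> linear_map K Y M (\<lambda>y. \<phi> (ys[i := y]) x)"
  using assms unfolding multilinear_def by auto

lemma set_update_subset [simp]:
  "\<lbrakk>set ys \<subseteq> A; y \<in> A\<rbrakk> \<Longrightarrow> set (ys[i := y]) \<subseteq> A"
  by (meson insert_subset order_trans set_update_subset_insert subset_insertI2)

lemma mtens_presentation:
  assumes "module K Y" "module K X"
  shows "presentation K (mtens_gens Y X n) (mtens_rels K Y X n)"
proof unfold_locales
  show "mtens_rels K Y X n \<subseteq> carrier (free_module K (mtens_gens Y X n))"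
    unfolding mtens_rels_def Let_def using assms
    by (auto simp: basis_vec_closed module_free_module mtens_gens_def)
qed

lemma mtens_relsI:
  fixes Y :: "('k, 'y) module" and X :: "('k, 'x) module" and n
  defines "G \<equiv> mtens_gens Y X n" and "F \<equiv> free_module K (mtens_gens Y X n)"
  shows "\<lbrakk>(ys, x) \<in> G; i < n; a \<in> carrier Y; b \<in> carrier Y\<rbrakk> \<Longrightarrow>
      basis_vec K (ys[i := a \<oplus>\<^bsub>Y\<^esub> b], x) \<ominus>\<^bsub>F\<^esub>
        (basis_vec K (ys[i := a], x) \<oplus>\<^bsub>F\<^esub> basis_vec K (ys[i := b], x)) \<in> mtens_rels K Y X n"
    and "\<lbrakk>(ys, x) \<in> G; i < n; c \<in> carrier K; a \<in> carrier Y\<rbrakk> \<Longrightarrow>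
      basis_vec K (ys[i := c \<odot>\<^bsub>Y\<^esub> a], x) \<ominus>\<^bsub>F\<^esub> (c \<odot>\<^bsub>F\<^esub> basis_vec K (ys[i := a], x))
        \<in> mtens_rels K Y X n"
    and "\<lbrakk>(ys, x) \<in> G; (ys, x') \<in> G\<rbrakk> \<Longrightarrow>
      basis_vec K (ys, x \<oplus>\<^bsub>X\<^esub> x') \<ominus>\<^bsub>F\<^esub> (basis_vec K (ys, x) \<oplus>\<^bsub>F\<^esub> basis_vec K (ys, x'))
        \<in> mtens_rels K Y X n"
    and "\<lbrakk>(ys, x) \<in> G; c \<in> carrier K\<rbrakk> \<Longrightarrow>
      basis_vec K (ys, c \<odot>\<^bsub>X\<^esub> x) \<ominus>\<^bsub>F\<^esub> (c \<odot>\<^bsub>F\<^esub> basis_vec K (ys, x)) \<in> mtens_rels K Y X n"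
  unfolding mtens_rels_def Let_def G_def F_def by blast+

lemma multilinear_kills_mtens_rels:
  assumes [simp]: "module K Y" "module K X" "module K M"
    and \<phi>: "multilinear Y X M n \<phi>" and r: "r \<in> mtens_rels K Y X n"
  shows "lsum M (\<lambda>(ys, x). \<phi> ys x) r = \<zero>\<^bsub>M\<^esub>"
proof -
  interpret M: module K M by fact
  let ?S = "mtens_gens Y X n"
  let ?L = "lsum M (\<lambda>(ys, x). \<phi> ys x)"
  note mods = module_free_module[of ?S] assms(3)
  have cl: "\<phi> ys x \<in> carrier M" if "(ys, x) \<in> ?S" for ys x
    using linear_closed[OF multilinearD(1)[OF \<phi>]] that unfolding mtens_gens_def by auto
  then have \<phi>c: "(\<lambda>(ys, x). \<phi> ys x) \<in> ?S \<rightarrow> carrier M"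
    by auto
  note L = lsum_linear[OF assms(3) \<phi>c]
  have e: "?L (basis_vec K (ys, x)) = \<phi> ys x" if "(ys, x) \<in> ?S" for ys x
    using lsum_basis_vec[OF assms(3), of "\<lambda>(ys, x). \<phi> ys x" "(ys, x)"] cl[OF that] by simp
  have M0: "x \<in> carrier M \<Longrightarrow> x \<ominus>\<^bsub>M\<^esub> x = \<zero>\<^bsub>M\<^esub>" for x
    by (simp add: M.r_neg a_minus_def)
  have upd: "(ys[i := y], x) \<in> ?S" if "(ys, x) \<in> ?S" "y \<in> carrier Y" for ys i y x
    using that unfolding mtens_gens_def by auto
  have addS: "(ys, x \<oplus>\<^bsub>X\<^esub> x') \<in> ?S" if "(ys, x) \<in> ?S" "(ys, x') \<in> ?S" for ys x x'
    using that unfolding mtens_gens_def by auto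
  have smultS: "(ys, c \<odot>\<^bsub>X\<^esub> x) \<in> ?S" if "(ys, x) \<in> ?S" "c \<in> carrier K" for ys c x
    using that unfolding mtens_gens_def by auto
  have linX: "linear_map K X M (\<lambda>x. \<phi> ys x)" if "(ys, x) \<in> ?S" for ys x
    using multilinearD(1)[OF \<phi>] that unfolding mtens_gens_def by auto
  have linY: "linear_map K Y M (\<lambda>y. \<phi> (ys[i := y]) x)" if "(ys, x) \<in> ?S" "i < n" for ys x i
    using multilinearD(2)[OF \<phi>] that unfolding mtens_gens_def by auto
  have inX: "x \<in> carrier X" if "(ys, x) \<in> ?S" for ys x
    using that unfolding mtens_gens_def by auto
  note simps = linear_minus[OF L mods] linear_add[OF L] linear_smult[OF L] basis_vec_closed
    module_free_module e M0 upd addS smultS cl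
  from r show ?thesis
    unfolding mtens_rels_def Let_def
  proof (elim UnE CollectE exE conjE, goal_cases)
    case (1 ys i a b x)
    then show ?case by (simp add: simps linear_add[OF linY])
  next
    case (2 ys i c a x)
    then show ?case by (simp add: simps linear_smult[OF linY])
  next
    case (3 ys x x')
    then show ?case by (simp add: simps linear_add[OF linX] inX)
  next
    case (4 ys c x)
    then show ?case by (simp add: simps linear_smult[OF linX] inX)
  qed
qed

context
  fixes Y :: "('k, 'y) module" and X :: "('k, 'x) module"
  assumes mods [simp]: "module K Y" "module K X"
begin

lemma module_mtens [simp]: "module K (mtens K Y X n)"
  unfolding mtens_def by (intro presentation.module_presented mtens_presentation) auto

lemma mpure_closed [simp]:
  "\<lbrakk>set ys \<subseteq> carrier Y; length ys = n; x \<in> carrier X\<rbrakk> \<Longrightarrow> mpure K Y X n ys x \<in> carrier (mtens K Y X n)"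
  unfolding mtens_def mpure_def
  by (intro presentation.gen_class_closed mtens_presentation) (auto simp: mtens_gens_def)

text \<open>The universal property of the iterated tensor product: existence of the induced map and
  its value on pure tensors.\<close>

lemma multilinear_lift:
  assumes [simp]: "module K M" and \<phi>: "multilinear Y X M n \<phi>"
  shows "linear_map K (mtens K Y X n) M (lin_ext K M (\<lambda>(ys, x). \<phi> ys x))"
    and "\<lbrakk>set ys \<subseteq> carrier Y; length ys = n; x \<in> carrier X\<rbrakk> \<Longrightarrow>
      lin_ext K M (\<lambda>(ys, x). \<phi> ys x) (mpure K Y X n ys x) = \<phi> ys x"
proof -
  have cl: "(\<lambda>(ys, x). \<phi> ys x) \<in> mtens_gens Y X n \<rightarrow> carrier M"
    using linear_closed[OF multilinearD(1)[OF \<phi>]] unfolding mtens_gens_def by auto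
  note facts = mtens_presentation[OF mods] assms(1) cl multilinear_kills_mtens_rels[OF mods assms]
  show "linear_map K (mtens K Y X n) M (lin_ext K M (\<lambda>(ys, x). \<phi> ys x))"
    unfolding mtens_def by (rule presentation.lin_ext_linear[OF facts])
  show "lin_ext K M (\<lambda>(ys, x). \<phi> ys x) (mpure K Y X n ys x) = \<phi> ys x"
    if "set ys \<subseteq> carrier Y" "length ys = n" "x \<in> carrier X"
    using presentation.lin_ext_gen[OF facts, of "(ys, x)"] that
    unfolding mpure_def mtens_gens_def by simp
qed

lemma mpure_multilinear: "multilinear Y X (mtens K Y X n) n (mpure K Y X n)"
proof -
  let ?S = "mtens_gens Y X n" and ?F = "free_module K (mtens_gens Y X n)"
  interpret T: presentation K ?S "mtens_rels K Y X n"
    by (rule mtens_presentation) auto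
  have eq: "T.P = mtens K Y X n"
    unfolding mtens_def ..
  define q where "q = (\<lambda>f. gen_submodule K ?F (mtens_rels K Y X n) +>\<^bsub>?F\<^esub> f)"
  have p: "mpure K Y X n ys x = q (basis_vec K (ys, x))" for ys x
    unfolding mpure_def gen_class_def q_def ..
  have q: "q f = q g" if "f \<ominus>\<^bsub>?F\<^esub> g \<in> mtens_rels K Y X n"
    "f \<in> carrier ?F" "g \<in> carrier ?F" for f g
    unfolding q_def using that(2,3) subsetD[OF gen_submodule_incl that(1)] by (rule T.coset_eq)
  note Lq = T.coset_linear[unfolded eq, folded q_def]
  note ls = linear_add[OF Lq, symmetric] linear_smult[OF Lq, symmetric] basis_vec_closed
    module_free_module
  show ?thesis
  proof (rule multilinearI; rule linearI)
    fix ys :: "'y list" and x x' assume *: "set ys \<subseteq> carrier Y" "length ys = n" "x \<in> carrier X" "x' \<in> carrier X"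
    then have **: "(ys, x) \<in> ?S" "(ys, x') \<in> ?S" "(ys, x \<oplus>\<^bsub>X\<^esub> x') \<in> ?S"
      by (auto simp: mtens_gens_def)
    then show "mpure K Y X n ys (x \<oplus>\<^bsub>X\<^esub> x') = mpure K Y X n ys x \<oplus>\<^bsub>mtens K Y X n\<^esub> mpure K Y X n ys x'"
      unfolding p by (simp add: ls, intro q)
        (blast intro: mtens_relsI | simp add: basis_vec_closed module_free_module)+
  next
    fix ys :: "'y list" and x c assume *: "set ys \<subseteq> carrier Y" "length ys = n" "x \<in> carrier X" "c \<in> carrier K"
    then have **: "(ys, x) \<in> ?S" "(ys, c \<odot>\<^bsub>X\<^esub> x) \<in> ?S"
      by (auto simp: mtens_gens_def)
    with * show "mpure K Y X n ys (c \<odot>\<^bsub>X\<^esub> x) = c \<odot>\<^bsub>mtens K Y X n\<^esub> mpure K Y X n ys x"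
      unfolding p by (simp add: ls, intro q)
        (blast intro: mtens_relsI | simp add: basis_vec_closed module_free_module)+
  next
    fix ys :: "'y list" and x a b i
    assume *: "set ys \<subseteq> carrier Y" "length ys = n" "x \<in> carrier X" "a \<in> carrier Y" "b \<in> carrier Y" "i < n"
    then have **: "(ys, x) \<in> ?S" "(ys[i := a], x) \<in> ?S" "(ys[i := b], x) \<in> ?S" "(ys[i := a \<oplus>\<^bsub>Y\<^esub> b], x) \<in> ?S"
      by (auto simp: mtens_gens_def)
    with * show "mpure K Y X n (ys[i := a \<oplus>\<^bsub>Y\<^esub> b]) x =
        mpure K Y X n (ys[i := a]) x \<oplus>\<^bsub>mtens K Y X n\<^esub> mpure K Y X n (ys[i := b]) x"
      unfolding p by (simp add: ls, intro q)
        (blast intro: mtens_relsI | simp add: basis_vec_closed module_free_module)+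
  next
    fix ys :: "'y list" and x a c i
    assume *: "set ys \<subseteq> carrier Y" "length ys = n" "x \<in> carrier X" "a \<in> carrier Y" "c \<in> carrier K" "i < n"
    then have **: "(ys, x) \<in> ?S" "(ys[i := a], x) \<in> ?S" "(ys[i := c \<odot>\<^bsub>Y\<^esub> a], x) \<in> ?S"
      by (auto simp: mtens_gens_def)
    with * show "mpure K Y X n (ys[i := c \<odot>\<^bsub>Y\<^esub> a]) x = c \<odot>\<^bsub>mtens K Y X n\<^esub> mpure K Y X n (ys[i := a]) x"
      unfolding p by (simp add: ls, intro q)
        (blast intro: mtens_relsI | simp add: basis_vec_closed module_free_module)+
  qed auto
qed

lemma linear_mpure:
  "\<lbrakk>set ys \<subseteq> carrier Y; length ys = n; linear_map K V X f\<rbrakk> \<Longrightarrow>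
    linear_map K V (mtens K Y X n) (\<lambda>v. mpure K Y X n ys (f v))"
  using multilinearD(1)[OF mpure_multilinear] by (auto intro: linear_compose)

lemma mtens_induct [consumes 1, case_names mpure add]:
  assumes t: "t \<in> carrier (mtens K Y X n)"
    and mpure: "\<And>ys x. \<lbrakk>set ys \<subseteq> carrier Y; length ys = n; x \<in> carrier X\<rbrakk> \<Longrightarrow> Q (mpure K Y X n ys x)"
    and add: "\<And>u v. \<lbrakk>u \<in> carrier (mtens K Y X n); v \<in> carrier (mtens K Y X n); Q u; Q v\<rbrakk>
      \<Longrightarrow> Q (u \<oplus>\<^bsub>mtens K Y X n\<^esub> v)"
  shows "Q t"
proof -
  interpret T: presentation K "mtens_gens Y X n" "mtens_rels K Y X n"
    by (rule mtens_presentation) auto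
  note lin = multilinearD(1)[OF mpure_multilinear]
  show ?thesis
  proof (rule T.presented_induct[of t Q, folded mtens_def])
    \<comment> \<open>Zero is obtained from linearity in the factor X; the list of zeros is only a
      filler of the right length, valid for \<open>n = 0\<close> too.\<close>
    have ys: "set (replicate n \<zero>\<^bsub>Y\<^esub>) \<subseteq> carrier Y" "length (replicate n \<zero>\<^bsub>Y\<^esub>) = n"
      by auto
    have "mpure K Y X n (replicate n \<zero>\<^bsub>Y\<^esub>) \<zero>\<^bsub>X\<^esub> = \<zero>\<^bsub>mtens K Y X n\<^esub>"
      by (rule linear_zero[OF lin[OF ys]]) auto
    then show "Q \<zero>\<^bsub>mtens K Y X n\<^esub>"
      using mpure[OF ys, of "\<zero>\<^bsub>X\<^esub>"] by simp
  next
    fix c s assume *: "c \<in> carrier K" "s \<in> mtens_gens Y X n"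
    then obtain ys x where s: "s = (ys, x)" "set ys \<subseteq> carrier Y" "length ys = n" "x \<in> carrier X"
      unfolding mtens_gens_def by auto
    have "c \<odot>\<^bsub>mtens K Y X n\<^esub> mpure K Y X n ys x = mpure K Y X n ys (c \<odot>\<^bsub>X\<^esub> x)"
      using linear_smult[OF lin] * s by simp
    with * s mpure show "Q (c \<odot>\<^bsub>mtens K Y X n\<^esub> gen_class K (mtens_gens Y X n) (mtens_rels K Y X n) s)"
      by (simp add: mpure_def)
  qed (use t add in auto)
qed

lemma mtens_ext:
  assumes "t \<in> carrier (mtens K Y X n)"
    and "linear_map K (mtens K Y X n) M f" "linear_map K (mtens K Y X n) M g"
    and "\<And>ys x. \<lbrakk>set ys \<subseteq> carrier Y; length ys = n; x \<in> carrier X\<rbrakk> \<Longrightarrow>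
      f (mpure K Y X n ys x) = g (mpure K Y X n ys x)"
  shows "f t = g t"
  using assms(1)
proof (induction rule: mtens_induct)
  case (mpure ys x)
  then show ?case using assms by blast
next
  case (add u v)
  then show ?case by (simp add: linear_add[OF assms(2)] linear_add[OF assms(3)])
qed

lemma lin_ext_mtens_cong:
  assumes "module K M" "multilinear Y X M n \<phi>" "t \<in> carrier (mtens K Y X n)"
    and "\<And>ys x. \<lbrakk>set ys \<subseteq> carrier Y; length ys = n; x \<in> carrier X\<rbrakk> \<Longrightarrow> \<psi> ys x = \<phi> ys x"
  shows "lin_ext K M (\<lambda>(ys, x). \<psi> ys x) t = lin_ext K M (\<lambda>(ys, x). \<phi> ys x) t"
  by (rule presentation.lin_ext_cong[OF mtens_presentation[OF mods] assms(1)])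
    (use assms linear_closed[OF multilinearD(1)[OF assms(2)]] in \<open>auto simp: mtens_def mtens_gens_def\<close>)

end

text \<open>Prepending one factor is the structure map Y \<otimes> T_n \<rightarrow> T_(n+1). It
  gives the list-indexed tensor powers a recursion, so that statements about them can be proved by
  induction on the number of factors.\<close>

definition tcons ::
  "('k, 'y) module \<Rightarrow> ('k, 'x) module \<Rightarrow> nat \<Rightarrow> 'y \<Rightarrow> ('k, 'y, 'x) mtens \<Rightarrow> ('k, 'y, 'x) mtens" where
  "tcons Y X n y = lin_ext K (mtens K Y X (Suc n)) (\<lambda>(ys, x). mpure K Y X (Suc n) (y # ys) x)"

context
  fixes Y :: "('k, 'y) module" and X :: "('k, 'x) module"
  assumes mods [simp]: "module K Y" "module K X"
begin

lemma tcons_multilinear: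
  assumes "y \<in> carrier Y"
  shows "multilinear Y X (mtens K Y X (Suc n)) n (\<lambda>ys x. mpure K Y X (Suc n) (y # ys) x)"
proof (rule multilinearI)
  fix ys :: "'y list" assume "set ys \<subseteq> carrier Y" "length ys = n"
  with assms have ys: "set (y # ys) \<subseteq> carrier Y" "length (y # ys) = Suc n" by auto
  note D = multilinearD[OF mpure_multilinear[OF mods] ys]
  show "linear_map K X (mtens K Y X (Suc n)) (\<lambda>x. mpure K Y X (Suc n) (y # ys) x)"
    by (rule D)
  show "linear_map K Y (mtens K Y X (Suc n)) (\<lambda>z. mpure K Y X (Suc n) (y # ys[i := z]) x)"
    if "i < n" "x \<in> carrier X" for i x
    using D(2)[where i = "Suc i"] that by simp
qed

lemma tcons_linear: "y \<in> carrier Y \<Longrightarrow> linear_map K (mtens K Y X n) (mtens K Y X (Suc n)) (tcons Y X n y)"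
  unfolding tcons_def by (intro multilinear_lift tcons_multilinear) auto

lemma tcons_mpure:
  "\<lbrakk>set ys \<subseteq> carrier Y; length ys = n; x \<in> carrier X; y \<in> carrier Y\<rbrakk> \<Longrightarrow>
    tcons Y X n y (mpure K Y X n ys x) = mpure K Y X (Suc n) (y # ys) x"
  unfolding tcons_def by (rule multilinear_lift(2)[OF mods]) (auto intro: tcons_multilinear)

lemma tcons_bilinear: "bilinear Y (mtens K Y X n) (mtens K Y X (Suc n)) (tcons Y X n)"
proof (rule bilinearI)
  fix t assume "t \<in> carrier (mtens K Y X n)"
  then show "linear_map K Y (mtens K Y X (Suc n)) (\<lambda>y. tcons Y X n y t)"
  proof (induction rule: mtens_induct[OF mods, consumes 1, case_names mpure add])
    case (mpure ys x)
    \<comment> \<open>The zero only occupies slot 0, which the update overwrites.\<close>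
    then have "set (\<zero>\<^bsub>Y\<^esub> # ys) \<subseteq> carrier Y" "length (\<zero>\<^bsub>Y\<^esub> # ys) = Suc n" by auto
    from multilinearD(2)[OF mpure_multilinear[OF mods] this, where i = 0] mpure
    have L: "linear_map K Y (mtens K Y X (Suc n)) (\<lambda>y. mpure K Y X (Suc n) (y # ys) x)"
      by simp
    show ?case
      by (rule linear_cong[OF L]) (use mpure in \<open>auto simp: tcons_mpure\<close>)
  next
    case (add u v)
    show ?case
      by (rule linear_cong[OF linear_sum[OF add(3,4)]])
        (use add in \<open>auto simp: linear_add[OF tcons_linear]\<close>)
  qed
qed (rule tcons_linear)

lemma tcons_closed [simp]:
  "\<lbrakk>y \<in> carrier Y; t \<in> carrier (mtens K Y X n)\<rbrakk> \<Longrightarrow> tcons Y X n y t \<in> carrier (mtens K Y X (Suc n))"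
  by (rule bilinear_closed[OF tcons_bilinear])

lemma linear_tcons:
  shows "\<lbrakk>linear_map K V Y f; t \<in> carrier (mtens K Y X n)\<rbrakk> \<Longrightarrow>
      linear_map K V (mtens K Y X (Suc n)) (\<lambda>v. tcons Y X n (f v) t)"
    and "\<lbrakk>linear_map K V (mtens K Y X n) g; y \<in> carrier Y\<rbrakk> \<Longrightarrow>
      linear_map K V (mtens K Y X (Suc n)) (\<lambda>v. tcons Y X n y (g v))"
  by (rule linear_compose, assumption, erule bilinearD[OF tcons_bilinear])+

text \<open>Vectors of the form y \<otimes> t span the next tensor power, so linear maps need
  comparing only there; this is the induction step for maps defined through
  \<open>tcons\<close>.\<close>

lemma mtens_Suc_ext:
  assumes "t \<in> carrier (mtens K Y X (Suc n))"
    and "linear_map K (mtens K Y X (Suc n)) M f" "linear_map K (mtens K Y X (Suc n)) M g"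
    and eq: "\<And>y t. \<lbrakk>y \<in> carrier Y; t \<in> carrier (mtens K Y X n)\<rbrakk> \<Longrightarrow> f (tcons Y X n y t) = g (tcons Y X n y t)"
  shows "f t = g t"
proof (rule mtens_ext[OF mods assms(1-3)])
  fix ys :: "'y list" and x assume *: "set ys \<subseteq> carrier Y" "length ys = Suc n" "x \<in> carrier X"
  then obtain y zs where "ys = y # zs" by (cases ys) auto
  with * eq[of y "mpure K Y X n zs x"] show "f (mpure K Y X (Suc n) ys x) = g (mpure K Y X (Suc n) ys x)"
    by (simp add: tcons_mpure)
qed

end

end

section \<open>Algebras and comodules in Sweedler notation\<close>

context linear_algebra
begin

text \<open>Together with the \<open>[simp]\<close> linearity rules of the operators, these reduce
  every bilinearity side condition of a Sweedler computation to membership facts.\<close>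

lemmas linear_simps =
  linear_ident linear_pure linear_scale linear_bnd_arg linear_bnd_body bilinearI
  linear_mpure linear_tcons bnd_closed bnd_pure

lemma bnd_bnd:
  assumes [simp]: "module K A" "module K B" "module K C" "module K D" "module K N"
    and "bilinear A B (tensor K C D) \<phi>" "bilinear C D N \<psi>" "t \<in> carrier (tensor K A B)"
  shows "bnd C D N (bnd A B (tensor K C D) t \<phi>) \<psi> = bnd A B N t (\<lambda>a b. bnd C D N (\<phi> a b) \<psi>)"
  by (rule linear_image_bnd[OF _ _ _ _ bnd_linear]) (use assms in auto)

lemma pure_bnd:
  assumes [simp]: "module K A" "module K B" "module K C" "module K D"
    and t: "t \<in> carrier (tensor K A B)"
  shows pure_bnd_left: "\<lbrakk>bilinear A B C \<phi>; d \<in> carrier D\<rbrakk> \<Longrightarrow>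
      pure K C D (bnd A B C t \<phi>) d = bnd A B (tensor K C D) t (\<lambda>a b. pure K C D (\<phi> a b) d)"
    and pure_bnd_right: "\<lbrakk>bilinear A B D \<psi>; c \<in> carrier C\<rbrakk> \<Longrightarrow>
      pure K C D c (bnd A B D t \<psi>) = bnd A B (tensor K C D) t (\<lambda>a b. pure K C D c (\<psi> a b))"
  by (rule linear_image_bnd[where g = "\<lambda>v. pure K C D v d"]
      linear_image_bnd[where g = "\<lambda>v. pure K C D c v"]; simp add: t linear_pure linear_ident)+

lemma tcons_bnd:
  assumes [simp]: "module K A" "module K B" "module K Y" "module K X"
    and t: "t \<in> carrier (tensor K A B)"
  shows "\<lbrakk>bilinear A B (mtens K Y X n) \<phi>; y \<in> carrier Y\<rbrakk> \<Longrightarrow>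
      tcons Y X n y (bnd A B (mtens K Y X n) t \<phi>) = bnd A B (mtens K Y X (Suc n)) t (\<lambda>a b. tcons Y X n y (\<phi> a b))"
    and "\<lbrakk>bilinear A B Y \<psi>; u \<in> carrier (mtens K Y X n)\<rbrakk> \<Longrightarrow>
      tcons Y X n (bnd A B Y t \<psi>) u = bnd A B (mtens K Y X (Suc n)) t (\<lambda>a b. tcons Y X n (\<psi> a b) u)"
  by (rule linear_image_bnd[where g = "\<lambda>v. tcons Y X n y v"]
      linear_image_bnd[where g = "\<lambda>v. tcons Y X n v u"]; simp add: t linear_tcons linear_ident)+

lemma smult_bnd:
  assumes [simp]: "module K A" "module K B" "module K M"
    and "t \<in> carrier (tensor K A B)" "bilinear A B M \<phi>" "c \<in> carrier K"
  shows "c \<odot>\<^bsub>M\<^esub> bnd A B M t \<phi> = bnd A B M t (\<lambda>a b. c \<odot>\<^bsub>M\<^esub> \<phi> a b)"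
  by (rule linear_image_bnd[where g = "\<lambda>v. c \<odot>\<^bsub>M\<^esub> v"]) (use assms in \<open>auto intro: linear_scale linear_ident\<close>)

lemmas bnd_image_simps = bnd_bnd pure_bnd tcons_bnd

lemma unital_algebra_facts:
  assumes "unital_algebra K A"
  shows "module K A" "ring A"
    "\<lbrakk>a \<in> carrier A; b \<in> carrier A\<rbrakk> \<Longrightarrow> a \<otimes>\<^bsub>A\<^esub> b \<in> carrier A" "\<one>\<^bsub>A\<^esub> \<in> carrier A"
    "\<lbrakk>a \<in> carrier A; b \<in> carrier A; c \<in> carrier A\<rbrakk> \<Longrightarrow> (a \<otimes>\<^bsub>A\<^esub> b) \<otimes>\<^bsub>A\<^esub> c = a \<otimes>\<^bsub>A\<^esub> (b \<otimes>\<^bsub>A\<^esub> c)"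
    "a \<in> carrier A \<Longrightarrow> \<one>\<^bsub>A\<^esub> \<otimes>\<^bsub>A\<^esub> a = a" "a \<in> carrier A \<Longrightarrow> a \<otimes>\<^bsub>A\<^esub> \<one>\<^bsub>A\<^esub> = a"
    "\<lbrakk>linear_map K V A f; b \<in> carrier A\<rbrakk> \<Longrightarrow> linear_map K V A (\<lambda>v. f v \<otimes>\<^bsub>A\<^esub> b)"
    "\<lbrakk>linear_map K V A f; b \<in> carrier A\<rbrakk> \<Longrightarrow> linear_map K V A (\<lambda>v. b \<otimes>\<^bsub>A\<^esub> f v)"
proof -
  interpret A: unital_algebra K A by fact
  show "module K A" "ring A"
    by (rule A.A.module_axioms, rule A.A.ring_axioms)
  show "\<lbrakk>linear_map K V A f; b \<in> carrier A\<rbrakk> \<Longrightarrow> linear_map K V A (\<lambda>v. f v \<otimes>\<^bsub>A\<^esub> b)"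
    "\<lbrakk>linear_map K V A f; b \<in> carrier A\<rbrakk> \<Longrightarrow> linear_map K V A (\<lambda>v. b \<otimes>\<^bsub>A\<^esub> f v)"
    by (rule linearI; simp add: linear_closed linear_add linear_smult A.A.l_distr A.A.r_distr
        A.smult_mult_left A.smult_mult_right)+
qed (use ring.ring_simprules[OF unital_algebra.axioms(2)[OF assms]] in
  \<open>auto simp: monoid.m_assoc monoid.l_one monoid.r_one ring.is_monoid[OF unital_algebra.axioms(2)[OF assms]]\<close>)

lemma tensor_algebra_mult:
  assumes "unital_algebra K A" "unital_algebra K B"
    and st: "s \<in> carrier (tensor K A B)" "t \<in> carrier (tensor K A B)"
  shows "s \<otimes>\<^bsub>tensor_algebra K A B\<^esub> t =
    bnd A B (tensor K A B) s (\<lambda>a b. bnd A B (tensor K A B) t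
      (\<lambda>a' b'. pure K A B (a \<otimes>\<^bsub>A\<^esub> a') (b \<otimes>\<^bsub>B\<^esub> b')))"
proof -
  note A [simp] = unital_algebra_facts[OF assms(1)] unital_algebra_facts[OF assms(2)]
  show ?thesis
    unfolding tensor_algebra_def monoid.simps
  proof (simp, rule lin_ext_eq_bnd)
    fix a b assume "a \<in> carrier A" "b \<in> carrier B"
    then show "lin_ext K (tensor K A B) (\<lambda>(a', b'). pure K A B (a \<otimes>\<^bsub>A\<^esub> a') (b \<otimes>\<^bsub>B\<^esub> b')) t =
        bnd A B (tensor K A B) t (\<lambda>a' b'. pure K A B (a \<otimes>\<^bsub>A\<^esub> a') (b \<otimes>\<^bsub>B\<^esub> b'))"
      using st by (intro lin_ext_eq_bnd) (simp_all add: linear_simps)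
  qed (use st in \<open>simp_all add: linear_simps\<close>)
qed

section \<open>Counit and coassociativity laws in Sweedler form\<close>

lemma coalgebra_facts:
  assumes "coalgebra K B \<Delta> \<epsilon>"
  shows "module K B" "linear_map K B (tensor K B B) \<Delta>"
    "b \<in> carrier B \<Longrightarrow> \<Delta> b \<in> carrier (tensor K B B)"
    "linear_map K V B f \<Longrightarrow> linear_map K V (tensor K B B) (\<lambda>v. \<Delta> (f v))"
    "b \<in> carrier B \<Longrightarrow> \<epsilon> b \<in> carrier K"
    "\<lbrakk>linear_map K V B f; module K M; m \<in> carrier M\<rbrakk> \<Longrightarrow> linear_map K V M (\<lambda>v. \<epsilon> (f v) \<odot>\<^bsub>M\<^esub> m)"
proof -
  interpret coalgebra K B \<Delta> \<epsilon> by fact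
  show "module K B"
    by (rule C.module_axioms)
  show lin: "linear_map K B (tensor K B B) \<Delta>"
    by (rule comult_linear)
  show "b \<in> carrier B \<Longrightarrow> \<Delta> b \<in> carrier (tensor K B B)"
    by (rule linear_closed[OF lin])
  show "linear_map K V B f \<Longrightarrow> linear_map K V (tensor K B B) (\<lambda>v. \<Delta> (f v))"
    by (erule linear_compose[OF _ lin])
  show \<epsilon>: "b \<in> carrier B \<Longrightarrow> \<epsilon> b \<in> carrier K" for b
    using counit_closed by auto
  show "linear_map K V M (\<lambda>v. \<epsilon> (f v) \<odot>\<^bsub>M\<^esub> m)"
    if "linear_map K V B f" "module K M" "m \<in> carrier M"
  proof -
    interpret M: module K M by fact
    show ?thesis
      by (rule linearI)
        (use that \<epsilon> in \<open>auto simp: linear_closed linear_add linear_smult counit_add counit_smult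
          M.smult_l_distr M.smult_assoc1\<close>)
  qed
qed

text \<open>The axiom is composed with an arbitrary linear map, so that it can be applied in the
  middle of a longer Sweedler sum.\<close>

lemma counit_law_left:
  assumes "coalgebra K B \<Delta> \<epsilon>" "b \<in> carrier B" "linear_map K B M f" and [simp]: "module K M"
  shows "bnd B B M (\<Delta> b) (\<lambda>b1 b2. \<epsilon> b1 \<odot>\<^bsub>M\<^esub> f b2) = f b"
proof -
  interpret coalgebra K B \<Delta> \<epsilon> by fact
  note [simp] = coalgebra_facts[OF assms(1)]
  have "b = bnd B B B (\<Delta> b) (\<lambda>b1 b2. \<epsilon> b1 \<odot>\<^bsub>B\<^esub> b2)"
    using counit_left[OF assms(2)] assms(2)
    by (subst (asm) lin_ext_eq_bnd[where A = B and B = B]) (auto simp: linear_simps)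
  then have "f b = f (bnd B B B (\<Delta> b) (\<lambda>b1 b2. \<epsilon> b1 \<odot>\<^bsub>B\<^esub> b2))"
    by simp
  also have "\<dots> = bnd B B M (\<Delta> b) (\<lambda>b1 b2. f (\<epsilon> b1 \<odot>\<^bsub>B\<^esub> b2))"
    by (rule linear_image_bnd) (use assms(2,3) in \<open>auto simp: linear_simps\<close>)
  finally show ?thesis
    using assms(2) by (simp add: linear_smult[OF assms(3)])
qed

text \<open>A coalgebra is a comodule over itself; coassociativity and the right counit law of
  \<open>\<Delta>\<close> then come from the comodule laws below.\<close>

lemma right_comodule_self:
  assumes "coalgebra K B \<Delta> \<epsilon>" shows "right_comodule K B \<Delta> \<epsilon> B \<Delta>"
proof -
  interpret coalgebra K B \<Delta> \<epsilon> by fact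
  show ?thesis
    by unfold_locales (use comult_linear coassoc counit_right in auto)
qed

lemma right_comodule_facts:
  assumes "right_comodule K B \<Delta> \<epsilon> M \<rho>"
  shows "coalgebra K B \<Delta> \<epsilon>" "module K M" "linear_map K M (tensor K M B) \<rho>"
    "m \<in> carrier M \<Longrightarrow> \<rho> m \<in> carrier (tensor K M B)"
    "linear_map K V M f \<Longrightarrow> linear_map K V (tensor K M B) (\<lambda>v. \<rho> (f v))"
proof -
  interpret right_comodule K B \<Delta> \<epsilon> M \<rho> by fact
  show "coalgebra K B \<Delta> \<epsilon>" by (rule coalgebra_axioms)
  show "module K M" by (rule M.module_axioms)
  show lin: "linear_map K M (tensor K M B) \<rho>"
    by (rule coact_linear)
  show "m \<in> carrier M \<Longrightarrow> \<rho> m \<in> carrier (tensor K M B)"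
    by (rule linear_closed[OF lin])
  show "linear_map K V M f \<Longrightarrow> linear_map K V (tensor K M B) (\<lambda>v. \<rho> (f v))"
    by (erule linear_compose[OF _ lin])
qed

lemma comodule_counit_law:
  assumes "right_comodule K B \<Delta> \<epsilon> M \<rho>" "m \<in> carrier M" "linear_map K M N f" and [simp]: "module K N"
  shows "bnd M B N (\<rho> m) (\<lambda>m0 b. \<epsilon> b \<odot>\<^bsub>N\<^esub> f m0) = f m"
proof -
  interpret right_comodule K B \<Delta> \<epsilon> M \<rho> by fact
  note [simp] = coalgebra_facts[OF coalgebra_axioms] right_comodule_facts(2-)[OF assms(1)]
  have "m = bnd M B M (\<rho> m) (\<lambda>m0 b. \<epsilon> b \<odot>\<^bsub>M\<^esub> m0)"
    using coact_counit[OF assms(2)] assms(2)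
    by (subst (asm) lin_ext_eq_bnd[where A = M and B = B]) (auto simp: linear_simps)
  then have "f m = f (bnd M B M (\<rho> m) (\<lambda>m0 b. \<epsilon> b \<odot>\<^bsub>M\<^esub> m0))"
    by simp
  also have "\<dots> = bnd M B N (\<rho> m) (\<lambda>m0 b. f (\<epsilon> b \<odot>\<^bsub>M\<^esub> m0))"
    by (rule linear_image_bnd) (use assms(2,3) in \<open>auto simp: linear_simps\<close>)
  finally show ?thesis
    using assms(2) by (simp add: linear_smult[OF assms(3)])
qed

text \<open>The two sides of the axiom are unfolded for any linear \<open>\<rho>\<close>, so the
  same formulas serve to use coassociativity and to establish it.\<close>

lemma comodule_coassoc_bnd:
  assumes "coalgebra K B \<Delta> \<epsilon>" and [simp]: "module K M" and lin: "linear_map K M (tensor K M B) \<rho>"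
    and m: "m \<in> carrier M"
  shows "tensor_assoc K M B B (tensor_map K (tensor K M B) B \<rho> id (\<rho> m)) =
      bnd M B (tensor K M (tensor K B B)) (\<rho> m) (\<lambda>m0 b. bnd M B (tensor K M (tensor K B B)) (\<rho> m0)
        (\<lambda>m00 b1. pure K M (tensor K B B) m00 (pure K B B b1 b)))"
    and "tensor_map K M (tensor K B B) id \<Delta> (\<rho> m) =
      bnd M B (tensor K M (tensor K B B)) (\<rho> m) (\<lambda>m0 b. pure K M (tensor K B B) m0 (\<Delta> b))"
proof -
  let ?N = "tensor K M (tensor K B B)"
  note B [simp] = coalgebra_facts[OF assms(1)]
  note [simp] = linear_closed[OF lin] linear_compose[OF _ lin] 
  have 1: "tensor_map K (tensor K M B) B \<rho> id (\<rho> m) =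
      bnd M B (tensor K (tensor K M B) B) (\<rho> m) (\<lambda>m0 b. pure K (tensor K M B) B (\<rho> m0) b)"
    using m lin by (subst tensor_map_eq_bnd[where V = M and W = B]) (auto simp: linear_ident)
  have 2: "bnd M B (tensor K (tensor K M B) B) (\<rho> m) (\<lambda>m0 b. pure K (tensor K M B) B (\<rho> m0) b)
      \<in> carrier (tensor K (tensor K M B) B)"
    using m by (simp add: linear_simps)
  have 3: "bilinear (tensor K M B) B ?N (\<lambda>s w. bnd M B ?N s
      (\<lambda>u v. pure K M (tensor K B B) u (pure K B B v w)))"
    by (simp add: linear_simps)
  show "tensor_assoc K M B B (tensor_map K (tensor K M B) B \<rho> id (\<rho> m)) =
      bnd M B ?N (\<rho> m) (\<lambda>m0 b. bnd M B ?N (\<rho> m0)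
        (\<lambda>m00 b1. pure K M (tensor K B B) m00 (pure K B B b1 b)))"
    unfolding 1 using m 3
    by (subst tensor_assoc_eq_bnd[OF _ _ _ 2])
      (auto simp: linear_image_bnd[OF _ _ _ _ bnd_linear] bnd_pure linear_simps)
  show "tensor_map K M (tensor K B B) id \<Delta> (\<rho> m) =
      bnd M B ?N (\<rho> m) (\<lambda>m0 b. pure K M (tensor K B B) m0 (\<Delta> b))"
    using m lin by (subst tensor_map_eq_bnd[where V = M and W = B]) (auto simp: linear_ident)
qed

text \<open>The axiom is an equation in M \<otimes> (B \<otimes> B). A trilinear
  \<open>\<phi>\<close> induces a linear map \<open>L\<close> on that space, and applying
  \<open>L\<close> to both sides gives the law for an arbitrary trilinear integrand.\<close>

lemma comodule_coassoc_law:
  assumes com: "right_comodule K B \<Delta> \<epsilon> M \<rho>" and m: "m \<in> carrier M" and [simp]: "module K N"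
    and [simp]: "\<And>a b. \<lbrakk>a \<in> carrier M; b \<in> carrier B\<rbrakk> \<Longrightarrow> linear_map K B N (\<lambda>c. \<phi> a b c)"
      "\<And>a c. \<lbrakk>a \<in> carrier M; c \<in> carrier B\<rbrakk> \<Longrightarrow> linear_map K B N (\<lambda>b. \<phi> a b c)"
      "\<And>b c. \<lbrakk>b \<in> carrier B; c \<in> carrier B\<rbrakk> \<Longrightarrow> linear_map K M N (\<lambda>a. \<phi> a b c)"
  shows "bnd M B N (\<rho> m) (\<lambda>m0 b. bnd M B N (\<rho> m0) (\<lambda>m00 b1. \<phi> m00 b1 b)) =
    bnd M B N (\<rho> m) (\<lambda>m0 b. bnd B B N (\<Delta> b) (\<lambda>b1 b2. \<phi> m0 b1 b2))"
proof -
  interpret right_comodule K B \<Delta> \<epsilon> M \<rho> by fact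
  note B [simp] = coalgebra_facts[OF coalgebra_axioms]
  note M [simp] = right_comodule_facts(2-)[OF com]
  let ?T = "tensor K M (tensor K B B)"
  define L where "L = (\<lambda>u. bnd M (tensor K B B) N u (\<lambda>a s. bnd B B N s (\<lambda>b c. \<phi> a b c)))"
  have bil: "bilinear M (tensor K B B) N (\<lambda>a s. bnd B B N s (\<lambda>b c. \<phi> a b c))"
    by (simp add: linear_simps)
  have L: "linear_map K ?T N L"
    unfolding L_def by (rule bnd_linear[OF _ _ _ bil]) auto
  have Lp: "L (pure K M (tensor K B B) a s) = bnd B B N s (\<lambda>b c. \<phi> a b c)"
    if "a \<in> carrier M" "s \<in> carrier (tensor K B B)" for a s
    unfolding L_def using that by (subst bnd_pure[OF _ _ _ bil]) auto
  have eq: "bnd M B ?T (\<rho> m) (\<lambda>m0 b. bnd M B ?T (\<rho> m0)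
        (\<lambda>m00 b1. pure K M (tensor K B B) m00 (pure K B B b1 b))) =
      bnd M B ?T (\<rho> m) (\<lambda>m0 b. pure K M (tensor K B B) m0 (\<Delta> b))"
    using coact_coassoc[OF m] comodule_coassoc_bnd[OF coalgebra_axioms M(1,2) m] by simp
  have "L (bnd M B ?T (\<rho> m) (\<lambda>m0 b. bnd M B ?T (\<rho> m0)
        (\<lambda>m00 b1. pure K M (tensor K B B) m00 (pure K B B b1 b)))) =
      bnd M B N (\<rho> m) (\<lambda>m0 b. bnd M B N (\<rho> m0) (\<lambda>m00 b1. \<phi> m00 b1 b))"
    using m by (simp add: linear_image_bnd[OF _ _ _ _ L] Lp linear_simps)
  moreover have "L (bnd M B ?T (\<rho> m) (\<lambda>m0 b. pure K M (tensor K B B) m0 (\<Delta> b))) =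
      bnd M B N (\<rho> m) (\<lambda>m0 b. bnd B B N (\<Delta> b) (\<lambda>b1 b2. \<phi> m0 b1 b2))"
    using m by (simp add: linear_image_bnd[OF _ _ _ _ L] Lp linear_simps)
  ultimately show ?thesis
    using eq by simp
qed

lemma right_comoduleI:
  assumes "coalgebra K B \<Delta> \<epsilon>" and [simp]: "module K M" and lin: "linear_map K M (tensor K M B) \<rho>"
    and coassoc': "\<And>m. m \<in> carrier M \<Longrightarrow>
      bnd M B (tensor K M (tensor K B B)) (\<rho> m) (\<lambda>m0 b. bnd M B (tensor K M (tensor K B B)) (\<rho> m0)
        (\<lambda>m00 b1. pure K M (tensor K B B) m00 (pure K B B b1 b))) =
      bnd M B (tensor K M (tensor K B B)) (\<rho> m) (\<lambda>m0 b. pure K M (tensor K B B) m0 (\<Delta> b))"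
    and counit': "\<And>m. m \<in> carrier M \<Longrightarrow> bnd M B M (\<rho> m) (\<lambda>m0 b. \<epsilon> b \<odot>\<^bsub>M\<^esub> m0) = m"
  shows "right_comodule K B \<Delta> \<epsilon> M \<rho>"
proof -
  interpret coalgebra K B \<Delta> \<epsilon> by fact
  note B [simp] = coalgebra_facts[OF assms(1)]
  interpret M: module K M by simp
  note [simp] = linear_closed[OF lin]
  show ?thesis
  proof unfold_locales
    fix m assume m: "m \<in> carrier M"
    show "tensor_assoc K M B B (tensor_map K (tensor K M B) B \<rho> id (\<rho> m)) =
      tensor_map K M (tensor K B B) id \<Delta> (\<rho> m)"
      using coassoc'[OF m] comodule_coassoc_bnd[OF assms(1-3) m] by simp
    show "lin_ext K M (\<lambda>(m0, m1). \<epsilon> m1 \<odot>\<^bsub>M\<^esub> m0) (\<rho> m) = m"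
      using counit'[OF m] m
      by (subst lin_ext_eq_bnd[where A = M and B = B]) (auto simp: linear_simps)
  qed (rule lin)
qed

end

section \<open>The diagonal coaction\<close>

locale comodule_data = linear_algebra K for K :: "'k ring" (structure) +
  fixes B :: "('k, 'b) module" and \<Delta> :: "'b \<Rightarrow> ('k, 'b, 'b) tens" and \<epsilon> :: "'b \<Rightarrow> 'k"
    and Y :: "('k, 'y) module" and \<rho>Y :: "'y \<Rightarrow> ('k, 'y, 'b) tens"
    and X :: "('k, 'x) module" and act :: "'b \<Rightarrow> 'x \<Rightarrow> 'x" and \<rho>X :: "'x \<Rightarrow> ('k, 'x, 'b) tens"
  assumes bialgebra: "bialgebra K B \<Delta> \<epsilon>"
    and comodule_algebra: "right_comodule_algebra K B \<Delta> \<epsilon> Y \<rho>Y"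
    and left_module: "left_module K B X act"
    and right_comodule: "right_comodule K B \<Delta> \<epsilon> X \<rho>X"
    and stable: "\<And>x. x \<in> carrier X \<Longrightarrow> lin_ext K X (\<lambda>(x0, x1). act x1 x0) (\<rho>X x) = x"
begin

abbreviation "T n \<equiv> mtens K Y X n"
abbreviation "TB n \<equiv> tensor K (mtens K Y X n) B"

lemma algebra_B: "unital_algebra K B" and coalgebra_B: "coalgebra K B \<Delta> \<epsilon>"
  by (rule bialgebra.axioms[OF bialgebra])+

lemma algebra_Y: "unital_algebra K Y" and comodule_Y: "right_comodule K B \<Delta> \<epsilon> Y \<rho>Y"
  by (rule right_comodule_algebra.axioms[OF comodule_algebra])+

lemmas algebra_B_simps [simp] = unital_algebra_facts[OF algebra_B]
lemmas algebra_Y_simps [simp] = unital_algebra_facts[OF algebra_Y]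
lemmas coalgebra_B_simps [simp] = coalgebra_facts(2-)[OF coalgebra_B]
lemmas comodule_Y_simps [simp] = right_comodule_facts(3-)[OF comodule_Y]
lemmas comodule_X_simps [simp] = right_comodule_facts(2-)[OF right_comodule]

lemma act_simps [simp]:
  shows "\<lbrakk>b \<in> carrier B; x \<in> carrier X\<rbrakk> \<Longrightarrow> act b x \<in> carrier X"
    and "x \<in> carrier X \<Longrightarrow> act \<one>\<^bsub>B\<^esub> x = x"
    and "\<lbrakk>a \<in> carrier B; b \<in> carrier B; x \<in> carrier X\<rbrakk> \<Longrightarrow> act (a \<otimes>\<^bsub>B\<^esub> b) x = act a (act b x)"
    and "\<lbrakk>linear_map K V B f; x \<in> carrier X\<rbrakk> \<Longrightarrow> linear_map K V X (\<lambda>v. act (f v) x)"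
    and "\<lbrakk>linear_map K V X g; b \<in> carrier B\<rbrakk> \<Longrightarrow> linear_map K V X (\<lambda>v. act b (g v))"
proof -
  interpret left_module K B X act by (rule left_module)
  show "\<lbrakk>b \<in> carrier B; x \<in> carrier X\<rbrakk> \<Longrightarrow> act b x \<in> carrier X"
    using linear_closed[OF act_linear_left] by blast
  show "x \<in> carrier X \<Longrightarrow> act \<one>\<^bsub>B\<^esub> x = x"
    "\<lbrakk>a \<in> carrier B; b \<in> carrier B; x \<in> carrier X\<rbrakk> \<Longrightarrow> act (a \<otimes>\<^bsub>B\<^esub> b) x = act a (act b x)"
    by (rule act_one act_mult; assumption)+
  show "\<lbrakk>linear_map K V B f; x \<in> carrier X\<rbrakk> \<Longrightarrow> linear_map K V X (\<lambda>v. act (f v) x)"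
    "\<lbrakk>linear_map K V X g; b \<in> carrier B\<rbrakk> \<Longrightarrow> linear_map K V X (\<lambda>v. act b (g v))"
    using linear_compose[OF _ act_linear_left] linear_compose[OF _ act_linear_right] by blast+
qed

lemma comult_mult:
  assumes "a \<in> carrier B" "b \<in> carrier B"
  shows "\<Delta> (a \<otimes>\<^bsub>B\<^esub> b) = bnd B B (tensor K B B) (\<Delta> a) (\<lambda>a1 a2. bnd B B (tensor K B B) (\<Delta> b)
    (\<lambda>b1 b2. pure K B B (a1 \<otimes>\<^bsub>B\<^esub> b1) (a2 \<otimes>\<^bsub>B\<^esub> b2)))"
  using ring_hom_mult[OF bialgebra.comult_hom[OF bialgebra] assms] assms
  by (simp add: tensor_algebra_mult algebra_B)

lemma comult_one: "\<Delta> \<one>\<^bsub>B\<^esub> = pure K B B \<one>\<^bsub>B\<^esub> \<one>\<^bsub>B\<^esub>"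
  using ring_hom_one[OF bialgebra.comult_hom[OF bialgebra]] by (simp add: tensor_algebra_def)

lemma counit_mult: "\<lbrakk>a \<in> carrier B; b \<in> carrier B\<rbrakk> \<Longrightarrow> \<epsilon> (a \<otimes>\<^bsub>B\<^esub> b) = \<epsilon> a \<otimes> \<epsilon> b"
  by (rule ring_hom_mult[OF bialgebra.counit_hom[OF bialgebra]])

lemma counit_one: "\<epsilon> \<one>\<^bsub>B\<^esub> = \<one>"
  by (rule ring_hom_one[OF bialgebra.counit_hom[OF bialgebra]])

lemma coact_Y_mult:
  assumes "a \<in> carrier Y" "b \<in> carrier Y"
  shows "\<rho>Y (a \<otimes>\<^bsub>Y\<^esub> b) = bnd Y B (tensor K Y B) (\<rho>Y a) (\<lambda>a0 a1. bnd Y B (tensor K Y B) (\<rho>Y b)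
    (\<lambda>b0 b1. pure K Y B (a0 \<otimes>\<^bsub>Y\<^esub> b0) (a1 \<otimes>\<^bsub>B\<^esub> b1)))"
  using ring_hom_mult[OF right_comodule_algebra.coact_hom[OF comodule_algebra] assms] assms
  by (simp add: tensor_algebra_mult algebra_B algebra_Y)

lemma stable_bnd:
  assumes "x \<in> carrier X"
  shows "bnd X B X (\<rho>X x) (\<lambda>x0 x1. act x1 x0) = x"
  using stable[OF assms] assms
  by (subst (asm) lin_ext_eq_bnd[where A = X and B = B]) (auto simp: linear_simps)

text \<open>A structurally recursive form of the coaction: each y_(1) is multiplied from the left
  onto the result for the rest, and x_(1) is innermost, hence rightmost. Unlike
  \<open>sweedler_list\<close>, which passes a continuation down the list, it matches induction
  along \<open>tcons\<close>.\<close>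

primrec coact_pure :: "'y list \<Rightarrow> 'x \<Rightarrow> ('k, ('k, 'y, 'x) mtens, 'b) tens" where
  "coact_pure [] x = bnd X B (TB 0) (\<rho>X x) (\<lambda>x0 x1. pure K (T 0) B (mpure K Y X 0 [] x0) x1)"
| "coact_pure (y # ys) x = bnd Y B (TB (Suc (length ys))) (\<rho>Y y)
     (\<lambda>y0 y1. bnd (T (length ys)) B (TB (Suc (length ys))) (coact_pure ys x)
       (\<lambda>t b. pure K (T (Suc (length ys))) B (tcons Y X (length ys) y0 t) (y1 \<otimes>\<^bsub>B\<^esub> b)))"

lemma coact_pure_linear:
  "set ys \<subseteq> carrier Y \<Longrightarrow> linear_map K X (TB (length ys)) (\<lambda>x. coact_pure ys x)"
proof (induction ys)
  case Nil
  show ?case by (simp add: linear_simps)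
next
  case (Cons y ys)
  then have "linear_map K X (TB (length ys)) (coact_pure ys)" by simp
  from Cons.prems this linear_closed[OF this] show ?case by (simp add: linear_simps)
qed

lemma coact_pure_closed [simp]:
  "\<lbrakk>set ys \<subseteq> carrier Y; x \<in> carrier X; length ys = n\<rbrakk> \<Longrightarrow> coact_pure ys x \<in> carrier (TB n)"
  using linear_closed[OF coact_pure_linear] by blast

lemma coact_pure_linear_update:
  "\<lbrakk>set ys \<subseteq> carrier Y; i < length ys; x \<in> carrier X\<rbrakk> \<Longrightarrow>
    linear_map K Y (TB (length ys)) (\<lambda>y. coact_pure (ys[i := y]) x)"
proof (induction ys arbitrary: i)
  case (Cons y ys)
  show ?case
  proof (cases i)
    case 0
    with Cons.prems show ?thesis by (simp add: linear_simps)
  next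
    case (Suc j)
    with Cons have "linear_map K Y (TB (length ys)) (\<lambda>y. coact_pure (ys[j := y]) x)" by simp
    from Cons.prems Suc this linear_closed[OF this] show ?thesis by (simp add: linear_simps)
  qed
qed simp

lemma coact_pure_multilinear: "multilinear Y X (TB n) n coact_pure"
  using coact_pure_linear coact_pure_linear_update by (intro multilinearI) blast+

definition coT :: "nat \<Rightarrow> ('k, 'y, 'x) mtens \<Rightarrow> ('k, ('k, 'y, 'x) mtens, 'b) tens" where
  "coT n = lin_ext K (TB n) (\<lambda>(ys, x). coact_pure ys x)"

lemma coT_linear: "linear_map K (T n) (TB n) (coT n)"
  unfolding coT_def by (rule multilinear_lift) (auto intro: coact_pure_multilinear)

lemma coT_mpure:
  "\<lbrakk>set ys \<subseteq> carrier Y; length ys = n; x \<in> carrier X\<rbrakk> \<Longrightarrow> coT n (mpure K Y X n ys x) = coact_pure ys x"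
  unfolding coT_def by (rule multilinear_lift(2)) (auto intro: coact_pure_multilinear)

lemma coT_closed [simp]: "t \<in> carrier (T n) \<Longrightarrow> coT n t \<in> carrier (TB n)"
  by (rule linear_closed[OF coT_linear])

lemma linear_coT [simp]: "linear_map K V (T n) f \<Longrightarrow> linear_map K V (TB n) (\<lambda>v. coT n (f v))"
  by (erule linear_compose[OF _ coT_linear])

text \<open>In these terms T_(n+1) carries the diagonal coaction of Y \<otimes> T_n.\<close>

lemma coT_tcons:
  assumes "y \<in> carrier Y" "t \<in> carrier (T n)"
  shows "coT (Suc n) (tcons Y X n y t) = bnd Y B (TB (Suc n)) (\<rho>Y y)
     (\<lambda>y0 y1. bnd (T n) B (TB (Suc n)) (coT n t)
       (\<lambda>t0 b. pure K (T (Suc n)) B (tcons Y X n y0 t0) (y1 \<otimes>\<^bsub>B\<^esub> b)))"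
proof (rule mtens_ext[OF _ _ assms(2)])
  show "linear_map K (T n) (TB (Suc n)) (\<lambda>t. coT (Suc n) (tcons Y X n y t))"
    using assms by (simp add: linear_simps)
  show "linear_map K (T n) (TB (Suc n)) (\<lambda>t. bnd Y B (TB (Suc n)) (\<rho>Y y)
     (\<lambda>y0 y1. bnd (T n) B (TB (Suc n)) (coT n t)
       (\<lambda>t0 b. pure K (T (Suc n)) B (tcons Y X n y0 t0) (y1 \<otimes>\<^bsub>B\<^esub> b))))"
    using assms by (simp add: linear_simps)
qed (use assms in \<open>auto simp: tcons_mpure coT_mpure\<close>)

lemma coT_zero:
  assumes "x \<in> carrier X"
  shows "coT 0 (mpure K Y X 0 [] x) =
    bnd X B (TB 0) (\<rho>X x) (\<lambda>x0 x1. pure K (T 0) B (mpure K Y X 0 [] x0) x1)"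
  using assms by (simp add: coT_mpure)

text \<open>The continuation of \<open>sweedler_list\<close> changes at every recursive call, so the
  claim is made for all continuations that factor through a linear map \<open>L\<close>. Descending
  past one factor replaces \<open>L\<close> by its composite with the map that prepends y_(0) and
  multiplies by y_(1).\<close>

lemma sweedler_list_coact_pure:
  assumes "set ys \<subseteq> carrier Y" "x \<in> carrier X" and M [simp]: "module K M"
    and "linear_map K (TB (length ys)) M L"
    and "\<And>zs b. \<lbrakk>set zs \<subseteq> carrier Y; length zs = length ys; b \<in> carrier B\<rbrakk> \<Longrightarrow>
      \<psi> zs b = L (bnd X B (TB (length ys)) (\<rho>X x)
        (\<lambda>x0 x1. pure K (T (length ys)) B (mpure K Y X (length ys) zs x0) (b \<otimes>\<^bsub>B\<^esub> x1)))"
  shows "sweedler_list K B M \<rho>Y \<psi> ys = L (coact_pure ys x)"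
  using assms(1,4,5)
proof (induction ys arbitrary: \<psi> L)
  case Nil
  from Nil(3)[of "[]" "\<one>\<^bsub>B\<^esub>"] show ?case by simp
next
  case (Cons y ys)
  let ?n = "length ys"
  define L' where "L' = (\<lambda>y0 y1 u. bnd (T ?n) B (TB (Suc ?n)) u
    (\<lambda>t b. pure K (T (Suc ?n)) B (tcons Y X ?n y0 t) (y1 \<otimes>\<^bsub>B\<^esub> b)))"
  have L': "linear_map K (TB ?n) (TB (Suc ?n)) (\<lambda>u. L' y0 y1 u)"
    if "y0 \<in> carrier Y" "y1 \<in> carrier B" for y0 y1
    unfolding L'_def using that by (simp add: linear_simps)
  have L: "linear_map K (TB (Suc ?n)) M L"
    using Cons.prems by simp
  have [simp]: "y \<in> carrier Y" "set ys \<subseteq> carrier Y"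
    using Cons.prems by auto
  have IH: "sweedler_list K B M \<rho>Y (\<lambda>zs b. \<psi> (y0 # zs) (y1 \<otimes>\<^bsub>B\<^esub> b)) ys = L (L' y0 y1 (coact_pure ys x))"
    if y: "y0 \<in> carrier Y" "y1 \<in> carrier B" for y0 y1
  proof (rule Cons.IH)
    show "linear_map K (TB ?n) M (\<lambda>u. L (L' y0 y1 u))"
      by (rule linear_compose[OF L'[OF y] L])
    fix zs b assume zs: "set zs \<subseteq> carrier Y" "length zs = ?n" "b \<in> carrier B"
    then have "\<psi> (y0 # zs) (y1 \<otimes>\<^bsub>B\<^esub> b) = L (bnd X B (TB (Suc ?n)) (\<rho>X x)
        (\<lambda>x0 x1. pure K (T (Suc ?n)) B (mpure K Y X (Suc ?n) (y0 # zs) x0) (y1 \<otimes>\<^bsub>B\<^esub> b \<otimes>\<^bsub>B\<^esub> x1)))"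
      using y Cons.prems(3)[of "y0 # zs" "y1 \<otimes>\<^bsub>B\<^esub> b"] by simp
    also have "bnd X B (TB (Suc ?n)) (\<rho>X x)
        (\<lambda>x0 x1. pure K (T (Suc ?n)) B (mpure K Y X (Suc ?n) (y0 # zs) x0) (y1 \<otimes>\<^bsub>B\<^esub> b \<otimes>\<^bsub>B\<^esub> x1)) =
        L' y0 y1 (bnd X B (TB ?n) (\<rho>X x) (\<lambda>x0 x1. pure K (T ?n) B (mpure K Y X ?n zs x0) (b \<otimes>\<^bsub>B\<^esub> x1)))"
      unfolding L'_def using y zs assms(2)
      by (simp add: linear_simps bnd_image_simps tcons_mpure)
    finally show "\<psi> (y0 # zs) (y1 \<otimes>\<^bsub>B\<^esub> b) = L (L' y0 y1 (bnd X B (TB ?n) (\<rho>X x)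
      (\<lambda>x0 x1. pure K (T ?n) B (mpure K Y X ?n zs x0) (b \<otimes>\<^bsub>B\<^esub> x1))))" .
  qed simp
  have bil: "bilinear Y B (TB (Suc ?n)) (\<lambda>y0 y1. L' y0 y1 (coact_pure ys x))"
    unfolding L'_def using assms(2) by (simp add: linear_simps)
  have "sweedler_list K B M \<rho>Y \<psi> (y # ys) = bnd Y B M (\<rho>Y y) (\<lambda>y0 y1. L (L' y0 y1 (coact_pure ys x)))"
    unfolding sweedler_list.simps
    by (rule lin_ext_eq_bnd)
      (auto simp: IH intro!: bilinearI linear_compose[OF _ L] bilinearD[OF bil])
  also have "\<dots> = L (bnd Y B (TB (Suc ?n)) (\<rho>Y y) (\<lambda>y0 y1. L' y0 y1 (coact_pure ys x)))"
    by (rule linear_image_bnd[symmetric]) (use L bil in auto)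
  finally show ?case
    unfolding L'_def by simp
qed

lemma coact_eq_coT:
  assumes "t \<in> carrier (T (Suc n))"
  shows "coact K B Y \<rho>Y X \<rho>X n t = coT (Suc n) t"
  unfolding coact_def coT_def Let_def TT_def
proof (simp, rule lin_ext_mtens_cong)
  fix ys :: "'y list" and x
  assume *: "set ys \<subseteq> carrier Y" "length ys = Suc n" "x \<in> carrier X"
  show "sweedler_list K B (TB (Suc n)) \<rho>Y (\<lambda>zs b. lin_ext K (TB (Suc n))
      (\<lambda>(x0, x1). pure K (T (Suc n)) B (mpure K Y X (Suc n) zs x0) (b \<otimes>\<^bsub>B\<^esub> x1)) (\<rho>X x)) ys =
      coact_pure ys x"
  proof (rule sweedler_list_coact_pure[where L = "\<lambda>u. u"])
    fix zs b assume zs: "set zs \<subseteq> carrier Y" "length zs = length ys" "b \<in> carrier B"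
    then show "lin_ext K (TB (Suc n))
      (\<lambda>(x0, x1). pure K (T (Suc n)) B (mpure K Y X (Suc n) zs x0) (b \<otimes>\<^bsub>B\<^esub> x1)) (\<rho>X x) =
      bnd X B (TB (length ys)) (\<rho>X x)
        (\<lambda>x0 x1. pure K (T (length ys)) B (mpure K Y X (length ys) zs x0) (b \<otimes>\<^bsub>B\<^esub> x1))"
      using * by (simp, intro lin_ext_eq_bnd) (auto simp: linear_simps)
  qed (use * in \<open>auto simp: linear_ident\<close>)
qed (use assms in \<open>auto intro: coact_pure_multilinear\<close>)

text \<open>The diagonal coaction on a tensor product of two comodules is a comodule structure
  because \<open>\<Delta>\<close> and \<open>\<epsilon>\<close> are multiplicative; applied to Y and
  T_n this is the induction step.\<close>

lemma right_comodule_T: "right_comodule K B \<Delta> \<epsilon> (T n) (coT n)"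
proof (induction n)
  case 0
  let ?N = "tensor K (T 0) (tensor K B B)"
  show ?case
  proof (rule right_comoduleI[OF coalgebra_B])
    fix t assume t: "t \<in> carrier (T 0)"
    show "bnd (T 0) B ?N (coT 0 t) (\<lambda>t0 b. bnd (T 0) B ?N (coT 0 t0)
        (\<lambda>t00 b1. pure K (T 0) (tensor K B B) t00 (pure K B B b1 b))) =
      bnd (T 0) B ?N (coT 0 t) (\<lambda>t0 b. pure K (T 0) (tensor K B B) t0 (\<Delta> b))"
    proof (rule mtens_ext[OF _ _ t, where M = "?N"])
      fix ys :: "'y list" and x
      assume *: "set ys \<subseteq> carrier Y" "length ys = 0" "x \<in> carrier X"
      let ?\<phi> = "\<lambda>x0 b1 b2. pure K (T 0) (tensor K B B) (mpure K Y X 0 [] x0) (pure K B B b1 b2)"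
      have "bnd X B ?N (\<rho>X x) (\<lambda>x0 b. bnd X B ?N (\<rho>X x0) (\<lambda>x00 b1. ?\<phi> x00 b1 b)) =
          bnd X B ?N (\<rho>X x) (\<lambda>x0 b. bnd B B ?N (\<Delta> b) (\<lambda>b1 b2. ?\<phi> x0 b1 b2))"
        by (rule comodule_coassoc_law[OF right_comodule]) (use * in \<open>simp_all add: linear_simps\<close>)
      \<comment> \<open>Summing over the two legs of a tensor in B \<otimes> B merely puts that
        tensor together again.\<close>
      moreover have "bnd B B ?N (\<Delta> b) (\<lambda>b1 b2. ?\<phi> x0 b1 b2) =
          pure K (T 0) (tensor K B B) (mpure K Y X 0 [] x0) (\<Delta> b)" if "x0 \<in> carrier X" "b \<in> carrier B" for x0 b
        using that tensor_ext[of B B "\<Delta> b" ?N "\<lambda>s. bnd B B ?N s (\<lambda>b1 b2. ?\<phi> x0 b1 b2)"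
          "\<lambda>s. pure K (T 0) (tensor K B B) (mpure K Y X 0 [] x0) s"] by (simp add: linear_simps)
      ultimately show "bnd (T 0) B ?N (coT 0 (mpure K Y X 0 ys x)) (\<lambda>t0 b. bnd (T 0) B ?N (coT 0 t0)
        (\<lambda>t00 b1. pure K (T 0) (tensor K B B) t00 (pure K B B b1 b))) =
        bnd (T 0) B ?N (coT 0 (mpure K Y X 0 ys x)) (\<lambda>t0 b. pure K (T 0) (tensor K B B) t0 (\<Delta> b))"
        using * by (simp add: coT_zero linear_simps bnd_image_simps)
    qed (simp_all add: linear_simps)
    show "bnd (T 0) B (T 0) (coT 0 t) (\<lambda>t0 b. \<epsilon> b \<odot>\<^bsub>T 0\<^esub> t0) = t"
    proof (rule mtens_ext[OF _ _ t, where M = "T 0"])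
      fix ys :: "'y list" and x
      assume *: "set ys \<subseteq> carrier Y" "length ys = 0" "x \<in> carrier X"
      then show "bnd (T 0) B (T 0) (coT 0 (mpure K Y X 0 ys x)) (\<lambda>t0 b. \<epsilon> b \<odot>\<^bsub>T 0\<^esub> t0) = mpure K Y X 0 ys x"
        by (simp add: coT_zero linear_simps bnd_image_simps comodule_counit_law[OF right_comodule])
    qed (simp_all add: linear_simps)
  qed (simp_all add: coT_linear)
next
  case (Suc n)
  let ?N = "tensor K (T (Suc n)) (tensor K B B)"
  show ?case
  proof (rule right_comoduleI[OF coalgebra_B])
    fix t assume t: "t \<in> carrier (T (Suc n))"
    show "bnd (T (Suc n)) B ?N (coT (Suc n) t) (\<lambda>t0 b. bnd (T (Suc n)) B ?N (coT (Suc n) t0)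
        (\<lambda>t00 b1. pure K (T (Suc n)) (tensor K B B) t00 (pure K B B b1 b))) =
      bnd (T (Suc n)) B ?N (coT (Suc n) t) (\<lambda>t0 b. pure K (T (Suc n)) (tensor K B B) t0 (\<Delta> b))"
    proof (rule mtens_Suc_ext[OF _ _ t, where M = "?N"])
      fix y u
      assume *: "y \<in> carrier Y" "u \<in> carrier (T n)"
      let ?\<phi> = "\<lambda>y0 c1 c2 u0 b1 b2. pure K (T (Suc n)) (tensor K B B) (tcons Y X n y0 u0)
        (pure K B B (c1 \<otimes>\<^bsub>B\<^esub> b1) (c2 \<otimes>\<^bsub>B\<^esub> b2))"
      have "bnd (T (Suc n)) B ?N (coT (Suc n) (tcons Y X n y u)) (\<lambda>t0 b. bnd (T (Suc n)) B ?N (coT (Suc n) t0)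
        (\<lambda>t00 b1. pure K (T (Suc n)) (tensor K B B) t00 (pure K B B b1 b))) =
        bnd Y B ?N (\<rho>Y y) (\<lambda>y0 c2. bnd (T n) B ?N (coT n u) (\<lambda>u0 b2.
          bnd Y B ?N (\<rho>Y y0) (\<lambda>y00 c1. bnd (T n) B ?N (coT n u0) (\<lambda>u00 b1. ?\<phi> y00 c1 c2 u00 b1 b2))))"
        using * by (simp add: coT_tcons linear_simps bnd_image_simps)
      \<comment> \<open>The sums for y and for u are independent. The swap brings the two successive
        coactions of y together, so that coassociativity can be applied first for Y and then for
        T_n.\<close>
      also have "\<dots> = bnd Y B ?N (\<rho>Y y) (\<lambda>y0 c2. bnd Y B ?N (\<rho>Y y0) (\<lambda>y00 c1.
          bnd (T n) B ?N (coT n u) (\<lambda>u0 b2. bnd (T n) B ?N (coT n u0) (\<lambda>u00 b1. ?\<phi> y00 c1 c2 u00 b1 b2))))"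
        using * by (intro bnd_cong refl bnd_swap) (simp_all add: linear_simps)
      also have "\<dots> = bnd Y B ?N (\<rho>Y y) (\<lambda>y0 c. bnd B B ?N (\<Delta> c) (\<lambda>c1 c2.
          bnd (T n) B ?N (coT n u) (\<lambda>u0 b2. bnd (T n) B ?N (coT n u0) (\<lambda>u00 b1. ?\<phi> y0 c1 c2 u00 b1 b2))))"
        using * by (intro comodule_coassoc_law[OF comodule_Y]) (simp_all add: linear_simps)
      also have "\<dots> = bnd Y B ?N (\<rho>Y y) (\<lambda>y0 c. bnd B B ?N (\<Delta> c) (\<lambda>c1 c2.
          bnd (T n) B ?N (coT n u) (\<lambda>u0 b. bnd B B ?N (\<Delta> b) (\<lambda>b1 b2. ?\<phi> y0 c1 c2 u0 b1 b2))))"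
        using * by (intro bnd_cong refl comodule_coassoc_law[OF Suc]) (simp_all add: linear_simps)
      also have "\<dots> = bnd Y B ?N (\<rho>Y y) (\<lambda>y0 c. bnd (T n) B ?N (coT n u) (\<lambda>u0 b.
          bnd B B ?N (\<Delta> c) (\<lambda>c1 c2. bnd B B ?N (\<Delta> b) (\<lambda>b1 b2. ?\<phi> y0 c1 c2 u0 b1 b2))))"
        using * by (intro bnd_cong refl bnd_swap) (simp_all add: linear_simps)
      \<comment> \<open>The products of legs assemble into the coproduct of a product, by
        multiplicativity of \<open>\<Delta>\<close>.\<close>
      also have "\<dots> = bnd (T (Suc n)) B ?N (coT (Suc n) (tcons Y X n y u)) (\<lambda>t0 b. pure K (T (Suc n)) (tensor K B B) t0 (\<Delta> b))"
        using * by (simp add: coT_tcons linear_simps bnd_image_simps comult_mult)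
      finally show "bnd (T (Suc n)) B ?N (coT (Suc n) (tcons Y X n y u)) (\<lambda>t0 b. bnd (T (Suc n)) B ?N (coT (Suc n) t0)
        (\<lambda>t00 b1. pure K (T (Suc n)) (tensor K B B) t00 (pure K B B b1 b))) =
        bnd (T (Suc n)) B ?N (coT (Suc n) (tcons Y X n y u)) (\<lambda>t0 b. pure K (T (Suc n)) (tensor K B B) t0 (\<Delta> b))" .
    qed (simp_all add: linear_simps)
    show "bnd (T (Suc n)) B (T (Suc n)) (coT (Suc n) t) (\<lambda>t0 b. \<epsilon> b \<odot>\<^bsub>T (Suc n)\<^esub> t0) = t"
    proof (rule mtens_Suc_ext[OF _ _ t, where M = "T (Suc n)"])
      fix y u
      assume *: "y \<in> carrier Y" "u \<in> carrier (T n)"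
      interpret T: module K "T (Suc n)" by simp
      \<comment> \<open>The order of the scalars is chosen so that the counit belonging to the inner
        sum stands outermost, as the counit law for T_n requires.\<close>
      have sm: "(a \<otimes> c) \<odot>\<^bsub>T (Suc n)\<^esub> v = c \<odot>\<^bsub>T (Suc n)\<^esub> (a \<odot>\<^bsub>T (Suc n)\<^esub> v)"
        if "a \<in> carrier K" "c \<in> carrier K" "v \<in> carrier (T (Suc n))" for a c v
        using that by (simp add: m_comm[of a c] T.smult_assoc1)
      have "bnd (T (Suc n)) B (T (Suc n)) (coT (Suc n) (tcons Y X n y u)) (\<lambda>t0 b. \<epsilon> b \<odot>\<^bsub>T (Suc n)\<^esub> t0) =
          bnd Y B (T (Suc n)) (\<rho>Y y) (\<lambda>y0 y1. bnd (T n) B (T (Suc n)) (coT n u)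
            (\<lambda>u0 b. \<epsilon> b \<odot>\<^bsub>T (Suc n)\<^esub> (\<epsilon> y1 \<odot>\<^bsub>T (Suc n)\<^esub> tcons Y X n y0 u0)))"
        using * by (simp add: coT_tcons linear_simps bnd_image_simps counit_mult sm)
      also have "\<dots> = bnd Y B (T (Suc n)) (\<rho>Y y) (\<lambda>y0 y1. \<epsilon> y1 \<odot>\<^bsub>T (Suc n)\<^esub> tcons Y X n y0 u)"
        using * by (intro bnd_cong refl comodule_counit_law[OF Suc]) (simp_all add: linear_simps)
      also have "\<dots> = tcons Y X n y u"
        using * by (intro comodule_counit_law[OF comodule_Y]) (simp_all add: linear_simps)
      finally show "bnd (T (Suc n)) B (T (Suc n)) (coT (Suc n) (tcons Y X n y u))
        (\<lambda>t0 b. \<epsilon> b \<odot>\<^bsub>T (Suc n)\<^esub> t0) = tcons Y X n y u" .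
    qed (use t in \<open>simp_all add: linear_simps\<close>)
  qed (simp_all add: coT_linear)
qed

end

section \<open>Faces and the cyclic operator\<close>

context comodule_data
begin

section \<open>Inner faces\<close>

definition mulat :: "nat \<Rightarrow> 'y list \<Rightarrow> 'y list" where
  "mulat j ys = take j ys @ [ys ! j \<otimes>\<^bsub>Y\<^esub> ys ! (j + 1)] @ drop (j + 2) ys"

lemma mulat_simps [simp]:
  "mulat 0 (a # b # ys) = (a \<otimes>\<^bsub>Y\<^esub> b) # ys"
  "mulat (Suc j) (a # ys) = a # mulat j ys"
  "length ys = j \<Longrightarrow> mulat j (ys @ [a, b]) = ys @ [a \<otimes>\<^bsub>Y\<^esub> b]"
  by (auto simp: mulat_def nth_append)

lemma mulat_append: "Suc j < length ys \<Longrightarrow> mulat j (ys @ zs) = mulat j ys @ zs"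
  by (simp add: mulat_def nth_append)

lemma mulat_closed:
  assumes "set ys \<subseteq> carrier Y" "Suc j < length ys"
  shows "set (mulat j ys) \<subseteq> carrier Y" "length (mulat j ys) = length ys - 1"
proof -
  have "ys ! j \<in> carrier Y" "ys ! Suc j \<in> carrier Y"
    using assms nth_mem[of j ys] nth_mem[of "Suc j" ys] by auto
  then show "set (mulat j ys) \<subseteq> carrier Y"
    using assms set_take_subset[of j ys] set_drop_subset[of "j + 2" ys] by (auto simp: mulat_def)
qed (use assms in \<open>auto simp: mulat_def\<close>)

text \<open>Stripping common leading factors reduces to \<open>i = 0\<close>. There either the two
  products are disjoint or they overlap in one factor.\<close>

lemma mulat_mulat:
  "\<lbrakk>set ys \<subseteq> carrier Y; i < j; Suc j < length ys\<rbrakk> \<Longrightarrow> mulat i (mulat j ys) = mulat (j - 1) (mulat i ys)"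
proof (induction i arbitrary: j ys)
  case 0
  then obtain k a b c zs where "j = Suc k" "ys = a # b # c # zs"
    by (cases j; cases ys; cases "tl ys"; cases "tl (tl ys)") auto
  \<comment> \<open>For \<open>k = 0\<close> the products overlap and associativity of Y is used;
    for larger \<open>k\<close> they do not touch.\<close>
  with 0 show ?case
    by (cases k) auto
next
  case (Suc i)
  then obtain a zs k where "ys = a # zs" "j = Suc (Suc k)"
    by (cases ys; cases j; cases "j - 1") auto
  with Suc.prems Suc.IH[of zs "Suc k"] show ?case
    by auto
qed

lemma mpure_Cons:
  "\<lbrakk>set ys \<subseteq> carrier Y; length ys = n; x \<in> carrier X; y \<in> carrier Y\<rbrakk> \<Longrightarrow>
    mpure K Y X (Suc n) (y # ys) x = tcons Y X n y (mpure K Y X n ys x)"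
  by (simp add: tcons_mpure)

text \<open>Multilinearity is not immediate from that of \<open>mpure\<close>, since a slot may be
  one of the two multiplied factors. Leading factors are peeled off until the product stands in
  front.\<close>

lemma mulat_linear:
  "\<lbrakk>set ys \<subseteq> carrier Y; length ys = Suc n; j < n; i < length ys; x \<in> carrier X\<rbrakk> \<Longrightarrow>
    linear_map K Y (T n) (\<lambda>y. mpure K Y X n (mulat j (ys[i := y])) x)"
proof (induction j arbitrary: ys i n)
  case 0
  then obtain a b zs where ys: "ys = a # b # zs"
    by (cases ys; cases "tl ys") auto
  then obtain m where n: "n = Suc m"
    using 0 by (cases n) auto
  have zs: "set zs \<subseteq> carrier Y" "length zs = m" "a \<in> carrier Y" "b \<in> carrier Y" "x \<in> carrier X"
    using 0 ys n by auto
  \<comment> \<open>The updated slot is the left factor of the product, its right factor, or lies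
    behind the product.\<close>
  consider "i = 0" | "i = 1" | k where "i = Suc (Suc k)" "k < m"
    using 0 ys n by (cases i; cases "i - 1") auto
  then show ?case
  proof cases
    case 1
    have L: "linear_map K Y (T (Suc m)) (\<lambda>y. tcons Y X m (y \<otimes>\<^bsub>Y\<^esub> b) (mpure K Y X m zs x))"
      using zs by (simp add: linear_simps)
    show ?thesis
      unfolding n by (rule linear_cong[OF L]) (use zs in \<open>auto simp: ys 1 mpure_Cons\<close>)
  next
    case 2
    have L: "linear_map K Y (T (Suc m)) (\<lambda>y. tcons Y X m (a \<otimes>\<^bsub>Y\<^esub> y) (mpure K Y X m zs x))"
      using zs by (simp add: linear_simps)
    show ?thesis
      unfolding n by (rule linear_cong[OF L]) (use zs in \<open>auto simp: ys 2 mpure_Cons\<close>)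
  next
    case (3 k)
    have L: "linear_map K Y (T (Suc m)) (\<lambda>y. tcons Y X m (a \<otimes>\<^bsub>Y\<^esub> b) (mpure K Y X m (zs[k := y]) x))"
      using zs 3 by (intro linear_tcons multilinearD(2)[OF mpure_multilinear]) auto
    show ?thesis
      unfolding n by (rule linear_cong[OF L]) (use zs in \<open>auto simp: ys 3 mpure_Cons\<close>)
  qed
next
  case (Suc j)
  then obtain a zs where ys: "ys = a # zs"
    by (cases ys) auto
  then obtain m where n: "n = Suc m"
    using Suc by (cases n) auto
  have zs: "set zs \<subseteq> carrier Y" "length zs = Suc m" "a \<in> carrier Y" "x \<in> carrier X" "j < m"
    using Suc ys n by auto
  show ?case
  proof (cases i)
    case 0
    have L: "linear_map K Y (T (Suc m)) (\<lambda>y. tcons Y X m y (mpure K Y X m (mulat j zs) x))"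
      using zs mulat_closed[of zs j] by (intro linear_tcons linear_ident mpure_closed) auto
    show ?thesis
      unfolding n by (rule linear_cong[OF L]) (use zs mulat_closed[of zs j] in \<open>auto simp: ys 0 mpure_Cons\<close>)
  next
    case (Suc k)
    have L: "linear_map K Y (T (Suc m)) (\<lambda>y. tcons Y X m a (mpure K Y X m (mulat j (zs[k := y])) x))"
      using zs Suc Suc.prems ys by (intro linear_tcons Suc.IH) auto
    show ?thesis
      unfolding n
      by (rule linear_cong[OF L])
        (use zs mulat_closed[of "zs[k := _]" j] in \<open>auto simp: ys Suc mpure_Cons\<close>)
  qed
qed

lemma mulat_multilinear:
  assumes "j < n" shows "multilinear Y X (T n) (Suc n) (\<lambda>ys x. mpure K Y X n (mulat j ys) x)"
proof (rule multilinearI)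
  fix ys :: "'y list" assume ys: "set ys \<subseteq> carrier Y" "length ys = Suc n"
  show "linear_map K X (T n) (\<lambda>x. mpure K Y X n (mulat j ys) x)"
    using mulat_closed[OF ys(1), of j] ys assms by (intro linear_mpure linear_ident) auto
qed (use mulat_linear assms in auto)

text \<open>The index counts the factors of Y in the target. Since \<open>TT K Y X n\<close> has n +
  1 factors, \<open>mulT n j\<close> is the face \<partial>_j on the space of degree n.\<close>

definition mulT :: "nat \<Rightarrow> nat \<Rightarrow> ('k, 'y, 'x) mtens \<Rightarrow> ('k, 'y, 'x) mtens" where
  "mulT n j = lin_ext K (T n) (\<lambda>(ys, x). mpure K Y X n (mulat j ys) x)"

context
  fixes n j :: nat assumes jn: "j < n"
begin

lemma mulT_linear: "linear_map K (T (Suc n)) (T n) (mulT n j)"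
  unfolding mulT_def by (rule multilinear_lift) (auto intro: mulat_multilinear[OF jn])

lemma mulT_mpure:
  "\<lbrakk>set ys \<subseteq> carrier Y; length ys = Suc n; x \<in> carrier X\<rbrakk> \<Longrightarrow>
    mulT n j (mpure K Y X (Suc n) ys x) = mpure K Y X n (mulat j ys) x"
  unfolding mulT_def by (rule multilinear_lift(2)) (auto intro: mulat_multilinear[OF jn])

lemma mulT_closed [simp]: "t \<in> carrier (T (Suc n)) \<Longrightarrow> mulT n j t \<in> carrier (T n)"
  by (rule linear_closed[OF mulT_linear])

lemma linear_mulT [simp]: "linear_map K V (T (Suc n)) f \<Longrightarrow> linear_map K V (T n) (\<lambda>v. mulT n j (f v))"
  by (erule linear_compose[OF _ mulT_linear])

lemma mulT_bnd:
  "\<lbrakk>module K A; module K C; bilinear A C (T (Suc n)) \<phi>; t \<in> carrier (tensor K A C)\<rbrakk> \<Longrightarrow>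
    mulT n j (bnd A C (T (Suc n)) t \<phi>) = bnd A C (T n) t (\<lambda>a c. mulT n j (\<phi> a c))"
  by (rule linear_image_bnd[OF _ _ _ _ mulT_linear]) auto

end

lemma mulT_tcons_zero:
  assumes "a \<in> carrier Y" "b \<in> carrier Y" "t \<in> carrier (T n)"
  shows "mulT (Suc n) 0 (tcons Y X (Suc n) a (tcons Y X n b t)) = tcons Y X n (a \<otimes>\<^bsub>Y\<^esub> b) t"
  by (rule mtens_ext[OF _ _ assms(3), where M = "T (Suc n)"])
    (use assms in \<open>auto simp: linear_simps tcons_mpure mulT_mpure\<close>)

lemma mulT_tcons_Suc:
  assumes "j < n" "a \<in> carrier Y" "t \<in> carrier (T (Suc n))"
  shows "mulT (Suc n) (Suc j) (tcons Y X (Suc n) a t) = tcons Y X n a (mulT n j t)"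
proof (rule mtens_ext[OF _ _ assms(3), where M = "T (Suc n)"])
  fix ys :: "'y list" and x assume *: "set ys \<subseteq> carrier Y" "length ys = Suc n" "x \<in> carrier X"
  then show "mulT (Suc n) (Suc j) (tcons Y X (Suc n) a (mpure K Y X (Suc n) ys x)) =
      tcons Y X n a (mulT n j (mpure K Y X (Suc n) ys x))"
    using assms mulat_closed[of ys j] by (simp add: tcons_mpure mulT_mpure)
qed (use assms in \<open>auto simp: linear_simps\<close>)

lemma mulT_mulT:
  assumes "i < j" "j < Suc n" "t \<in> carrier (T (Suc (Suc n)))"
  shows "mulT n i (mulT (Suc n) j t) = mulT n (j - 1) (mulT (Suc n) i t)"
proof (rule mtens_ext[OF _ _ assms(3), where M = "T n"])
  fix ys :: "'y list" and x assume *: "set ys \<subseteq> carrier Y" "length ys = Suc (Suc n)" "x \<in> carrier X"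
  then show "mulT n i (mulT (Suc n) j (mpure K Y X (Suc (Suc n)) ys x)) =
      mulT n (j - 1) (mulT (Suc n) i (mpure K Y X (Suc (Suc n)) ys x))"
    using assms(1,2) mulat_closed[of ys j] mulat_closed[of ys i] mulat_mulat[of ys i j]
    by (simp add: mulT_mpure)
qed (use assms in \<open>auto simp: linear_ident\<close>)

text \<open>The coefficients of neighbouring factors are adjacent in the product in B, and the
  coaction of Y is multiplicative; hence multiplying two neighbours commutes with the coaction.
  Factors in front are peeled off by induction on \<open>j\<close>.\<close>

lemma coT_mulT:
  "\<lbrakk>j < n; t \<in> carrier (T (Suc n))\<rbrakk> \<Longrightarrow>
    coT n (mulT n j t) = bnd (T (Suc n)) B (TB n) (coT (Suc n) t) (\<lambda>t0 b. pure K (T n) B (mulT n j t0) b)"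
proof (induction j arbitrary: n t)
  case 0
  then obtain m where n: "n = Suc m" by (cases n) auto
  show ?case
    unfolding n
  proof (rule mtens_Suc_ext[OF _ _ 0(2)[unfolded n], where M = "TB (Suc m)"])
    fix a u assume a: "a \<in> carrier Y" and u: "u \<in> carrier (T (Suc m))"
    show "coT (Suc m) (mulT (Suc m) 0 (tcons Y X (Suc m) a u)) =
      bnd (T (Suc (Suc m))) B (TB (Suc m)) (coT (Suc (Suc m)) (tcons Y X (Suc m) a u))
        (\<lambda>t0 b. pure K (T (Suc m)) B (mulT (Suc m) 0 t0) b)"
      by (rule mtens_Suc_ext[OF _ _ u, where M = "TB (Suc m)"])
        (use a in \<open>simp_all add: linear_simps bnd_image_simps coT_tcons mulT_tcons_zero coact_Y_mult\<close>)
  qed (simp_all add: linear_simps)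
next
  case (Suc j)
  then obtain m where n: "n = Suc m" by (cases n) auto
  show ?case
    unfolding n
  proof (rule mtens_Suc_ext[OF _ _ Suc.prems(2)[unfolded n], where M = "TB (Suc m)"])
    fix a u assume "a \<in> carrier Y" "u \<in> carrier (T (Suc m))"
    then show "coT (Suc m) (mulT (Suc m) (Suc j) (tcons Y X (Suc m) a u)) =
      bnd (T (Suc (Suc m))) B (TB (Suc m)) (coT (Suc (Suc m)) (tcons Y X (Suc m) a u))
        (\<lambda>t0 b. pure K (T (Suc m)) B (mulT (Suc m) (Suc j) t0) b)"
      using Suc.prems n by (simp add: linear_simps bnd_image_simps coT_tcons mulT_tcons_Suc Suc.IH)
  qed (use Suc.prems n in \<open>simp_all add: linear_simps\<close>)
qed

section \<open>The cyclic operator and its relations with the inner faces\<close>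

definition cyc_pure :: "nat \<Rightarrow> 'y list \<Rightarrow> 'x \<Rightarrow> ('k, 'y, 'x) mtens" where
  "cyc_pure n ys x = bnd Y B (T (Suc n)) (\<rho>Y (last ys))
     (\<lambda>y0 y1. tcons Y X n y0 (mpure K Y X n (butlast ys) (act y1 x)))"

lemma cyc_pure_multilinear: "multilinear Y X (T (Suc n)) (Suc n) (cyc_pure n)"
proof (rule multilinearI)
  fix ys :: "'y list" assume "set ys \<subseteq> carrier Y" "length ys = Suc n"
  then obtain zs z where ys: "ys = zs @ [z]" "set zs \<subseteq> carrier Y" "length zs = n" "z \<in> carrier Y"
    by (cases ys rule: rev_cases) auto
  show "linear_map K X (T (Suc n)) (\<lambda>x. cyc_pure n ys x)"
    unfolding cyc_pure_def using ys by (simp add: linear_simps)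
  fix i x assume i: "i < Suc n" "x \<in> carrier X"
  show "linear_map K Y (T (Suc n)) (\<lambda>y. cyc_pure n (ys[i := y]) x)"
  proof (cases "i < n")
    case True
    with ys i show ?thesis
      unfolding cyc_pure_def
      by (simp add: linear_simps list_update_append multilinearD(2)[OF mpure_multilinear])
  next
    case False
    with i ys have "i = length zs" by simp
    with i ys show ?thesis
      unfolding cyc_pure_def by (simp add: linear_simps list_update_append)
  qed
qed

text \<open>
  The space \<open>TT K Y X n\<close> is \<open>T (Suc n)\<close>; the index of \<open>tau\<close> is that of \<open>\<tau>\<^sub>n\<close>.
\<close>

definition tau :: "nat \<Rightarrow> ('k, 'y, 'x) mtens \<Rightarrow> ('k, 'y, 'x) mtens" where
  "tau n = lin_ext K (T (Suc n)) (\<lambda>(ys, x). cyc_pure n ys x)"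

lemma tau_linear: "linear_map K (T (Suc n)) (T (Suc n)) (tau n)"
  unfolding tau_def by (rule multilinear_lift) (auto intro: cyc_pure_multilinear)

lemma tau_mpure:
  "\<lbrakk>set ys \<subseteq> carrier Y; length ys = n; x \<in> carrier X; y \<in> carrier Y\<rbrakk> \<Longrightarrow>
    tau n (mpure K Y X (Suc n) (ys @ [y]) x) =
    bnd Y B (T (Suc n)) (\<rho>Y y) (\<lambda>y0 y1. tcons Y X n y0 (mpure K Y X n ys (act y1 x)))"
  unfolding tau_def by (subst multilinear_lift(2)) (auto intro: cyc_pure_multilinear simp: cyc_pure_def)

lemma tau_closed [simp]: "t \<in> carrier (T (Suc n)) \<Longrightarrow> tau n t \<in> carrier (T (Suc n))"
  by (rule linear_closed[OF tau_linear])

lemma linear_tau [simp]: "linear_map K V (T (Suc n)) f \<Longrightarrow> linear_map K V (T (Suc n)) (\<lambda>v. tau n (f v))"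
  by (erule linear_compose[OF _ tau_linear])

lemma tau_bnd:
  "\<lbrakk>module K A; module K C; bilinear A C (T (Suc n)) \<phi>; t \<in> carrier (tensor K A C)\<rbrakk> \<Longrightarrow>
    tau n (bnd A C (T (Suc n)) t \<phi>) = bnd A C (T (Suc n)) t (\<lambda>a c. tau n (\<phi> a c))"
  by (rule linear_image_bnd[OF _ _ _ _ tau_linear]) auto

text \<open>\<open>tau\<close> reads the last factor, so comparison on tensors split at the end
  replaces the split at the front.\<close>

lemma mtens_snoc_ext:
  assumes "t \<in> carrier (T (Suc n))"
    and "linear_map K (T (Suc n)) M f" "linear_map K (T (Suc n)) M g"
    and "\<And>ys y x. \<lbrakk>set ys \<subseteq> carrier Y; length ys = n; y \<in> carrier Y; x \<in> carrier X\<rbrakk> \<Longrightarrow>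
      f (mpure K Y X (Suc n) (ys @ [y]) x) = g (mpure K Y X (Suc n) (ys @ [y]) x)"
  shows "f t = g t"
proof (rule mtens_ext[OF _ _ assms(1-3)])
  fix ys :: "'y list" and x assume *: "set ys \<subseteq> carrier Y" "length ys = Suc n" "x \<in> carrier X"
  then obtain zs z where "ys = zs @ [z]" by (cases ys rule: rev_cases) auto
  with * assms(4)[of zs z x] show "f (mpure K Y X (Suc n) ys x) = g (mpure K Y X (Suc n) ys x)"
    by simp
qed auto

text \<open>The product does not involve the last factor, and the rotation only shifts its position
  by one.\<close>

lemma mulT_tau_Suc:
  assumes "k < m" "t \<in> carrier (T (Suc (Suc m)))"
  shows "mulT (Suc m) (Suc k) (tau (Suc m) t) = tau m (mulT (Suc m) k t)"
proof (rule mtens_snoc_ext[OF assms(2), where M = "T (Suc m)"])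
  fix ys y x assume *: "set ys \<subseteq> carrier Y" "length ys = Suc m" "y \<in> carrier Y" "x \<in> carrier X"
  have c: "mulat k (ys @ [y]) = mulat k ys @ [y]" "set (mulat k ys) \<subseteq> carrier Y" "length (mulat k ys) = m"
    using mulat_closed[of ys k] * assms(1) by (auto simp: mulat_append)
  have "tau m (mulT (Suc m) k (mpure K Y X (Suc (Suc m)) (ys @ [y]) x)) =
      tau m (mpure K Y X (Suc m) (mulat k ys @ [y]) x)"
    using * c assms(1) by (subst mulT_mpure) auto
  also have "\<dots> = bnd Y B (T (Suc m)) (\<rho>Y y) (\<lambda>y0 y1. tcons Y X m y0 (mpure K Y X m (mulat k ys) (act y1 x)))"
    using * c by (intro tau_mpure) auto
  also have "\<dots> = mulT (Suc m) (Suc k) (tau (Suc m) (mpure K Y X (Suc (Suc m)) (ys @ [y]) x))"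
    using * assms(1) by (simp add: tau_mpure mulT_bnd linear_simps mulT_tcons_Suc mulT_mpure)
  finally show "mulT (Suc m) (Suc k) (tau (Suc m) (mpure K Y X (Suc (Suc m)) (ys @ [y]) x)) =
      tau m (mulT (Suc m) k (mpure K Y X (Suc (Suc m)) (ys @ [y]) x))" ..
qed (use assms in \<open>simp_all add: linear_simps\<close>)

text \<open>Rotating the last two factors one after the other and then multiplying them gives the
  same as multiplying first and rotating the product: the coaction of Y is multiplicative and the
  action on X is associative. With \<partial>_n = \<partial>_0 \<tau> this is the relation between
  \<tau> and the last face.\<close>

lemma mulT_tau_tau:
  assumes "t \<in> carrier (T (Suc (Suc m)))"
  shows "mulT (Suc m) 0 (tau (Suc m) (tau (Suc m) t)) = tau m (mulT (Suc m) m t)"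
proof (rule mtens_snoc_ext[OF assms, where M = "T (Suc m)"])
  fix zs v x assume "set zs \<subseteq> carrier Y" "length zs = Suc m" and v: "v \<in> carrier Y" "x \<in> carrier X"
  then obtain ys u where zs: "zs = ys @ [u]" "set ys \<subseteq> carrier Y" "length ys = m" "u \<in> carrier Y"
    by (cases zs rule: rev_cases) auto
  have 1: "tau (Suc m) (mpure K Y X (Suc (Suc m)) (zs @ [v]) x) =
      bnd Y B (T (Suc (Suc m))) (\<rho>Y v) (\<lambda>v0 v1. tcons Y X (Suc m) v0 (mpure K Y X (Suc m) zs (act v1 x)))"
    using zs v by (intro tau_mpure) auto
  \<comment> \<open>In the second rotation v0 already stands in front, so the list ends in
    u.\<close>
  have 2: "tau (Suc m) (tcons Y X (Suc m) v0 (mpure K Y X (Suc m) zs x')) =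
      bnd Y B (T (Suc (Suc m))) (\<rho>Y u) (\<lambda>u0 u1. tcons Y X (Suc m) u0 (tcons Y X m v0 (mpure K Y X m ys (act u1 x'))))"
    if "v0 \<in> carrier Y" "x' \<in> carrier X" for v0 x'
    using tau_mpure[of "v0 # ys" "Suc m" x' u] zs that by (simp add: mpure_Cons)
  have "mulT (Suc m) 0 (tau (Suc m) (tau (Suc m) (mpure K Y X (Suc (Suc m)) (zs @ [v]) x))) =
      bnd Y B (T (Suc m)) (\<rho>Y v) (\<lambda>v0 v1. bnd Y B (T (Suc m)) (\<rho>Y u)
      (\<lambda>u0 u1. tcons Y X m (u0 \<otimes>\<^bsub>Y\<^esub> v0) (mpure K Y X m ys (act u1 (act v1 x)))))"
    unfolding 1 using zs(2-) \<open>set zs \<subseteq> carrier Y\<close> \<open>length zs = Suc m\<close> v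
    by (simp add: 2 tau_bnd mulT_bnd linear_simps mulT_tcons_zero)
  \<comment> \<open>The rotations sum over v first; the coaction of the product u v sums over u
    first.\<close>
  also have "\<dots> = bnd Y B (T (Suc m)) (\<rho>Y u) (\<lambda>u0 u1. bnd Y B (T (Suc m)) (\<rho>Y v)
      (\<lambda>v0 v1. tcons Y X m (u0 \<otimes>\<^bsub>Y\<^esub> v0) (mpure K Y X m ys (act u1 (act v1 x)))))"
    using zs v by (intro bnd_swap) (simp_all add: linear_simps)
  also have "\<dots> = tau m (mpure K Y X (Suc m) (ys @ [u \<otimes>\<^bsub>Y\<^esub> v]) x)"
    using zs v by (simp add: tau_mpure coact_Y_mult linear_simps bnd_image_simps)
  also have "mpure K Y X (Suc m) (ys @ [u \<otimes>\<^bsub>Y\<^esub> v]) x = mulT (Suc m) m (mpure K Y X (Suc (Suc m)) (zs @ [v]) x)"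
    using zs v by (simp add: mulT_mpure)
  finally show "mulT (Suc m) 0 (tau (Suc m) (tau (Suc m) (mpure K Y X (Suc (Suc m)) (zs @ [v]) x))) =
    tau m (mulT (Suc m) m (mpure K Y X (Suc (Suc m)) (zs @ [v]) x))" .
qed (simp_all add: linear_simps)

section \<open>Powers of the cyclic operator\<close>

definition actT :: "nat \<Rightarrow> 'b \<Rightarrow> ('k, 'y, 'x) mtens \<Rightarrow> ('k, 'y, 'x) mtens" where
  "actT n b = lin_ext K (T n) (\<lambda>(ys, x). mpure K Y X n ys (act b x))"

lemma actT_multilinear:
  "b \<in> carrier B \<Longrightarrow> multilinear Y X (T n) n (\<lambda>ys x. mpure K Y X n ys (act b x))"
  by (rule multilinearI) (auto simp: linear_simps multilinearD(2)[OF mpure_multilinear])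

lemma actT_linear: "b \<in> carrier B \<Longrightarrow> linear_map K (T n) (T n) (actT n b)"
  unfolding actT_def by (rule multilinear_lift) (auto intro: actT_multilinear)

lemma actT_mpure:
  "\<lbrakk>set ys \<subseteq> carrier Y; length ys = n; x \<in> carrier X; b \<in> carrier B\<rbrakk> \<Longrightarrow>
    actT n b (mpure K Y X n ys x) = mpure K Y X n ys (act b x)"
  unfolding actT_def by (rule multilinear_lift(2)) (auto intro: actT_multilinear)

lemma actT_closed [simp]: "\<lbrakk>b \<in> carrier B; t \<in> carrier (T n)\<rbrakk> \<Longrightarrow> actT n b t \<in> carrier (T n)"
  by (rule linear_closed[OF actT_linear])

lemma actT_linear_left: 
  assumes "t \<in> carrier (T n)" shows "linear_map K B (T n) (\<lambda>b. actT n b t)"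
  using assms
proof (induction rule: mtens_induct[OF algebra_Y_simps(1) comodule_X_simps(1), consumes 1, case_names mpure add])
  case (mpure ys x)
  have L: "linear_map K B (T n) (\<lambda>b. mpure K Y X n ys (act b x))"
    using mpure by (simp add: linear_simps)
  show ?case
    by (rule linear_cong[OF L]) (use mpure in \<open>auto simp: actT_mpure\<close>)
next
  case (add u v)
  show ?case
    by (rule linear_cong[OF linear_sum[OF add(3,4)]])
      (use add in \<open>auto simp: linear_add[OF actT_linear]\<close>)
qed

lemma linear_actT [simp]:
  shows "\<lbrakk>linear_map K V B f; t \<in> carrier (T n)\<rbrakk> \<Longrightarrow> linear_map K V (T n) (\<lambda>v. actT n (f v) t)"
    and "\<lbrakk>linear_map K V (T n) g; b \<in> carrier B\<rbrakk> \<Longrightarrow> linear_map K V (T n) (\<lambda>v. actT n b (g v))"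
  by (rule linear_compose, assumption, erule actT_linear_left actT_linear)+

lemma actT_mult:
  "\<lbrakk>a \<in> carrier B; b \<in> carrier B; t \<in> carrier (T n)\<rbrakk> \<Longrightarrow> actT n (a \<otimes>\<^bsub>B\<^esub> b) t = actT n a (actT n b t)"
  by (rule mtens_ext[where M = "T n"]) (auto simp: linear_simps actT_mpure)

lemma actT_one: "t \<in> carrier (T n) \<Longrightarrow> actT n \<one>\<^bsub>B\<^esub> t = t"
  by (rule mtens_ext[where M = "T n" and g = "\<lambda>t. t"]) (auto simp: linear_simps actT_mpure)

lemma actT_tcons:
  "\<lbrakk>b \<in> carrier B; y \<in> carrier Y; t \<in> carrier (T n)\<rbrakk> \<Longrightarrow>
    actT (Suc n) b (tcons Y X n y t) = tcons Y X n y (actT n b t)"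
  by (rule mtens_ext[where M = "T (Suc n)" and n = n]) (auto simp: linear_simps actT_mpure tcons_mpure)

lemma actT_bnd:
  "\<lbrakk>module K A; module K C; bilinear A C (T n) \<phi>; t \<in> carrier (tensor K A C); b \<in> carrier B\<rbrakk> \<Longrightarrow>
    actT n b (bnd A C (T n) t \<phi>) = bnd A C (T n) t (\<lambda>a c. actT n b (\<phi> a c))"
  by (rule linear_image_bnd[OF _ _ _ _ actT_linear]) auto

text \<open>
  \<open>prepend [z\<^sub>1, \<dots>, z\<^sub>r] m (y\<^sub>1 \<otimes> \<cdots> \<otimes> y\<^sub>m \<otimes> x)\<close> is
  \<open>z\<^sub>1\<^sub>(\<^sub>0\<^sub>) \<otimes> \<cdots> \<otimes> z\<^sub>r\<^sub>(\<^sub>0\<^sub>) \<otimes> y\<^sub>1 \<otimes> \<cdots> \<otimes> y\<^sub>m \<otimes> z\<^sub>1\<^sub>(\<^sub>1\<^sub>) \<cdots> z\<^sub>r\<^sub>(\<^sub>1\<^sub>) x\<close>.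
\<close>

primrec prepend :: "'y list \<Rightarrow> nat \<Rightarrow> ('k, 'y, 'x) mtens \<Rightarrow> ('k, 'y, 'x) mtens" where
  "prepend [] m t = t"
| "prepend (z # zs) m t = bnd Y B (T (Suc (m + length zs))) (\<rho>Y z)
     (\<lambda>z0 z1. tcons Y X (m + length zs) z0 (actT (m + length zs) z1 (prepend zs m t)))"

lemma prepend_linear:
  "set zs \<subseteq> carrier Y \<Longrightarrow> linear_map K (T m) (T (m + length zs)) (\<lambda>t. prepend zs m t)"
proof (induction zs)
  case (Cons z zs)
  then have "linear_map K (T m) (T (m + length zs)) (prepend zs m)" by simp
  with Cons linear_closed[OF this] show ?case by (simp add: linear_simps)
qed (auto intro: linear_cong[OF linear_ident(1)])

lemma prepend_closed [simp]:
  "\<lbrakk>set zs \<subseteq> carrier Y; t \<in> carrier (T m)\<rbrakk> \<Longrightarrow> prepend zs m t \<in> carrier (T (m + length zs))"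
  using linear_closed[OF prepend_linear] by blast

text \<open>The last entry of the list is the innermost one, which is the factor that
  \<open>tau\<close> moves first.\<close>

lemma prepend_snoc:
  "\<lbrakk>set zs \<subseteq> carrier Y; z \<in> carrier Y; t \<in> carrier (T m)\<rbrakk> \<Longrightarrow>
    prepend (zs @ [z]) m t =
    prepend zs (Suc m) (bnd Y B (T (Suc m)) (\<rho>Y z) (\<lambda>z0 z1. tcons Y X m z0 (actT m z1 t)))"
  by (induction zs) auto

text \<open>Each application moves the last factor to the front, so after \<open>length zs\<close>
  applications the factors \<open>zs\<close> precede \<open>ys\<close>, and their coefficients have
  acted on x from the last to the first.\<close>

lemma tau_power_append:
  "\<lbrakk>set ys \<subseteq> carrier Y; set zs \<subseteq> carrier Y; x \<in> carrier X; length ys + length zs = Suc n\<rbrakk> \<Longrightarrow>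
    (tau n ^^ length zs) (mpure K Y X (Suc n) (ys @ zs) x) =
    prepend zs (length ys) (mpure K Y X (length ys) ys x)"
\<comment> \<open>The factor moved first joins the front of \<open>ys\<close> and its coefficient
  acts on x, hence both must vary.\<close>
proof (induction zs arbitrary: ys x rule: rev_induct)
  case (snoc z zs)
  then have n: "length ys + length zs = n" by simp
  let ?N = "T (Suc n)"
  have lin: "linear_map K (T (Suc (length ys))) ?N (prepend zs (Suc (length ys)))"
    using prepend_linear[of zs "Suc (length ys)"] snoc.prems n by simp
  have "(tau n ^^ length (zs @ [z])) (mpure K Y X (Suc n) (ys @ zs @ [z]) x) =
      (tau n ^^ length zs) (tau n (mpure K Y X (Suc n) ((ys @ zs) @ [z]) x))"
    by (simp add: funpow_swap1)
  also have "\<dots> = (tau n ^^ length zs) (bnd Y B ?N (\<rho>Y z) (\<lambda>z0 z1. mpure K Y X (Suc n) ((z0 # ys) @ zs) (act z1 x)))"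
    using snoc.prems n by (subst tau_mpure) (simp_all add: tcons_mpure)
  also have "\<dots> = bnd Y B ?N (\<rho>Y z) (\<lambda>z0 z1. (tau n ^^ length zs) (mpure K Y X (Suc n) ((z0 # ys) @ zs) (act z1 x)))"
  proof (rule linear_image_bnd)
    show "bilinear Y B ?N (\<lambda>z0 z1. mpure K Y X (Suc n) ((z0 # ys) @ zs) (act z1 x))"
      by (rule bilinear_cong[where \<phi> = "\<lambda>z0 z1. tcons Y X n z0 (mpure K Y X n (ys @ zs) (act z1 x))"])
        (use snoc.prems n in \<open>simp_all add: linear_simps tcons_mpure\<close>)
  qed (use snoc.prems in \<open>auto intro: linear_funpow tau_linear\<close>)
  also have "\<dots> = bnd Y B ?N (\<rho>Y z) (\<lambda>z0 z1. prepend zs (Suc (length ys)) (mpure K Y X (Suc (length ys)) (z0 # ys) (act z1 x)))"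
    using snoc.prems n snoc.IH by (intro bnd_cong refl) (simp del: append_Cons)
  also have "\<dots> = bnd Y B ?N (\<rho>Y z) (\<lambda>z0 z1. prepend zs (Suc (length ys)) (tcons Y X (length ys) z0 (actT (length ys) z1 (mpure K Y X (length ys) ys x))))"
    using snoc.prems by (simp add: actT_mpure tcons_mpure)
  also have "\<dots> = prepend zs (Suc (length ys)) (bnd Y B (T (Suc (length ys))) (\<rho>Y z) (\<lambda>z0 z1. tcons Y X (length ys) z0 (actT (length ys) z1 (mpure K Y X (length ys) ys x))))"
    by (rule linear_image_bnd[symmetric]) (use snoc.prems lin in \<open>simp_all add: linear_simps\<close>)
  also have "\<dots> = prepend (zs @ [z]) (length ys) (mpure K Y X (length ys) ys x)"
    using snoc.prems by (simp add: prepend_snoc)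
  finally show ?case .
qed simp

text \<open>In the product y^0_(1) ... y^n_(1) x_(1) the rightmost factor acts first, and x_(1)
  x_(0) = x by stability. What remains is the action of the coefficients of Y on x, which is what
  \<open>prepend\<close> describes.\<close>

lemma coact_pure_act:
  "\<lbrakk>set ys \<subseteq> carrier Y; x \<in> carrier X\<rbrakk> \<Longrightarrow>
    bnd (T (length ys)) B (T (length ys)) (coact_pure ys x) (\<lambda>t b. actT (length ys) b t) =
    prepend ys 0 (mpure K Y X 0 [] x)"
proof (induction ys)
  case Nil
  then have "bnd (T 0) B (T 0) (coact_pure [] x) (\<lambda>t b. actT 0 b t) =
      bnd X B (T 0) (\<rho>X x) (\<lambda>x0 x1. mpure K Y X 0 [] (act x1 x0))"
    by (simp add: linear_simps bnd_image_simps actT_mpure)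
  also have "\<dots> = mpure K Y X 0 [] (bnd X B X (\<rho>X x) (\<lambda>x0 x1. act x1 x0))"
    by (rule linear_image_bnd[symmetric]) (use Nil in \<open>simp_all add: linear_simps\<close>)
  finally show ?case
    using Nil by (simp add: stable_bnd)
next
  case (Cons y ys)
  let ?n = "length ys"
  have "bnd (T (Suc ?n)) B (T (Suc ?n)) (coact_pure (y # ys) x) (\<lambda>t b. actT (Suc ?n) b t) =
      bnd Y B (T (Suc ?n)) (\<rho>Y y) (\<lambda>y0 y1. bnd (T ?n) B (T (Suc ?n)) (coact_pure ys x)
        (\<lambda>t b. tcons Y X ?n y0 (actT ?n y1 (actT ?n b t))))"
    using Cons.prems by (simp add: linear_simps bnd_image_simps actT_tcons actT_mult)
  also have "\<dots> = bnd Y B (T (Suc ?n)) (\<rho>Y y) (\<lambda>y0 y1. tcons Y X ?n y0 (actT ?n y1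
      (bnd (T ?n) B (T ?n) (coact_pure ys x) (\<lambda>t b. actT ?n b t))))"
    using Cons.prems by (simp add: linear_simps bnd_image_simps actT_bnd)
  finally show ?case
    using Cons by simp
qed

text \<open>With \<open>ys\<close> empty in \<open>tau_power_append\<close> every factor is moved
  once, so the original order returns.\<close>

lemma tau_power:
  assumes "t \<in> carrier (T (Suc n))"
  shows "(tau n ^^ Suc n) t = bnd (T (Suc n)) B (T (Suc n)) (coT (Suc n) t) (\<lambda>t0 b. actT (Suc n) b t0)"
proof (rule mtens_ext[OF _ _ assms, where M = "T (Suc n)"])
  show "linear_map K (T (Suc n)) (T (Suc n)) (tau n ^^ Suc n)"
    by (rule linear_funpow[OF tau_linear])
  fix ys :: "'y list" and x assume *: "set ys \<subseteq> carrier Y" "length ys = Suc n" "x \<in> carrier X"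
  then show "(tau n ^^ Suc n) (mpure K Y X (Suc n) ys x) =
      bnd (T (Suc n)) B (T (Suc n)) (coT (Suc n) (mpure K Y X (Suc n) ys x)) (\<lambda>t0 b. actT (Suc n) b t0)"
    using tau_power_append[of "[]" ys x n] coact_pure_act[of ys x] by (simp add: coT_mpure del: funpow.simps)
qed (simp_all add: linear_simps)

end

section \<open>Subspaces and restriction of coactions\<close>

context linear_algebra
begin

lemma submoduleI_smult:
  assumes "module K V" "H \<subseteq> carrier V" "\<zero>\<^bsub>V\<^esub> \<in> H"
    and "\<And>a b. \<lbrakk>a \<in> H; b \<in> H\<rbrakk> \<Longrightarrow> a \<oplus>\<^bsub>V\<^esub> b \<in> H"
    and "\<And>c a. \<lbrakk>c \<in> carrier K; a \<in> H\<rbrakk> \<Longrightarrow> c \<odot>\<^bsub>V\<^esub> a \<in> H"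
  shows "submodule H K V"
proof -
  interpret V: module K V by fact
  have "\<ominus>\<^bsub>V\<^esub> a \<in> H" if "a \<in> H" for a
    using assms(5)[of "\<ominus> \<one>" a] that assms(2) V.smult_l_minus[of \<one> a] by auto
  then show ?thesis
    using assms by (intro V.submoduleI) auto
qed

lemma submoduleD:
  assumes "submodule W K V" "module K V"
  shows "W \<subseteq> carrier V" "w \<in> W \<Longrightarrow> w \<in> carrier V" "\<zero>\<^bsub>V\<^esub> \<in> W"
    and "\<lbrakk>a \<in> W; b \<in> W\<rbrakk> \<Longrightarrow> a \<oplus>\<^bsub>V\<^esub> b \<in> W" "\<lbrakk>c \<in> carrier K; a \<in> W\<rbrakk> \<Longrightarrow> c \<odot>\<^bsub>V\<^esub> a \<in> W"
    and "a \<in> W \<Longrightarrow> \<ominus>\<^bsub>V\<^esub> a \<in> W" "\<lbrakk>a \<in> W; b \<in> W\<rbrakk> \<Longrightarrow> a \<ominus>\<^bsub>V\<^esub> b \<in> W"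
proof -
  interpret V: module K V by fact
  note E = V.submoduleE[OF assms(1)]
  show "W \<subseteq> carrier V" "w \<in> W \<Longrightarrow> w \<in> carrier V" "\<lbrakk>a \<in> W; b \<in> W\<rbrakk> \<Longrightarrow> a \<oplus>\<^bsub>V\<^esub> b \<in> W"
    "\<lbrakk>c \<in> carrier K; a \<in> W\<rbrakk> \<Longrightarrow> c \<odot>\<^bsub>V\<^esub> a \<in> W" "a \<in> W \<Longrightarrow> \<ominus>\<^bsub>V\<^esub> a \<in> W"
    "\<lbrakk>a \<in> W; b \<in> W\<rbrakk> \<Longrightarrow> a \<ominus>\<^bsub>V\<^esub> b \<in> W"
    using E by (auto simp: a_minus_def)
  show "\<zero>\<^bsub>V\<^esub> \<in> W"
    using subgroup.one_closed[OF submodule.axioms(1)[OF assms(1)]] by simp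
qed

text \<open>The upper bound for the use of Zorn's lemma below.\<close>

lemma submodule_union_chain:
  assumes "module K V" "C \<noteq> {}" "subset.chain {N. submodule N K V} C"
  shows "submodule (\<Union>C) K V"
proof (rule submoduleI_smult[OF assms(1)])
  have C: "submodule N K V" if "N \<in> C" for N
    using assms(3) that unfolding subset.chain_def by auto
  note D = submoduleD[OF C assms(1)]
  show "\<Union>C \<subseteq> carrier V"
    using D(1) by auto
  show "\<zero>\<^bsub>V\<^esub> \<in> \<Union>C"
    using D(3) assms(2) by auto
  show "a \<oplus>\<^bsub>V\<^esub> b \<in> \<Union>C" if ab: "a \<in> \<Union>C" "b \<in> \<Union>C" for a b
  proof -
    obtain N N' where N: "N \<in> C" "a \<in> N" "N' \<in> C" "b \<in> N'"
      using ab by auto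
    then have "N \<subseteq> N' \<or> N' \<subseteq> N"
      using assms(3) unfolding subset.chain_def by auto
    with N D(4) show ?thesis by (metis UnionI subsetD)
  qed
  show "c \<odot>\<^bsub>V\<^esub> a \<in> \<Union>C" if "c \<in> carrier K" "a \<in> \<Union>C" for c a
    using D(5) that by auto
qed

text \<open>The field is a plain ring record and not a \<open>module\<close> record, so
  \<open>linear_map\<close> cannot express linearity into it; the counit axioms are spelled out in
  the same way.\<close>

definition functional :: "('k, 'v) module \<Rightarrow> ('v \<Rightarrow> 'k) \<Rightarrow> bool" where
  "functional V \<xi> \<longleftrightarrow> \<xi> \<in> carrier V \<rightarrow> carrier K \<and>
     (\<forall>x\<in>carrier V. \<forall>y\<in>carrier V. \<xi> (x \<oplus>\<^bsub>V\<^esub> y) = \<xi> x \<oplus> \<xi> y) \<and>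
     (\<forall>c\<in>carrier K. \<forall>x\<in>carrier V. \<xi> (c \<odot>\<^bsub>V\<^esub> x) = c \<otimes> \<xi> x)"

lemma functional_closed [simp]: "\<lbrakk>functional V \<xi>; v \<in> carrier V\<rbrakk> \<Longrightarrow> \<xi> v \<in> carrier K"
  unfolding functional_def by auto

lemma linear_functional:
  assumes "functional V \<xi>" "linear_map K U V f" "module K M" "m \<in> carrier M"
  shows "linear_map K U M (\<lambda>u. \<xi> (f u) \<odot>\<^bsub>M\<^esub> m)"
proof -
  interpret M: module K M by fact
  show ?thesis
    by (rule linearI) (use assms in \<open>auto simp: functional_def Pi_iff linear_closed linear_add
      linear_smult M.smult_l_distr M.smult_assoc1\<close>)
qed

text \<open>A subspace that is maximal among those containing \<open>U\<close> but not \<open>b\<close> is a complement of the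
  line through \<open>b\<close>, hence the kernel of the functional sought.\<close>

lemma exists_functional:
  assumes V: "module K V" and U: "submodule U K V" and b: "b \<in> carrier V" "b \<notin> U"
  obtains \<xi> where "functional V \<xi>" "\<And>u. u \<in> U \<Longrightarrow> \<xi> u = \<zero>" "\<xi> b = \<one>"
proof -
  interpret V: module K V by fact
  define F where "F = {N. submodule N K V \<and> U \<subseteq> N \<and> b \<notin> N}"
  have "\<exists>C\<in>F. \<forall>N\<in>F. C \<subseteq> N \<longrightarrow> N = C"
  proof (rule subset_Zorn_nonempty)
    show "F \<noteq> {}"
      using U b unfolding F_def by auto
    fix \<C> assume "\<C> \<noteq> {}" "subset.chain F \<C>"
    then have "subset.chain {N. submodule N K V} \<C>" "\<And>N. N \<in> \<C> \<Longrightarrow> U \<subseteq> N \<and> b \<notin> N"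
      unfolding subset.chain_def F_def by auto
    with submodule_union_chain[OF V \<open>\<C> \<noteq> {}\<close>] \<open>\<C> \<noteq> {}\<close> show "\<Union>\<C> \<in> F"
      unfolding F_def by fast
  qed
  then obtain C where CF: "C \<in> F" and maxF: "\<forall>N\<in>F. C \<subseteq> N \<longrightarrow> N = C" ..
  then have C: "submodule C K V" "U \<subseteq> C" "b \<notin> C"
    unfolding F_def by auto
  have max: "N = C" if "submodule N K V" "C \<subseteq> N" "b \<notin> N" for N
    using maxF that C(2) unfolding F_def by auto
  note D = submoduleD[OF C(1) V]
  have minus_zero: "v \<ominus>\<^bsub>V\<^esub> \<zero> \<odot>\<^bsub>V\<^esub> b = v" if "v \<in> carrier V" for v
  proof -
    have "\<ominus>\<^bsub>V\<^esub> \<zero>\<^bsub>V\<^esub> = \<zero>\<^bsub>V\<^esub>"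
      by (rule V.minus_equality) auto
    then show ?thesis
      using that b by (simp only: a_minus_def V.smult_l_null V.r_zero)
  qed
  have ex: "\<exists>k\<in>carrier K. v \<ominus>\<^bsub>V\<^esub> k \<odot>\<^bsub>V\<^esub> b \<in> C" if v: "v \<in> carrier V" for v
  proof (cases "v \<in> C")
    case True
    then show ?thesis
      using v by (intro bexI[of _ \<zero>]) (simp_all only: minus_zero zero_closed True)
  next
    case False
    \<comment> \<open>The span of \<open>C\<close> and \<open>v\<close> is strictly larger than
      \<open>C\<close>, so maximality forces it to contain \<open>b\<close>; that relation is then
      solved for \<open>v\<close>.\<close>
    define N where "N = {c \<oplus>\<^bsub>V\<^esub> k \<odot>\<^bsub>V\<^esub> v | c k. c \<in> C \<and> k \<in> carrier K}"
    have NI: "c \<oplus>\<^bsub>V\<^esub> k \<odot>\<^bsub>V\<^esub> v \<in> N" if "c \<in> C" "k \<in> carrier K" for c k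
      using that unfolding N_def by blast
    have "submodule N K V"
    proof (rule submoduleI_smult[OF V])
      show "N \<subseteq> carrier V"
        using D(2) v unfolding N_def by auto
      show "\<zero>\<^bsub>V\<^esub> \<in> N"
        using NI[OF D(3) zero_closed] v by simp
    next
      fix x y assume "x \<in> N" "y \<in> N"
      then obtain c k c' k' where *: "x = c \<oplus>\<^bsub>V\<^esub> k \<odot>\<^bsub>V\<^esub> v" "y = c' \<oplus>\<^bsub>V\<^esub> k' \<odot>\<^bsub>V\<^esub> v"
        "c \<in> C" "c' \<in> C" "k \<in> carrier K" "k' \<in> carrier K"
        unfolding N_def by auto
      then have "x \<oplus>\<^bsub>V\<^esub> y = (c \<oplus>\<^bsub>V\<^esub> c') \<oplus>\<^bsub>V\<^esub> (k \<oplus> k') \<odot>\<^bsub>V\<^esub> v"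
        using D(2) v by (simp add: V.smult_l_distr V.a_ac)
      with * show "x \<oplus>\<^bsub>V\<^esub> y \<in> N"
        using NI D(4) by auto
    next
      fix l x assume "l \<in> carrier K" "x \<in> N"
      then obtain c k where *: "x = c \<oplus>\<^bsub>V\<^esub> k \<odot>\<^bsub>V\<^esub> v" "c \<in> C" "k \<in> carrier K" "l \<in> carrier K"
        unfolding N_def by auto
      then have "l \<odot>\<^bsub>V\<^esub> x = l \<odot>\<^bsub>V\<^esub> c \<oplus>\<^bsub>V\<^esub> (l \<otimes> k) \<odot>\<^bsub>V\<^esub> v"
        using D(2) v by (simp add: V.smult_r_distr V.smult_assoc1)
      with * show "l \<odot>\<^bsub>V\<^esub> x \<in> N"
        using NI D(5) by auto
    qed
    moreover have "C \<subseteq> N"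
      using NI[OF _ zero_closed] v D(2) by fastforce
    moreover have "v \<in> N"
      using NI[OF D(3) one_closed] v by simp
    ultimately have "b \<in> N"
      using max False by blast
    then obtain c k where ck: "b = c \<oplus>\<^bsub>V\<^esub> k \<odot>\<^bsub>V\<^esub> v" "c \<in> C" "k \<in> carrier K"
      unfolding N_def by auto
    have "k \<noteq> \<zero>"
      using ck C(3) D(2) v by auto
    then have k: "inv k \<in> carrier K" "inv k \<otimes> k = \<one>"
      using ck(3) field_Units by auto
    have "inv k \<odot>\<^bsub>V\<^esub> b = inv k \<odot>\<^bsub>V\<^esub> c \<oplus>\<^bsub>V\<^esub> (inv k \<otimes> k) \<odot>\<^bsub>V\<^esub> v"
      using ck k(1) D(2) v by (simp add: V.smult_r_distr V.smult_assoc1)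
    then have "v \<ominus>\<^bsub>V\<^esub> inv k \<odot>\<^bsub>V\<^esub> b = \<ominus>\<^bsub>V\<^esub> (inv k \<odot>\<^bsub>V\<^esub> c)"
      using ck k D(2) v V.a_comm[of "\<ominus>\<^bsub>V\<^esub> (inv k \<odot>\<^bsub>V\<^esub> c)" "\<ominus>\<^bsub>V\<^esub> v"]
      by (simp add: a_minus_def V.minus_add V.r_neg2)
    with k(1) ck(2) D(5,6) show ?thesis
      by (intro bexI[of _ "inv k"]) simp_all
  qed
  \<comment> \<open>Two different coefficients would leave a nonzero multiple of \<open>b\<close> in
    \<open>C\<close>, and dividing by it would put \<open>b\<close> itself there.\<close>
  have uniq: "k = k'" if "k \<in> carrier K" "k' \<in> carrier K" "v \<in> carrier V"
    "v \<ominus>\<^bsub>V\<^esub> k \<odot>\<^bsub>V\<^esub> b \<in> C" "v \<ominus>\<^bsub>V\<^esub> k' \<odot>\<^bsub>V\<^esub> b \<in> C" for k k' v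
  proof (rule ccontr)
    assume "k \<noteq> k'"
    have "k \<ominus> k' \<noteq> \<zero>"
    proof
      assume "k \<ominus> k' = \<zero>"
      then have "\<ominus> (\<ominus> k') = k"
        using that(1,2) by (intro minus_equality) (simp_all add: a_minus_def)
      with that(2) \<open>k \<noteq> k'\<close> show False by simp
    qed
    then have i: "inv (k \<ominus> k') \<in> carrier K" "inv (k \<ominus> k') \<otimes> (k \<ominus> k') = \<one>"
      using that(1,2) field_Units by auto
    have "(v \<ominus>\<^bsub>V\<^esub> p) \<ominus>\<^bsub>V\<^esub> (v \<ominus>\<^bsub>V\<^esub> q) = q \<ominus>\<^bsub>V\<^esub> p" if "p \<in> carrier V" "q \<in> carrier V" for p q
      using that \<open>v \<in> carrier V\<close> V.a_comm[of v "\<ominus>\<^bsub>V\<^esub> p"] V.a_comm[of q "\<ominus>\<^bsub>V\<^esub> p"]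
      by (simp add: a_minus_def V.minus_add V.a_assoc V.r_neg2)
    then have "(v \<ominus>\<^bsub>V\<^esub> k' \<odot>\<^bsub>V\<^esub> b) \<ominus>\<^bsub>V\<^esub> (v \<ominus>\<^bsub>V\<^esub> k \<odot>\<^bsub>V\<^esub> b) = (k \<ominus> k') \<odot>\<^bsub>V\<^esub> b"
      using that b(1) by (simp add: a_minus_def V.smult_l_distr V.smult_l_minus)
    then have "(k \<ominus> k') \<odot>\<^bsub>V\<^esub> b \<in> C"
      using D(7)[OF that(5,4)] by simp
    from D(5)[OF i(1) this] have "b \<in> C"
      using that(1,2) b(1) i V.smult_assoc1[OF i(1), of "k \<ominus> k'" b] by simp
    with C(3) show False ..
  qed
  \<comment> \<open>The coordinate along \<open>b\<close> in the decomposition of V into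
    \<open>C\<close> and the line through \<open>b\<close>.\<close>
  define \<xi> where "\<xi> = (\<lambda>v. THE k. k \<in> carrier K \<and> v \<ominus>\<^bsub>V\<^esub> k \<odot>\<^bsub>V\<^esub> b \<in> C)"
  have \<xi>: "\<xi> v = k" if "v \<in> carrier V" "k \<in> carrier K" "v \<ominus>\<^bsub>V\<^esub> k \<odot>\<^bsub>V\<^esub> b \<in> C" for v k
    unfolding \<xi>_def using that uniq by (intro the_equality) auto
  have \<xi>': "\<xi> v \<in> carrier K" "v \<ominus>\<^bsub>V\<^esub> \<xi> v \<odot>\<^bsub>V\<^esub> b \<in> C" if "v \<in> carrier V" for v
    using ex[OF that] \<xi>[OF that] by auto
  show ?thesis
  proof
    show "functional V \<xi>"
      unfolding functional_def
    proof (intro conjI ballI)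
      fix x y assume xy: "x \<in> carrier V" "y \<in> carrier V"
      show "\<xi> (x \<oplus>\<^bsub>V\<^esub> y) = \<xi> x \<oplus> \<xi> y"
      proof (rule \<xi>)
        have "(x \<oplus>\<^bsub>V\<^esub> y) \<ominus>\<^bsub>V\<^esub> (\<xi> x \<oplus> \<xi> y) \<odot>\<^bsub>V\<^esub> b =
            (x \<ominus>\<^bsub>V\<^esub> \<xi> x \<odot>\<^bsub>V\<^esub> b) \<oplus>\<^bsub>V\<^esub> (y \<ominus>\<^bsub>V\<^esub> \<xi> y \<odot>\<^bsub>V\<^esub> b)"
          using xy b \<xi>' by (simp add: a_minus_def V.smult_l_distr V.minus_add V.a_ac)
        then show "(x \<oplus>\<^bsub>V\<^esub> y) \<ominus>\<^bsub>V\<^esub> (\<xi> x \<oplus> \<xi> y) \<odot>\<^bsub>V\<^esub> b \<in> C"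
          using D(4) \<xi>' xy by simp
      qed (use xy \<xi>' in auto)
    next
      fix c x assume cx: "c \<in> carrier K" "x \<in> carrier V"
      show "\<xi> (c \<odot>\<^bsub>V\<^esub> x) = c \<otimes> \<xi> x"
      proof (rule \<xi>)
        have "c \<odot>\<^bsub>V\<^esub> x \<ominus>\<^bsub>V\<^esub> (c \<otimes> \<xi> x) \<odot>\<^bsub>V\<^esub> b = c \<odot>\<^bsub>V\<^esub> (x \<ominus>\<^bsub>V\<^esub> \<xi> x \<odot>\<^bsub>V\<^esub> b)"
          using cx b \<xi>' by (simp add: a_minus_def V.smult_r_distr V.smult_assoc1 V.smult_r_minus)
        then show "c \<odot>\<^bsub>V\<^esub> x \<ominus>\<^bsub>V\<^esub> (c \<otimes> \<xi> x) \<odot>\<^bsub>V\<^esub> b \<in> C"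
          using D(5) \<xi>' cx by simp
      qed (use cx \<xi>' in auto)
    qed (use \<xi>' in auto)
    show "\<xi> u = \<zero>" if "u \<in> U" for u
      using that C(2) D(2) by (intro \<xi>) (auto simp only: minus_zero zero_closed)
    show "\<xi> b = \<one>"
      using b D(3) by (intro \<xi>) (auto simp: a_minus_def V.r_neg)
  qed
qed

lemma submodule_module: "module K M \<Longrightarrow> submodule W K M \<Longrightarrow> module K (M\<lparr>carrier := W\<rparr>)"
  by (rule submodule.submodule_is_module)

section \<open>Slices, and tensors with values in a subspace\<close>

context
  fixes M :: "('k, 'm) module" and V :: "('k, 'v) module"
  assumes MV [simp]: "module K M" "module K V"
begin

abbreviation slice :: "('v \<Rightarrow> 'k) \<Rightarrow> ('k, 'm, 'v) tens \<Rightarrow> 'm" where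
  "slice \<xi> t \<equiv> bnd M V M t (\<lambda>m b. \<xi> b \<odot>\<^bsub>M\<^esub> m)"

lemma slice_bilinear: "functional V \<xi> \<Longrightarrow> bilinear M V M (\<lambda>m b. \<xi> b \<odot>\<^bsub>M\<^esub> m)"
  by (simp add: linear_simps linear_functional[of V \<xi>])

context
  fixes W assumes W: "submodule W K M"
begin

lemma linear_inclusion: "linear_map K U (M\<lparr>carrier := W\<rparr>) f \<Longrightarrow> linear_map K U M f"
  using submoduleD(1)[OF W] unfolding linear_map_def by auto

lemma tensor_incl_eq_bnd:
  "s \<in> carrier (tensor K (M\<lparr>carrier := W\<rparr>) V) \<Longrightarrow>
    tensor_incl K M V s = bnd (M\<lparr>carrier := W\<rparr>) V (tensor K M V) s (pure K M V)"
  unfolding tensor_incl_def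
  by (subst tensor_map_eq_bnd[where V = "M\<lparr>carrier := W\<rparr>" and W = V])
    (auto simp: submodule_module[OF MV(1) W] linear_ident intro: linear_inclusion)

lemma inclusion_pure_bilinear: "bilinear (M\<lparr>carrier := W\<rparr>) V (tensor K M V) (pure K M V)"
  using submoduleD(1)[OF W]
  by (intro bilinearI linear_pure) (auto intro: linear_inclusion linear_ident)

lemma tensor_incl_linear:
  "linear_map K (tensor K (M\<lparr>carrier := W\<rparr>) V) (tensor K M V) (tensor_incl K M V)"
  by (rule linear_cong[OF bnd_linear[OF _ _ _ inclusion_pure_bilinear]])
    (auto simp: submodule_module[OF MV(1) W] tensor_incl_eq_bnd)

lemma tensor_incl_pure:
  "\<lbrakk>w \<in> W; b \<in> carrier V\<rbrakk> \<Longrightarrow> tensor_incl K M V (pure K (M\<lparr>carrier := W\<rparr>) V w b) = pure K M V w b"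
  by (simp add: tensor_incl_eq_bnd submodule_module[OF MV(1) W] bnd_pure inclusion_pure_bilinear)

text \<open>A Sweedler sum may be evaluated in the tensor product of the subspace or in that of the
  whole space.\<close>

lemma bnd_tensor_incl:
  assumes "module K N" "bilinear M V N \<phi>" "s \<in> carrier (tensor K (M\<lparr>carrier := W\<rparr>) V)"
  shows "bnd M V N (tensor_incl K M V s) \<phi> = bnd (M\<lparr>carrier := W\<rparr>) V N s \<phi>"
proof -
  have bil: "bilinear (M\<lparr>carrier := W\<rparr>) V N \<phi>"
    using bilinearD[OF assms(2)] submoduleD(2)[OF W]
    by (intro bilinearI) (auto intro: linear_compose[OF linear_inclusion[OF linear_ident(1)]])
  show ?thesis
    by (rule tensor_ext[OF _ _ assms(3) linear_compose[OF tensor_incl_linear bnd_linear] bnd_linear])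
      (use assms bil submoduleD(2)[OF W] in \<open>auto simp: submodule_module[OF MV(1) W] bnd_pure tensor_incl_pure\<close>)
qed

end

text \<open>The right factors come from a prescribed finite list, with arbitrary coefficients in M.
  The list need not be independent; it takes the place of a basis and gives something to do
  induction on.\<close>

primrec tensor_span :: "'v list \<Rightarrow> ('k, 'm, 'v) tens set" where
  "tensor_span [] = {\<zero>\<^bsub>tensor K M V\<^esub>}"
| "tensor_span (b # bs) = {pure K M V m b \<oplus>\<^bsub>tensor K M V\<^esub> u | m u. m \<in> carrier M \<and> u \<in> tensor_span bs}"

lemma tensor_span_submodule:
  "set bs \<subseteq> carrier V \<Longrightarrow> submodule (tensor_span bs) K (tensor K M V)"
proof (induction bs)
  case Nil
  show ?case by (simp add: submodule_zero)
next
  case (Cons b bs)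
  interpret TT: module K "tensor K M V" by simp
  have b: "b \<in> carrier V" and sub: "submodule (tensor_span bs) K (tensor K M V)"
    using Cons by auto
  note D = submoduleD[OF sub]
  note lin = linear_pure_left[OF MV linear_ident(1) b]
  have I: "pure K M V m b \<oplus>\<^bsub>tensor K M V\<^esub> u \<in> tensor_span (b # bs)" if "m \<in> carrier M" "u \<in> tensor_span bs" for m u
    using that by auto
  show ?case
  proof (rule submoduleI_smult)
    show "tensor_span (b # bs) \<subseteq> carrier (tensor K M V)"
      using b D(2) by auto
    show "\<zero>\<^bsub>tensor K M V\<^esub> \<in> tensor_span (b # bs)"
      using I[OF module_zero_closed D(3)] linear_zero[OF lin] by simp
  next
    fix s t assume "s \<in> tensor_span (b # bs)" "t \<in> tensor_span (b # bs)"
    then obtain m u n v where *: "s = pure K M V m b \<oplus>\<^bsub>tensor K M V\<^esub> u" "t = pure K M V n b \<oplus>\<^bsub>tensor K M V\<^esub> v"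
      "m \<in> carrier M" "n \<in> carrier M" "u \<in> tensor_span bs" "v \<in> tensor_span bs"
      by auto
    then have "s \<oplus>\<^bsub>tensor K M V\<^esub> t = pure K M V (m \<oplus>\<^bsub>M\<^esub> n) b \<oplus>\<^bsub>tensor K M V\<^esub> (u \<oplus>\<^bsub>tensor K M V\<^esub> v)"
      using b D(2) by (simp add: linear_add[OF lin] TT.a_ac)
    with * D(4) I show "s \<oplus>\<^bsub>tensor K M V\<^esub> t \<in> tensor_span (b # bs)"
      by (simp del: tensor_span.simps)
  next
    fix c s assume c: "c \<in> carrier K" and "s \<in> tensor_span (b # bs)"
    then obtain m u where *: "s = pure K M V m b \<oplus>\<^bsub>tensor K M V\<^esub> u" "m \<in> carrier M" "u \<in> tensor_span bs"
      by auto
    then have "c \<odot>\<^bsub>tensor K M V\<^esub> s = pure K M V (c \<odot>\<^bsub>M\<^esub> m) b \<oplus>\<^bsub>tensor K M V\<^esub> c \<odot>\<^bsub>tensor K M V\<^esub> u"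
      using b c D(2) by (simp add: linear_smult[OF lin] TT.smult_r_distr)
    with * c D(5) I show "c \<odot>\<^bsub>tensor K M V\<^esub> s \<in> tensor_span (b # bs)"
      by (simp del: tensor_span.simps)
  qed simp
qed

lemma pure_in_tensor_span:
  "\<lbrakk>set bs \<subseteq> carrier V; m \<in> carrier M; b \<in> set bs\<rbrakk> \<Longrightarrow> pure K M V m b \<in> tensor_span bs"
proof (induction bs)
  case (Cons a bs)
  interpret TT: module K "tensor K M V" by simp
  note D = submoduleD[OF tensor_span_submodule]
  show ?case
  proof (cases "b = a")
    case True
    with Cons.prems D(3)[of bs] show ?thesis
      by (auto intro!: exI[of _ m] exI[of _ "\<zero>\<^bsub>tensor K M V\<^esub>"])
  next
    case False
    with Cons have p: "pure K M V m b \<in> tensor_span bs" "b \<in> carrier V" by auto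
    have "pure K M V \<zero>\<^bsub>M\<^esub> a = \<zero>\<^bsub>tensor K M V\<^esub>"
      using linear_zero[OF linear_pure_left[OF MV linear_ident(1)]] Cons.prems by auto
    with Cons.prems p show ?thesis
      by (auto intro!: exI[of _ "\<zero>\<^bsub>M\<^esub>"] exI[of _ "pure K M V m b"])
  qed
qed simp

text \<open>A right factor that depends linearly on the list can be distributed over it. This is
  what allows a redundant entry to be dropped.\<close>

lemma pure_gen_in_tensor_span:
  assumes "set bs \<subseteq> carrier V" "m \<in> carrier M" "b \<in> gen_submodule K V (set bs)"
  shows "pure K M V m b \<in> tensor_span bs"
proof -
  have "submodule {v \<in> carrier V. pure K M V m v \<in> tensor_span bs} K V"
    using assms by (intro submodule_linear_vimage[where W = "tensor K M V"] tensor_span_submodule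
        linear_pure_right linear_ident) auto
  from gen_submodule_least[OF this, of "set bs"] assms show ?thesis
    using pure_in_tensor_span by blast
qed

lemma tensor_in_tensor_span:
  assumes "t \<in> carrier (tensor K M V)"
  obtains bs where "set bs \<subseteq> carrier V" "t \<in> tensor_span bs"
proof -
  interpret TT: module K "tensor K M V" by simp
  note D = submoduleD[OF tensor_span_submodule]
  have app: "u \<oplus>\<^bsub>tensor K M V\<^esub> v \<in> tensor_span (bs @ cs)"
    if "u \<in> tensor_span bs" "v \<in> tensor_span cs" "set bs \<subseteq> carrier V" "set cs \<subseteq> carrier V" for u v bs cs
    using that
  proof (induction bs arbitrary: u)
    case Nil
    then show ?case using D(2)[of cs v] by simp
  next
    case (Cons b bs)
    then obtain m w where *: "u = pure K M V m b \<oplus>\<^bsub>tensor K M V\<^esub> w" "m \<in> carrier M" "w \<in> tensor_span bs"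
      by auto
    then have "u \<oplus>\<^bsub>tensor K M V\<^esub> v = pure K M V m b \<oplus>\<^bsub>tensor K M V\<^esub> (w \<oplus>\<^bsub>tensor K M V\<^esub> v)"
      using Cons.prems D(2)[of bs w] D(2)[of cs v] by (simp add: TT.a_assoc)
    with * Cons.IH[of w] Cons.prems show ?case by auto
  qed
  have "\<exists>bs. set bs \<subseteq> carrier V \<and> t \<in> tensor_span bs"
    using MV assms
  proof (induction rule: tensor_induct)
    case (pure a b)
    then show ?case
      using pure_in_tensor_span[of "[b]" a b] by (intro exI[of _ "[b]"]) simp
  next
    case (add u v)
    then obtain bs cs where "set bs \<subseteq> carrier V" "u \<in> tensor_span bs" "set cs \<subseteq> carrier V" "v \<in> tensor_span cs"
      by auto
    then show ?case
      using app[of u bs v cs] by (intro exI[of _ "bs @ cs"]) simp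
  qed
  with that show ?thesis by blast
qed

lemma slice_kills_tensor_span:
  assumes \<xi>: "functional V \<xi>"
  shows "\<lbrakk>set bs \<subseteq> carrier V; \<And>b. b \<in> set bs \<Longrightarrow> \<xi> b = \<zero>; t \<in> tensor_span bs\<rbrakk> \<Longrightarrow> slice \<xi> t = \<zero>\<^bsub>M\<^esub>"
proof (induction bs arbitrary: t)
  case Nil
  then show ?case
    using linear_zero[OF bnd_linear[OF MV(1,2,1) slice_bilinear[OF \<xi>]]] by simp
next
  case (Cons b bs)
  interpret M: module K M by simp
  obtain m u where *: "t = pure K M V m b \<oplus>\<^bsub>tensor K M V\<^esub> u" "m \<in> carrier M" "u \<in> tensor_span bs"
    using Cons.prems by auto
  moreover have "u \<in> carrier (tensor K M V)"
    using submoduleD(2)[OF tensor_span_submodule] * Cons.prems by auto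
  ultimately show ?case
    using Cons by (simp add: linear_add[OF bnd_linear[OF MV(1,2,1) slice_bilinear[OF \<xi>]]]
        bnd_pure[OF _ _ _ slice_bilinear[OF \<xi>]])
qed

lemma tensor_incl_image_submodule:
  assumes "submodule W K M"
  shows "submodule (tensor_incl K M V ` carrier (tensor K (M\<lparr>carrier := W\<rparr>) V)) K (tensor K M V)"
proof (rule submoduleI_smult)
  note L = tensor_incl_linear[OF assms]
  have m: "module K (tensor K (M\<lparr>carrier := W\<rparr>) V)"
    using submodule_module[OF MV(1) assms] by simp
  show "tensor_incl K M V ` carrier (tensor K (M\<lparr>carrier := W\<rparr>) V) \<subseteq> carrier (tensor K M V)"
    using linear_closed[OF L] by auto
  show "\<zero>\<^bsub>tensor K M V\<^esub> \<in> tensor_incl K M V ` carrier (tensor K (M\<lparr>carrier := W\<rparr>) V)"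
    using linear_zero[OF L m] m by (metis image_eqI module_tensor module_zero_closed MV)
  show "a \<oplus>\<^bsub>tensor K M V\<^esub> b \<in> tensor_incl K M V ` carrier (tensor K (M\<lparr>carrier := W\<rparr>) V)"
    if "a \<in> tensor_incl K M V ` carrier (tensor K (M\<lparr>carrier := W\<rparr>) V)"
      "b \<in> tensor_incl K M V ` carrier (tensor K (M\<lparr>carrier := W\<rparr>) V)" for a b
    using that m by (auto simp: linear_add[OF L, symmetric])
  show "c \<odot>\<^bsub>tensor K M V\<^esub> a \<in> tensor_incl K M V ` carrier (tensor K (M\<lparr>carrier := W\<rparr>) V)"
    if "c \<in> carrier K" "a \<in> tensor_incl K M V ` carrier (tensor K (M\<lparr>carrier := W\<rparr>) V)" for a c
    using that m by (auto simp: linear_smult[OF L, symmetric])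
qed simp

text \<open>Induction on a list of right factors. If the first entry b is redundant, it is dropped.
  Otherwise a functional that is 1 at b and vanishes on the other entries exhibits the coefficient m
  of b as a slice, hence m lies in \<open>W\<close>, and m \<otimes> b can be subtracted without
  losing the hypothesis on slices.\<close>

lemma slices_imp_tensor_incl:
  assumes W: "submodule W K M" and t: "t \<in> carrier (tensor K M V)"
    and slices: "\<And>\<xi>. functional V \<xi> \<Longrightarrow> slice \<xi> t \<in> W"
  shows "t \<in> tensor_incl K M V ` carrier (tensor K (M\<lparr>carrier := W\<rparr>) V)"
proof -
  let ?I = "tensor_incl K M V ` carrier (tensor K (M\<lparr>carrier := W\<rparr>) V)"
  interpret TT: module K "tensor K M V" by simp
  interpret M: module K M by simp
  note I = submoduleD[OF tensor_incl_image_submodule[OF W]]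
  note DW = submoduleD[OF W MV(1)]
  have pI: "pure K M V w b \<in> ?I" if "w \<in> W" "b \<in> carrier V" for w b
    using tensor_incl_pure[OF W that] that submodule_module[OF MV(1) W]
    by (intro image_eqI[of _ _ "pure K (M\<lparr>carrier := W\<rparr>) V w b"]) auto
  have "t \<in> ?I" if "set bs \<subseteq> carrier V" "t \<in> tensor_span bs"
    "\<And>\<xi>. functional V \<xi> \<Longrightarrow> slice \<xi> t \<in> W" for bs t
    using that
  proof (induction bs arbitrary: t)
    case Nil
    then show ?case using I(3) by simp
  next
    case (Cons b bs)
    then have b: "b \<in> carrier V" "set bs \<subseteq> carrier V" by auto
    note S = submoduleD[OF tensor_span_submodule[OF b(2)]]
    have gen: "submodule (gen_submodule K V (set bs)) K V"
      using b by (intro submodule_gen_submodule) auto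
    obtain m u where *: "t = pure K M V m b \<oplus>\<^bsub>tensor K M V\<^esub> u" "m \<in> carrier M" "u \<in> tensor_span bs"
      using Cons.prems by auto
    have u: "u \<in> carrier (tensor K M V)"
      using S(2) * by auto
    have sl: "slice \<xi> t = \<xi> b \<odot>\<^bsub>M\<^esub> m \<oplus>\<^bsub>M\<^esub> slice \<xi> u" if "functional V \<xi>" for \<xi>
      using * u b by (simp add: linear_add[OF bnd_linear[OF MV(1,2,1) slice_bilinear[OF that]]]
          bnd_pure[OF _ _ _ slice_bilinear[OF that]])
    show ?case
    proof (cases "b \<in> gen_submodule K V (set bs)")
      case True
      then have "t \<in> tensor_span bs"
        using * b S(4) pure_gen_in_tensor_span by simp
      with Cons b show ?thesis by blast
    next
      case False
      \<comment> \<open>This functional separates b from the span of the remaining entries, so its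
        slice of \<open>t\<close> is exactly \<open>m\<close>.\<close>
      obtain \<xi> where \<xi>: "functional V \<xi>" "\<And>v. v \<in> gen_submodule K V (set bs) \<Longrightarrow> \<xi> v = \<zero>" "\<xi> b = \<one>"
        by (rule exists_functional[OF MV(2) gen b(1) False]) (rule that; assumption)
      have "slice \<xi> u = \<zero>\<^bsub>M\<^esub>"
      proof (rule slice_kills_tensor_span[OF \<xi>(1) b(2) _ *(3)])
        show "\<xi> a = \<zero>" if "a \<in> set bs" for a
          by (rule \<xi>(2)[OF subsetD[OF gen_submodule_incl that]])
      qed
      with sl[OF \<xi>(1)] \<xi>(3) * have "slice \<xi> t = m" by simp
      with Cons.prems(3)[OF \<xi>(1)] have m: "m \<in> W" by simp
      \<comment> \<open>The hypothesis passes to the remainder: its slice differs from that of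
        \<open>t\<close> by a multiple of \<open>m\<close>, now known to lie in
        \<open>W\<close>.\<close>
      have "slice \<eta> u \<in> W" if "functional V \<eta>" for \<eta>
      proof -
        have c: "slice \<eta> u \<in> carrier M" "\<eta> b \<odot>\<^bsub>M\<^esub> m \<in> carrier M"
          using bnd_closed[OF MV(1,2,1) slice_bilinear[OF that] u] that b * by auto
        then have "slice \<eta> u = slice \<eta> t \<ominus>\<^bsub>M\<^esub> \<eta> b \<odot>\<^bsub>M\<^esub> m"
          using sl[OF that] by (simp add: a_minus_def M.a_ac M.r_neg1 M.r_neg2 M.r_neg)
        with DW(5,7) m b Cons.prems(3)[OF that] that show ?thesis by simp
      qed
      then have "u \<in> ?I"
        using Cons.IH b * by blast
      with pI[OF m b(1)] I(4) * show ?thesis by simp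
    qed
  qed
  then show ?thesis
    using tensor_in_tensor_span[OF t] slices by metis
qed

end

lemma tensor_zero_module:
  assumes [simp]: "module K M" "module K V"
    and t: "t \<in> carrier (tensor K (M\<lparr>carrier := {\<zero>\<^bsub>M\<^esub>}\<rparr>) V)"
  shows "t = \<zero>\<^bsub>tensor K (M\<lparr>carrier := {\<zero>\<^bsub>M\<^esub>}\<rparr>) V\<^esub>"
proof -
  let ?M = "M\<lparr>carrier := {\<zero>\<^bsub>M\<^esub>}\<rparr>"
  have m [simp]: "module K ?M"
    by (rule submodule_module[OF assms(1) submodule_zero[OF assms(1)]])
  interpret TT: module K "tensor K ?M V" by simp
  show ?thesis
    using m assms(2) t
  proof (induction rule: tensor_induct)
    case (pure a b)
    then show ?case
      using linear_zero[OF linear_pure_left[OF m assms(2) linear_ident(1)]] by auto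
  qed simp
qed

text \<open>The slice criterion is reused for the zero subspace: if the inclusion kills s, all
  slices of s vanish, so s comes from 0 \<otimes> V, which is zero.\<close>

lemma tensor_incl_inj:
  assumes [simp]: "module K M" "module K V" and W: "submodule W K M"
  shows "inj_on (tensor_incl K M V) (carrier (tensor K (M\<lparr>carrier := W\<rparr>) V))"
proof (rule inj_onI)
  let ?M = "M\<lparr>carrier := W\<rparr>"
  note L = tensor_incl_linear[OF assms(1,2) W]
  have m [simp]: "module K ?M"
    by (rule submodule_module[OF assms(1) W])
  interpret TT: module K "tensor K ?M V" by simp
  interpret TM: module K "tensor K M V" by simp
  interpret M: module K M by simp
  have z: "submodule {\<zero>\<^bsub>M\<^esub>} K ?M"
    using submodule_zero[OF m] by simp
  have ker: "s = \<zero>\<^bsub>tensor K ?M V\<^esub>"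
    if s: "s \<in> carrier (tensor K ?M V)" "tensor_incl K M V s = \<zero>\<^bsub>tensor K M V\<^esub>" for s
  proof -
    \<comment> \<open>The ambient space of this application is the subspace itself; the slices are
      transported to M, where the image of s is zero.\<close>
    have "s \<in> tensor_incl K ?M V ` carrier (tensor K (?M\<lparr>carrier := {\<zero>\<^bsub>M\<^esub>}\<rparr>) V)"
    proof (rule slices_imp_tensor_incl[OF m assms(2) z s(1)])
      fix \<xi> assume \<xi>: "functional V \<xi>"
      have "bnd ?M V ?M s (\<lambda>m b. \<xi> b \<odot>\<^bsub>?M\<^esub> m) = bnd ?M V M s (\<lambda>m b. \<xi> b \<odot>\<^bsub>M\<^esub> m)"
        using linear_image_bnd[OF m assms(2) m assms(1) linear_inclusion[OF assms(1,2) W linear_ident(1)]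
            slice_bilinear[OF m assms(2) \<xi>] s(1)] by simp
      also have "\<dots> = bnd M V M (tensor_incl K M V s) (\<lambda>m b. \<xi> b \<odot>\<^bsub>M\<^esub> m)"
        using bnd_tensor_incl[OF assms(1,2) W assms(1) slice_bilinear[OF assms(1,2) \<xi>] s(1)] by simp
      also have "\<dots> = \<zero>\<^bsub>M\<^esub>"
        unfolding s(2) using linear_zero[OF bnd_linear[OF assms(1,2,1) slice_bilinear[OF assms(1,2) \<xi>]]] by simp
      finally show "bnd ?M V ?M s (\<lambda>m b. \<xi> b \<odot>\<^bsub>?M\<^esub> m) \<in> {\<zero>\<^bsub>M\<^esub>}" by simp
    qed
    then obtain r where r: "r \<in> carrier (tensor K (?M\<lparr>carrier := {\<zero>\<^bsub>M\<^esub>}\<rparr>) V)" "s = tensor_incl K ?M V r"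
      by auto
    then have "r = \<zero>\<^bsub>tensor K (?M\<lparr>carrier := {\<zero>\<^bsub>M\<^esub>}\<rparr>) V\<^esub>"
      using tensor_zero_module[OF m assms(2), of r] by simp
    with r(2) show ?thesis
      using linear_zero[OF tensor_incl_linear[OF m assms(2) z]] submodule_module[OF m z] by simp
  qed
  fix s t assume st: "s \<in> carrier (tensor K ?M V)" "t \<in> carrier (tensor K ?M V)"
    "tensor_incl K M V s = tensor_incl K M V t"
  then have "tensor_incl K M V (s \<ominus>\<^bsub>tensor K ?M V\<^esub> t) = \<zero>\<^bsub>tensor K M V\<^esub>"
    using linear_closed[OF L, of t] linear_minus[OF L _ _ st(1,2)] TM.r_neg
    by (simp add: a_minus_def[of "tensor K M V"])
  from ker[OF _ this] st have "s \<oplus>\<^bsub>tensor K ?M V\<^esub> \<ominus>\<^bsub>tensor K ?M V\<^esub> t = \<zero>\<^bsub>tensor K ?M V\<^esub>"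
    by (simp add: a_minus_def)
  from TT.minus_equality[OF this] st show "s = t" by simp
qed

lemma bnd_pure_self:
  assumes [simp]: "module K A" "module K B" and t: "t \<in> carrier (tensor K A B)"
  shows "bnd A B (tensor K A B) t (pure K A B) = t"
  by (rule tensor_ext[OF _ _ t bnd_linear linear_ident(1)])
    (simp_all add: bnd_pure pure_bilinear)

section \<open>Restriction of a comodule structure to a subspace\<close>

context
  fixes B :: "('k, 'b) module" and \<Delta> \<epsilon> and M :: "('k, 'm) module" and \<rho> and W
  assumes comodule: "right_comodule K B \<Delta> \<epsilon> M \<rho>" and sub: "submodule W K M"
    and restricts: "coaction_restricts K B M \<rho> W"
begin

private lemma mods [simp]: "module K M" "module K B" "module K (M\<lparr>carrier := W\<rparr>)"
proof -
  show "module K M" "module K B"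
    using right_comodule_facts[OF comodule] coalgebra_facts by auto
  then show "module K (M\<lparr>carrier := W\<rparr>)"
    using submodule_module sub by auto
qed

lemma restrict_coaction_facts:
  assumes "w \<in> W"
  shows "restrict_coaction K B M \<rho> W w \<in> carrier (tensor K (M\<lparr>carrier := W\<rparr>) B)"
    and "tensor_incl K M B (restrict_coaction K B M \<rho> W w) = \<rho> w"
proof -
  have *: "\<rho> w \<in> tensor_incl K M B ` carrier (tensor K (M\<lparr>carrier := W\<rparr>) B)"
    using assms restricts unfolding coaction_restricts_def by auto
  show "restrict_coaction K B M \<rho> W w \<in> carrier (tensor K (M\<lparr>carrier := W\<rparr>) B)"
    "tensor_incl K M B (restrict_coaction K B M \<rho> W w) = \<rho> w"
    unfolding restrict_coaction_def by (rule inv_into_into[OF *] f_inv_into_f[OF *])+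
qed

text \<open>\<open>restrict_coaction\<close> is an inverse image and has no linearity of its own.
  Each law is checked after the injective inclusion into M \<otimes> B, where it is linearity of
  \<open>\<rho>\<close>.\<close>

lemma restrict_coaction_linear:
  "linear_map K (M\<lparr>carrier := W\<rparr>) (tensor K (M\<lparr>carrier := W\<rparr>) B) (restrict_coaction K B M \<rho> W)"
proof -
  note inj = inj_onD[OF tensor_incl_inj[OF mods(1,2) sub]]
  note L = tensor_incl_linear[OF mods(1,2) sub]
  note \<rho> = right_comodule_facts(3)[OF comodule]
  note D = submoduleD[OF sub mods(1)]
  let ?r = "restrict_coaction K B M \<rho> W"
  show ?thesis
  proof (rule linearI)
    fix x assume "x \<in> carrier (M\<lparr>carrier := W\<rparr>)"
    then have x: "x \<in> W" "x \<in> carrier M" using D by auto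
    then show "?r x \<in> carrier (tensor K (M\<lparr>carrier := W\<rparr>) B)"
      by (simp add: restrict_coaction_facts)
    show "?r (c \<odot>\<^bsub>M\<lparr>carrier := W\<rparr>\<^esub> x) = c \<odot>\<^bsub>tensor K (M\<lparr>carrier := W\<rparr>) B\<^esub> ?r x"
      if "c \<in> carrier K" for c
      by (rule inj) (use x that D(5) in \<open>simp_all add: restrict_coaction_facts linear_smult[OF L] linear_smult[OF \<rho>]\<close>)
    fix y assume "y \<in> carrier (M\<lparr>carrier := W\<rparr>)"
    then have y: "y \<in> W" "y \<in> carrier M" using D by auto
    show "?r (x \<oplus>\<^bsub>M\<lparr>carrier := W\<rparr>\<^esub> y) = ?r x \<oplus>\<^bsub>tensor K (M\<lparr>carrier := W\<rparr>) B\<^esub> ?r y"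
      by (rule inj) (use x y D(4) in \<open>simp_all add: restrict_coaction_facts linear_add[OF L] linear_add[OF \<rho>]\<close>)
  qed
qed

lemma bnd_restrict_coaction:
  assumes "module K N" "bilinear M B N \<phi>" "w \<in> W"
  shows "bnd (M\<lparr>carrier := W\<rparr>) B N (restrict_coaction K B M \<rho> W w) \<phi> = bnd M B N (\<rho> w) \<phi>"
  using bnd_tensor_incl[OF mods(1,2) sub assms(1,2) restrict_coaction_facts(1)[OF assms(3)]]
    restrict_coaction_facts(2)[OF assms(3)] by simp

text \<open>Coassociativity is compared after the inclusion of W \<otimes> (B \<otimes> B) into M
  \<otimes> (B \<otimes> B), which is again injective; there it is the axiom for M.\<close>

lemma right_comodule_restrict:
  "right_comodule K B \<Delta> \<epsilon> (M\<lparr>carrier := W\<rparr>) (restrict_coaction K B M \<rho> W)"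
proof -
  \<comment> \<open>The name keeps the simplifier from reducing the carrier to \<open>W\<close>, so
    that rules stated for carriers still match.\<close>
  define M' where "M' = M\<lparr>carrier := W\<rparr>"
  define r where "r = restrict_coaction K B M \<rho> W"
  let ?BB = "tensor K B B"
  note coalg = right_comodule_facts(1)[OF comodule]
  note [simp] = coalgebra_facts[OF coalg] right_comodule_facts(2-)[OF comodule]
  have BB: "module K ?BB" by simp
  have carr: "carrier M' = W"
    unfolding M'_def by simp
  have M' [simp]: "module K M'"
    unfolding M'_def by simp
  have W [simp]: "m \<in> carrier M' \<Longrightarrow> m \<in> carrier M" for m
    using submoduleD(2)[OF sub mods(1)] carr by simp
  have r [simp]: "m \<in> carrier M' \<Longrightarrow> r m \<in> carrier (tensor K M' B)" for m
    using restrict_coaction_facts(1) unfolding M'_def r_def by simp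
  have r_lin: "linear_map K M' (tensor K M' B) r"
    unfolding M'_def r_def by (rule restrict_coaction_linear)
  have [simp]: "linear_map K V M' f \<Longrightarrow> linear_map K V (tensor K M' B) (\<lambda>v. r (f v))"
    for V and f :: "'z \<Rightarrow> 'm"
    by (erule linear_compose[OF _ r_lin])
  have incl: "linear_map K M' M (\<lambda>m. m)"
    unfolding M'_def by (rule linear_inclusion[OF mods(1,2) sub linear_ident(1)])
  have bnd_r: "bnd M' B N (r m) \<phi> = bnd M B N (\<rho> m) \<phi>"
    if "module K N" "bilinear M B N \<phi>" "m \<in> carrier M'" for N :: "('k, 'n) module" and \<phi> m
    using bnd_restrict_coaction that carr unfolding M'_def r_def by simp
  have \<rho>_lin: "linear_map K M' (tensor K M B) \<rho>"
    using linear_compose[OF incl right_comodule_facts(3)[OF comodule]] by simp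
  \<comment> \<open>The inclusion is taken with right factor B \<otimes> B, where coassociativity
    takes values.\<close>
  note L = tensor_incl_linear[OF mods(1) BB sub, folded M'_def]
  note Lp = tensor_incl_pure[OF mods(1) BB sub, folded M'_def carr]
  note inj = inj_onD[OF tensor_incl_inj[OF mods(1) BB sub, folded M'_def]]
  have "right_comodule K B \<Delta> \<epsilon> M' r"
  proof (rule right_comoduleI[OF coalg M' r_lin])
    fix m assume m: "m \<in> carrier M'"
    let ?N = "tensor K M ?BB" and ?N' = "tensor K M' ?BB"
    let ?l = "bnd M' B ?N' (r m) (\<lambda>m0 b. bnd M' B ?N' (r m0) (\<lambda>m00 b1. pure K M' ?BB m00 (pure K B B b1 b)))"
    let ?rr = "bnd M' B ?N' (r m) (\<lambda>m0 b. pure K M' ?BB m0 (\<Delta> b))"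
    have "tensor_incl K M ?BB ?l = bnd M' B ?N (r m) (\<lambda>m0 b. bnd M' B ?N (r m0) (\<lambda>m00 b1. pure K M ?BB m00 (pure K B B b1 b)))"
      using m by (simp add: linear_image_bnd[OF _ _ _ _ L] Lp linear_simps)
    also have "\<dots> = bnd M' B ?N (r m) (\<lambda>m0 b. bnd M B ?N (\<rho> m0) (\<lambda>m00 b1. pure K M ?BB m00 (pure K B B b1 b)))"
      by (intro bnd_cong refl bnd_r) (simp_all add: linear_simps)
    also have "\<dots> = bnd M B ?N (\<rho> m) (\<lambda>m0 b. bnd M B ?N (\<rho> m0) (\<lambda>m00 b1. pure K M ?BB m00 (pure K B B b1 b)))"
      using m by (intro bnd_r) (simp_all add: linear_simps)
    also have "\<dots> = bnd M B ?N (\<rho> m) (\<lambda>m0 b. bnd B B ?N (\<Delta> b) (\<lambda>b1 b2. pure K M ?BB m0 (pure K B B b1 b2)))"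
      using m by (intro comodule_coassoc_law[OF comodule]) (simp_all add: linear_simps)
    also have "\<dots> = bnd M B ?N (\<rho> m) (\<lambda>m0 b. pure K M ?BB m0 (bnd B B ?BB (\<Delta> b) (pure K B B)))"
      by (intro bnd_cong refl pure_bnd_right[symmetric]) (simp_all add: pure_bilinear)
    also have "\<dots> = bnd M B ?N (\<rho> m) (\<lambda>m0 b. pure K M ?BB m0 (\<Delta> b))"
      by (intro bnd_cong refl) (simp add: bnd_pure_self)
    also have "\<dots> = bnd M' B ?N (r m) (\<lambda>m0 b. pure K M ?BB m0 (\<Delta> b))"
      using m by (intro bnd_r[symmetric]) (simp_all add: linear_simps)
    also have "\<dots> = tensor_incl K M ?BB ?rr"
      using m by (simp add: linear_image_bnd[OF _ _ _ _ L] Lp linear_simps)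
    finally show "?l = ?rr"
      by (rule inj) (use m in \<open>simp_all add: linear_simps\<close>)
    have [simp]: "c \<odot>\<^bsub>M'\<^esub> v = c \<odot>\<^bsub>M\<^esub> v" for c v
      unfolding M'_def by simp
    have in3: "bilinear M' B M' (\<lambda>m0 b. \<epsilon> b \<odot>\<^bsub>M'\<^esub> m0)"
      by (rule bilinearI; rule coalgebra_facts(6)[OF coalg] linear_scale) (auto simp: linear_ident)
    have "bnd M' B M' (r m) (\<lambda>m0 b. \<epsilon> b \<odot>\<^bsub>M'\<^esub> m0) = bnd M' B M (r m) (\<lambda>m0 b. \<epsilon> b \<odot>\<^bsub>M'\<^esub> m0)"
      by (rule linear_image_bnd[OF _ _ _ _ incl in3]) (use m in auto)
    also have "\<dots> = bnd M B M (\<rho> m) (\<lambda>m0 b. \<epsilon> b \<odot>\<^bsub>M\<^esub> m0)"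
      using m by (simp, intro bnd_r) (simp_all add: linear_simps)
    also have "\<dots> = m"
      by (rule comodule_counit_law[OF comodule _ linear_ident(1)]) (use m in auto)
    finally show "bnd M' B M' (r m) (\<lambda>m0 b. \<epsilon> b \<odot>\<^bsub>M'\<^esub> m0) = m" .
  qed
  then show ?thesis
    unfolding M'_def r_def .
qed

end

text \<open>The vectors at which \<rho> h = (h \<otimes> id) \<rho> for every h in \<open>H\<close>.
  Both versions of PCM are of this form, with natural or with integer powers of \<tau> as
  \<open>H\<close>.\<close>

definition commuting_part ::
  "('k, 'b) module \<Rightarrow> ('k, 'm) module \<Rightarrow> ('m \<Rightarrow> ('k, 'm, 'b) tens) \<Rightarrow> ('m \<Rightarrow> 'm) set \<Rightarrow> 'm set" where
  "commuting_part B M \<rho> H = {v \<in> carrier M. \<forall>h\<in>H.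
     \<rho> (h v) = bnd M B (tensor K M B) (\<rho> v) (\<lambda>m b. pure K M B (h m) b)}"

context
  fixes B :: "('k, 'b) module" and \<Delta> \<epsilon> and M :: "('k, 'm) module" and \<rho> and H
  assumes comodule: "right_comodule K B \<Delta> \<epsilon> M \<rho>" and H: "\<And>h. h \<in> H \<Longrightarrow> linear_map K M M h"
begin

lemma commuting_part_submodule: "submodule (commuting_part B M \<rho> H) K M"
proof -
  note [simp] = coalgebra_facts[OF right_comodule_facts(1)[OF comodule]] right_comodule_facts(2-)[OF comodule]
  have "submodule {v \<in> carrier M. \<rho> (h v) = bnd M B (tensor K M B) (\<rho> v) (\<lambda>m b. pure K M B (h m) b)} K M"
    if "h \<in> H" for h
    using H[OF that] linear_closed[OF H[OF that]]
    by (intro submodule_linear_eq[where W = "tensor K M B"]) (simp_all add: linear_simps)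
  moreover have "commuting_part B M \<rho> H = \<Inter>(insert (carrier M)
      ((\<lambda>h. {v \<in> carrier M. \<rho> (h v) = bnd M B (tensor K M B) (\<rho> v) (\<lambda>m b. pure K M B (h m) b)}) ` H))"
    unfolding commuting_part_def by auto
  ultimately show ?thesis
    by (simp only:, intro submodule_Inter) (auto intro: module.carrier_is_submodule)
qed

text \<open>It is enough that the slices w = \<xi>(v_(1)) v_(0) commute with each h. By
  coassociativity \<open>\<xi>\<close> can be moved to the last of three legs, so that the rest of
  the expression depends on v only through (h \<otimes> id) \<rho>(v), which the hypothesis replaces
  by \<rho>(h v).\<close>

lemma commuting_part_restricts: "coaction_restricts K B M \<rho> (commuting_part B M \<rho> H)"
  unfolding coaction_restricts_def
proof (rule image_subsetI)
  note [simp] = coalgebra_facts[OF right_comodule_facts(1)[OF comodule]] right_comodule_facts(2-)[OF comodule]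
  fix v assume v: "v \<in> commuting_part B M \<rho> H"
  then have vM [simp]: "v \<in> carrier M" unfolding commuting_part_def by simp
  let ?N = "tensor K M B"
  show "\<rho> v \<in> tensor_incl K M B ` carrier (tensor K (M\<lparr>carrier := commuting_part B M \<rho> H\<rparr>) B)"
  proof (rule slices_imp_tensor_incl[OF _ _ commuting_part_submodule])
    fix \<xi> assume \<xi> [simp]: "functional B \<xi>"
    note [simp] = linear_functional[OF \<xi>] functional_closed[OF \<xi>]
    have sl: "bilinear M B M (\<lambda>m b. \<xi> b \<odot>\<^bsub>M\<^esub> m)"
      by (rule slice_bilinear) auto
    let ?w = "bnd M B M (\<rho> v) (\<lambda>m b. \<xi> b \<odot>\<^bsub>M\<^esub> m)"
    have w: "?w \<in> carrier M"
      by (rule bnd_closed[OF _ _ _ sl]) auto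
    have "\<rho> (h ?w) = bnd M B ?N (\<rho> ?w) (\<lambda>m b. pure K M B (h m) b)" if h: "h \<in> H" for h
    proof -
      note hl = H[OF h]
      have [simp]: "linear_map K V M f \<Longrightarrow> linear_map K V M (\<lambda>v. h (f v))" for V and f :: "'z \<Rightarrow> 'm"
        by (erule linear_compose[OF _ hl])
      note [simp] = linear_closed[OF hl]
      have \<rho>l: "linear_map K M ?N \<rho>" by simp
      have g: "linear_map K M ?N (\<lambda>m. bnd M B ?N (\<rho> m) (\<lambda>m b. pure K M B (h m) b))"
        by (simp add: linear_simps)
      have hv: "bnd M B ?N (\<rho> v) (\<lambda>m b. pure K M B (h m) b) = \<rho> (h v)"
        using v h unfolding commuting_part_def by simp
      have "bnd M B ?N (\<rho> ?w) (\<lambda>m b. pure K M B (h m) b) =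
          bnd M B ?N (\<rho> v) (\<lambda>m b. bnd M B ?N (\<rho> m) (\<lambda>m0 b0. \<xi> b \<odot>\<^bsub>?N\<^esub> pure K M B (h m0) b0))"
        by (simp add: linear_image_bnd[OF _ _ _ _ g sl] linear_smult[OF g] smult_bnd linear_simps)
      \<comment> \<open>Coassociativity removes the second coaction from the argument of
        \<open>h\<close>, where it could not be exchanged with \<open>h\<close>.\<close>
      also have "\<dots> = bnd M B ?N (\<rho> v) (\<lambda>m c. bnd B B ?N (\<Delta> c) (\<lambda>b0 b1. \<xi> b1 \<odot>\<^bsub>?N\<^esub> pure K M B (h m) b0))"
        by (intro comodule_coassoc_law[OF comodule]) (simp_all add: linear_simps)
      \<comment> \<open>The sum is rewritten as a function of (h \<otimes> id) \<rho>(v), to which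
        the hypothesis on \<open>v\<close> applies.\<close>
      also have "\<dots> = bnd M B ?N (bnd M B ?N (\<rho> v) (\<lambda>m b. pure K M B (h m) b))
          (\<lambda>m c. bnd B B ?N (\<Delta> c) (\<lambda>b0 b1. \<xi> b1 \<odot>\<^bsub>?N\<^esub> pure K M B m b0))"
        by (simp add: bnd_image_simps linear_simps)
      also have "\<dots> = bnd M B ?N (\<rho> (h v)) (\<lambda>m b. bnd M B ?N (\<rho> m) (\<lambda>m0 b0. \<xi> b \<odot>\<^bsub>?N\<^esub> pure K M B m0 b0))"
        unfolding hv by (intro comodule_coassoc_law[OF comodule, symmetric]) (simp_all add: linear_simps)
      also have "\<dots> = bnd M B ?N (\<rho> (h v)) (\<lambda>m b. \<xi> b \<odot>\<^bsub>?N\<^esub> bnd M B ?N (\<rho> m) (pure K M B))"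
        by (intro bnd_cong refl smult_bnd[symmetric]) (simp_all add: pure_bilinear)
      \<comment> \<open>The hypothesis is used in the opposite direction, to return from \<rho>(h v)
        to \<rho>(v).\<close>
      also have "\<dots> = bnd M B ?N (bnd M B ?N (\<rho> v) (\<lambda>m b. pure K M B (h m) b)) (\<lambda>m b. \<xi> b \<odot>\<^bsub>?N\<^esub> \<rho> m)"
        unfolding hv by (intro bnd_cong refl) (simp add: bnd_pure_self)
      also have "\<dots> = bnd M B ?N (\<rho> v) (\<lambda>m b. \<rho> (h (\<xi> b \<odot>\<^bsub>M\<^esub> m)))"
        by (simp add: bnd_image_simps linear_simps linear_smult[OF hl] linear_smult[OF \<rho>l])
      also have "\<dots> = \<rho> (h ?w)"
        by (rule linear_image_bnd[OF _ _ _ _ linear_compose[OF hl \<rho>l] sl, symmetric]) auto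
      finally show ?thesis ..
    qed
    with w show "?w \<in> commuting_part B M \<rho> H"
      unfolding commuting_part_def by simp
  qed auto
qed

end

end

section \<open>The para-cyclic structure\<close>

context comodule_data
begin

lemma TT_eq: "TT K Y X n = T (Suc n)"
  unfolding TT_def by simp

lemma cyc_eq_tau:
  assumes "t \<in> carrier (T (Suc n))"
  shows "cyc K Y \<rho>Y X act n t = tau n t"
  unfolding cyc_def tau_def TT_eq
proof (rule lin_ext_mtens_cong)
  fix ys :: "'y list" and x assume "set ys \<subseteq> carrier Y" "length ys = Suc n" "x \<in> carrier X"
  then obtain zs z where "ys = zs @ [z]" "set zs \<subseteq> carrier Y" "length zs = n" "z \<in> carrier Y" "x \<in> carrier X"
    by (cases ys rule: rev_cases) auto
  then show "lin_ext K (T (Suc n)) (\<lambda>(y0, y1). mpure K Y X (n + 1) (y0 # butlast ys) (act y1 x)) (\<rho>Y (last ys)) =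
      cyc_pure n ys x"
    unfolding cyc_pure_def by (intro lin_ext_eq_bnd) (simp_all add: linear_simps mpure_Cons)
qed (use assms in \<open>auto intro: cyc_pure_multilinear\<close>)

definition faceT :: "nat \<Rightarrow> nat \<Rightarrow> ('k, 'y, 'x) mtens \<Rightarrow> ('k, 'y, 'x) mtens" where
  "faceT n j t = (if j < n then mulT n j t else mulT n 0 (tau n t))"

lemma multilinear_compose:
  assumes "multilinear Y X M n \<phi>" "linear_map K M N g"
  shows "multilinear Y X N n (\<lambda>ys x. g (\<phi> ys x))"
  by (rule multilinearI; rule linear_compose[OF _ assms(2)]; rule multilinearD[OF assms(1)])

text \<open>The last face is recognised as \<partial>_0 \<tau> by comparing the multilinear maps
  that define the two sides on generators; the product of the moved y_(0) with the first factor is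
  the zeroth inner face after rotation.\<close>

lemma face_eq_faceT:
  assumes "n \<ge> 1" "j \<le> n" "t \<in> carrier (T (Suc n))"
  shows "face K Y \<rho>Y X act n j t = faceT n j t"
proof (cases "j < n")
  case True
  have "face K Y \<rho>Y X act n j t = lin_ext K (T n) (\<lambda>(ys, x). mpure K Y X n (mulat j ys) x) t"
    using True assms unfolding face_def TT_def mulat_def by simp
  with True show ?thesis
    by (simp add: faceT_def mulT_def)
next
  case False
  with assms obtain m where n: "n = Suc m" "j = n" by (cases n) auto
  note t = assms(3)[unfolded n(1)]
  let ?\<phi> = "\<lambda>ys x. mulT n 0 (cyc_pure n ys x)"
  have lin: "linear_map K (T (Suc n)) (T n) (mulT n 0)"
    using n by (intro mulT_linear) simp
  note ml = multilinear_compose[OF cyc_pure_multilinear lin]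
  have "face K Y \<rho>Y X act n j t = lin_ext K (T n) (\<lambda>(ys, x). lin_ext K (T n)
      (\<lambda>(y0, y1). mpure K Y X n ((y0 \<otimes>\<^bsub>Y\<^esub> hd ys) # tl (butlast ys)) (act y1 x)) (\<rho>Y (last ys))) t"
    using n unfolding face_def TT_def by simp
  also have "\<dots> = lin_ext K (T n) (\<lambda>(ys, x). ?\<phi> ys x) t"
  proof (rule lin_ext_mtens_cong[OF _ _ _ ml assms(3)])
    fix ys :: "'y list" and x assume *: "set ys \<subseteq> carrier Y" "length ys = Suc n" "x \<in> carrier X"
    then obtain us z where "ys = us @ [z]" "length us = n"
      by (cases ys rule: rev_cases) auto
    then obtain a zs where ys: "ys = (a # zs) @ [z]" "set zs \<subseteq> carrier Y" "length zs = m" "z \<in> carrier Y" "a \<in> carrier Y"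
      using * n by (cases us) auto
    then show "lin_ext K (T n) (\<lambda>(y0, y1). mpure K Y X n ((y0 \<otimes>\<^bsub>Y\<^esub> hd ys) # tl (butlast ys)) (act y1 x)) (\<rho>Y (last ys)) =
        ?\<phi> ys x"
      using * unfolding cyc_pure_def n(1)
      by (simp add: mulT_bnd linear_simps, intro lin_ext_eq_bnd)
        (simp_all add: linear_simps mpure_Cons mulT_tcons_zero)
  qed auto
  also have "\<dots> = mulT n 0 (tau n t)"
  proof (rule mtens_ext[OF _ _ assms(3), where M = "T n"])
    show "linear_map K (T (Suc n)) (T n) (lin_ext K (T n) (\<lambda>(ys, x). ?\<phi> ys x))"
      by (rule multilinear_lift) (use ml in auto)
    fix ys :: "'y list" and x assume *: "set ys \<subseteq> carrier Y" "length ys = Suc n" "x \<in> carrier X"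
    then show "lin_ext K (T n) (\<lambda>(ys, x). ?\<phi> ys x) (mpure K Y X (Suc n) ys x) = mulT n 0 (tau n (mpure K Y X (Suc n) ys x))"
      unfolding tau_def by (subst (1 2) multilinear_lift(2)) (use ml in \<open>auto intro: cyc_pure_multilinear\<close>)
  qed (use n in \<open>auto simp: linear_ident\<close>)
  finally show ?thesis
    using n by (simp add: faceT_def)
qed

lemma faceT_linear: "n \<ge> 1 \<Longrightarrow> linear_map K (T (Suc n)) (T n) (faceT n j)"
  unfolding faceT_def by (cases "j < n") (simp_all add: mulT_linear linear_ident)

lemma faceT_closed [simp]: "\<lbrakk>n \<ge> 1; t \<in> carrier (T (Suc n))\<rbrakk> \<Longrightarrow> faceT n j t \<in> carrier (T n)"
  by (rule linear_closed[OF faceT_linear])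

lemma faceT_faceT:
  assumes "i < j" "j \<le> Suc (Suc m)" "t \<in> carrier (T (Suc (Suc (Suc m))))"
  shows "faceT (Suc m) i (faceT (Suc (Suc m)) j t) = faceT (Suc m) (j - 1) (faceT (Suc (Suc m)) i t)"
proof -
  \<comment> \<open>Either both faces are inner, or only \<open>j\<close> is the last face, or
    \<open>i\<close> is the last face of the smaller degree as well. The last two cases turn into
    inner identities after the rotations are pushed to the right.\<close>
  consider "j < Suc (Suc m)" | "j = Suc (Suc m)" "i = Suc m" | "j = Suc (Suc m)" "i < Suc m"
    using assms by linarith
  then show ?thesis
  proof cases
    case 1
    then have "j - 1 < Suc m" using assms(1) by simp
    with 1 assms mulT_mulT[of i j "Suc m" t] show ?thesis by (simp add: faceT_def)
  next
    case 2
    have "mulT (Suc m) 0 (tau (Suc m) (mulT (Suc (Suc m)) 0 (tau (Suc (Suc m)) t))) =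
        mulT (Suc m) 0 (mulT (Suc (Suc m)) (Suc 0) (tau (Suc (Suc m)) (tau (Suc (Suc m)) t)))"
      using assms by (simp add: mulT_tau_Suc)
    also have "\<dots> = mulT (Suc m) 0 (mulT (Suc (Suc m)) 0 (tau (Suc (Suc m)) (tau (Suc (Suc m)) t)))"
      using assms by (subst mulT_mulT) simp_all
    also have "\<dots> = mulT (Suc m) 0 (tau (Suc m) (mulT (Suc (Suc m)) (Suc m) t))"
      using assms by (simp add: mulT_tau_tau)
    finally show ?thesis
      using 2 by (simp add: faceT_def)
  next
    case 3
    have "mulT (Suc m) 0 (tau (Suc m) (mulT (Suc (Suc m)) i t)) =
        mulT (Suc m) 0 (mulT (Suc (Suc m)) (Suc i) (tau (Suc (Suc m)) t))"
      using 3 assms by (simp add: mulT_tau_Suc)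
    also have "\<dots> = mulT (Suc m) i (mulT (Suc (Suc m)) 0 (tau (Suc (Suc m)) t))"
      using 3 assms by (subst mulT_mulT) simp_all
    finally show ?thesis
      using 3 by (simp add: faceT_def)
  qed
qed

lemma faceT_tau:
  assumes "1 \<le> j" "j \<le> Suc m" "t \<in> carrier (T (Suc (Suc m)))"
  shows "faceT (Suc m) j (tau (Suc m) t) = tau m (faceT (Suc m) (j - 1) t)"
proof -
  obtain k where k: "j = Suc k"
    using assms(1) by (cases j) auto
  show ?thesis
    using assms unfolding k by (cases "k < m") (simp_all add: faceT_def mulT_tau_Suc mulT_tau_tau not_less_less_Suc_eq)
qed

lemma weak_para_cyclic_T: "weak_para_cyclic K (TT K Y X) (face K Y \<rho>Y X act) (cyc K Y \<rho>Y X act)"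
proof -
  have face: "face K Y \<rho>Y X act (Suc m) j t = faceT (Suc m) j t"
    if "j \<le> Suc m" "t \<in> carrier (T (Suc (Suc m)))" for m j t
    using that by (simp add: face_eq_faceT)
  have tau: "cyc K Y \<rho>Y X act n t = tau n t" if "t \<in> carrier (T (Suc n))" for n t
    by (rule cyc_eq_tau[OF that])
  show ?thesis
    unfolding weak_para_cyclic_def pre_simplicial_def TT_eq
  proof (intro conjI allI impI ballI)
    show "linear_map K (T (Suc n)) (T (Suc n)) (cyc K Y \<rho>Y X act n)" for n
      by (rule linear_cong[OF tau_linear]) (auto simp: tau)
    fix n :: nat
    {
      fix j assume "1 \<le> n" "j \<le> n"
      then obtain m where m: "n = Suc m" by (cases n) auto
      have "linear_map K (T (Suc (Suc m))) (T (Suc m)) (face K Y \<rho>Y X act (Suc m) j)"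
        by (rule linear_cong[OF faceT_linear]) (use \<open>j \<le> n\<close> m face in auto)
      then show "linear_map K (T (Suc n)) (T (Suc (n - 1))) (face K Y \<rho>Y X act n j)"
        using m by simp
    next
      fix j i z assume *: "2 \<le> n" "j \<le> n" "i < j" "z \<in> carrier (T (Suc n))"
      then obtain m where m: "n = Suc (Suc m)" by (cases n; cases "n - 1") auto
      show "face K Y \<rho>Y X act (n - 1) i (face K Y \<rho>Y X act n j z) =
        face K Y \<rho>Y X act (n - 1) (j - 1) (face K Y \<rho>Y X act n i z)"
        using * faceT_faceT[of i j m z] unfolding m by (simp add: face)
    next
      fix j z assume *: "1 \<le> n" "j \<in> {1..n}" "z \<in> carrier (T (Suc n))"
      then obtain m where m: "n = Suc m" by (cases n) auto
      show "face K Y \<rho>Y X act n j (cyc K Y \<rho>Y X act n z) =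
        cyc K Y \<rho>Y X act (n - 1) (face K Y \<rho>Y X act n (j - 1) z)"
        using * faceT_tau[of j m z] unfolding m by (cases j) (simp_all add: face tau)
    next
      fix z assume *: "1 \<le> n" "z \<in> carrier (T (Suc n))"
      then obtain m where m: "n = Suc m" by (cases n) auto
      show "face K Y \<rho>Y X act n 0 (cyc K Y \<rho>Y X act n z) = face K Y \<rho>Y X act n n z"
        using * unfolding m by (simp add: face tau faceT_def)
    }
  qed simp
qed

end

context linear_algebra
begin

lemma linear_map_restrict:
  assumes "linear_map K M N f" "W \<subseteq> carrier M" "\<And>v. v \<in> W \<Longrightarrow> f v \<in> W'"
  shows "linear_map K (M\<lparr>carrier := W\<rparr>) (N\<lparr>carrier := W'\<rparr>) f"
  by (rule linearI)
    (use assms(3) subsetD[OF assms(2)] in \<open>auto simp: linear_add[OF assms(1)] linear_smult[OF assms(1)]\<close>)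

lemma weak_para_cyclic_restrict:
  assumes "weak_para_cyclic K Z d \<tau>" and sub: "\<And>n. submodule (W n) K (Z n)"
    and "\<And>n j v. \<lbrakk>1 \<le> n; j \<le> n; v \<in> W n\<rbrakk> \<Longrightarrow> d n j v \<in> W (n - 1)"
    and "\<And>n v. v \<in> W n \<Longrightarrow> \<tau> n v \<in> W n"
  shows "weak_para_cyclic K (\<lambda>n. (Z n)\<lparr>carrier := W n\<rparr>) d \<tau>"
proof -
  have mod: "module K (Z n)" for n
    using assms(1) unfolding weak_para_cyclic_def pre_simplicial_def by blast
  note W = submoduleD(1)[OF sub mod]
  have W': "v \<in> W n \<Longrightarrow> v \<in> carrier (Z n)" for n v
    using W by blast
  show ?thesis
    using assms(1,3,4) W' unfolding weak_para_cyclic_def pre_simplicial_def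
    by (auto simp: submodule_module[OF mod sub] intro!: linear_map_restrict[OF _ W])
qed

lemma module_minus_eq_zero:
  assumes "module K V" "a \<in> carrier V" "b \<in> carrier V"
  shows "a \<ominus>\<^bsub>V\<^esub> b = \<zero>\<^bsub>V\<^esub> \<longleftrightarrow> a = b"
proof -
  interpret V: module K V by fact
  show ?thesis
    using V.minus_equality[of a "\<ominus>\<^bsub>V\<^esub> b"] assms(2,3) by (auto simp: a_minus_def V.r_neg)
qed

text \<open>\<open>\<rho>'\<close> and \<open>f'\<close> are the operators as originally defined,
  \<open>\<rho>\<close> and \<open>f\<close> the ones with which they agree on the carrier and for
  which the laws are available.\<close>

lemma equalizer_eq_commuting_part:
  assumes com: "right_comodule K B \<Delta> \<epsilon> M \<rho>" and f: "linear_map K M M f"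
    and eq: "\<And>v. v \<in> carrier M \<Longrightarrow> \<rho>' v = \<rho> v" "\<And>v. v \<in> carrier M \<Longrightarrow> f' v = f v"
  shows "equalizer K B M \<rho>' f' = commuting_part B M \<rho> {f}"
proof -
  note [simp] = coalgebra_facts(1)[OF right_comodule_facts(1)[OF com]] right_comodule_facts(2-)[OF com]
  note [simp] = linear_closed[OF f] linear_compose[OF _ f]
  have f': "linear_map K M M f'"
    by (rule linear_cong[OF f]) (use eq in auto)
  have tm: "tensor_map K M B f' id (\<rho> v) = bnd M B (tensor K M B) (\<rho> v) (\<lambda>m b. pure K M B (f m) b)"
    if "v \<in> carrier M" for v
    using that f' by (simp add: eq tensor_map_eq_bnd[where V = M and W = B] linear_ident)
  have "bnd M B (tensor K M B) (\<rho> v) (\<lambda>m b. pure K M B (f m) b) \<in> carrier (tensor K M B)"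
    if "v \<in> carrier M" for v
    using that by (simp add: linear_simps)
  then have "\<rho>' (f' v) \<ominus>\<^bsub>tensor K M B\<^esub> tensor_map K M B f' id (\<rho>' v) = \<zero>\<^bsub>tensor K M B\<^esub> \<longleftrightarrow>
      \<rho> (f v) = bnd M B (tensor K M B) (\<rho> v) (\<lambda>m b. pure K M B (f m) b)" if "v \<in> carrier M" for v
    using that by (simp add: tm eq module_minus_eq_zero)
  then show ?thesis
    unfolding equalizer_def a_kernel_def' commuting_part_def by auto
qed

lemma commuting_part_Inter:
  "I \<noteq> {} \<Longrightarrow> (\<Inter>i\<in>I. commuting_part B M \<rho> {h i}) = commuting_part B M \<rho> (h ` I)"
  unfolding commuting_part_def by auto

end

context comodule_data
begin

lemma linear_tau_power [simp]: "linear_map K (T (Suc n)) (T (Suc n)) (tau n ^^ j)"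
  by (rule linear_funpow[OF tau_linear])

lemma tau_power_closed [simp]: "t \<in> carrier (T (Suc n)) \<Longrightarrow> (tau n ^^ j) t \<in> carrier (T (Suc n))"
  by (rule linear_closed[OF linear_tau_power])

lemma cyc_power_eq:
  "t \<in> carrier (T (Suc n)) \<Longrightarrow> (cyc K Y \<rho>Y X act n ^^ j) t = (tau n ^^ j) t"
  by (induction j) (simp_all add: cyc_eq_tau)

text \<open>Each \<tau> shifts the multiplied position by one and adds one to the exponent; passing
  from the last inner position back to 0 adds two. The indices obtained depend on \<open>j\<close>
  and \<open>l\<close> but not on the vector.\<close>

lemma tau_power_mulT:
  assumes "j \<le> m"
  shows "\<exists>i k. i \<le> m \<and> (\<forall>v\<in>carrier (T (Suc (Suc m))).
    (tau m ^^ l) (mulT (Suc m) j v) = mulT (Suc m) i ((tau (Suc m) ^^ k) v))"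
proof (induction l)
  case 0
  show ?case
    using assms by (intro exI[of _ j] exI[of _ 0]) simp
next
  case (Suc l)
  then obtain i k where i: "i \<le> m" and eq: "\<And>v. v \<in> carrier (T (Suc (Suc m))) \<Longrightarrow>
      (tau m ^^ l) (mulT (Suc m) j v) = mulT (Suc m) i ((tau (Suc m) ^^ k) v)"
    by blast
  show ?case
  proof (cases "i < m")
    case True
    with eq show ?thesis
      by (intro exI[of _ "Suc i"] exI[of _ "Suc k"]) (simp add: mulT_tau_Suc)
  next
    case False
    with i have "i = m" by simp
    with eq show ?thesis
      by (intro exI[of _ 0] exI[of _ "Suc (Suc k)"]) (simp add: mulT_tau_tau)
  qed
qed

section \<open>The submodules PCM and CM, and the cyclic structure on CM\<close>

lemma PCM_eq:
  "PCM K B Y \<rho>Y X act \<rho>X n = commuting_part B (T (Suc n)) (coT (Suc n)) (range (\<lambda>j. tau n ^^ j))"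
  unfolding PCM_def TT_eq
  by (subst commuting_part_Inter[symmetric], simp)
    (intro INF_cong refl equalizer_eq_commuting_part[OF right_comodule_T], auto simp: coact_eq_coT cyc_power_eq)

abbreviation "coinvariant n v \<equiv> coT n v = pure K (T n) B v \<one>\<^bsub>B\<^esub>"

lemma coinvariant_image:
  assumes "linear_map K (T n) (T m) g" "v \<in> carrier (T n)" "coinvariant n v"
  shows "bnd (T n) B (TB m) (coT n v) (\<lambda>t b. pure K (T m) B (g t) b) = pure K (T m) B (g v) \<one>\<^bsub>B\<^esub>"
  using assms linear_closed[OF assms(1)] by (simp add: linear_simps)

text \<open>If \<rho>(v) = v \<otimes> 1, then (\<tau>^j \<otimes> id) \<rho>(v) = \<tau>^j v
  \<otimes> 1, so commutation with \<tau>^j says exactly that \<tau>^j v is coinvariant too.\<close>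

lemma CM_eq:
  "CM K B Y \<rho>Y X act \<rho>X n = {v \<in> carrier (T (Suc n)). \<forall>j. coinvariant (Suc n) ((tau n ^^ j) v)}"
proof -
  let ?c = "\<lambda>v j. bnd (T (Suc n)) B (TB (Suc n)) (coT (Suc n) v) (\<lambda>t b. pure K (T (Suc n)) B ((tau n ^^ j) t) b)"
  have "(\<forall>j. coT (Suc n) ((tau n ^^ j) v) = ?c v j) \<and> coinvariant (Suc n) v \<longleftrightarrow>
      (\<forall>j. coinvariant (Suc n) ((tau n ^^ j) v))" if v: "v \<in> carrier (T (Suc n))" for v
  proof (cases "coinvariant (Suc n) v")
    case True
    have "?c v j = pure K (T (Suc n)) B ((tau n ^^ j) v) \<one>\<^bsub>B\<^esub>" for j
      by (rule coinvariant_image[OF linear_tau_power v True])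
    with True show ?thesis by presburger
  next
    case False
    then show ?thesis by (metis funpow_0)
  qed
  then have "v \<in> carrier (T (Suc n)) \<and> (\<forall>j. coT (Suc n) ((tau n ^^ j) v) = ?c v j) \<and> coact K B Y \<rho>Y X \<rho>X n v = pure K (T (Suc n)) B v \<one>\<^bsub>B\<^esub> \<longleftrightarrow>
      v \<in> carrier (T (Suc n)) \<and> (\<forall>j. coinvariant (Suc n) ((tau n ^^ j) v))" for v
    by (metis coact_eq_coT)
  then show ?thesis
    unfolding CM_def PCM_eq commuting_part_def TT_eq by (intro Collect_cong) simp
qed

lemma CM_submodule: "submodule (CM K B Y \<rho>Y X act \<rho>X n) K (T (Suc n))"
proof -
  have "submodule {v \<in> carrier (T (Suc n)). coinvariant (Suc n) ((tau n ^^ j) v)} K (T (Suc n))" for j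
    by (rule submodule_linear_eq[where W = "TB (Suc n)"]) (simp_all add: linear_simps)
  moreover have "CM K B Y \<rho>Y X act \<rho>X n =
      (\<Inter>j. {v \<in> carrier (T (Suc n)). coinvariant (Suc n) ((tau n ^^ j) v)})"
    unfolding CM_eq by auto
  ultimately show ?thesis
    by (simp only:, intro submodule_Inter) auto
qed

lemma coinvariant_mulT:
  assumes "j < n" "t \<in> carrier (T (Suc n))" "coinvariant (Suc n) t"
  shows "coinvariant n (mulT n j t)"
  using assms coinvariant_image[OF mulT_linear[OF assms(1)] assms(2,3)] by (simp add: coT_mulT)

lemma CM_tau: "v \<in> CM K B Y \<rho>Y X act \<rho>X n \<Longrightarrow> tau n v \<in> CM K B Y \<rho>Y X act \<rho>X n"
  unfolding CM_eq by simp (metis comp_apply funpow.simps(2) funpow_swap1)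

text \<open>A power of \<tau> after an inner face is an inner face after a power of \<tau>, and
  inner faces are colinear, hence preserve coinvariants.\<close>

lemma CM_mulT:
  assumes "j \<le> m" "v \<in> CM K B Y \<rho>Y X act \<rho>X (Suc m)"
  shows "mulT (Suc m) j v \<in> CM K B Y \<rho>Y X act \<rho>X m"
proof -
  have v: "v \<in> carrier (T (Suc (Suc m)))" "\<And>k. coinvariant (Suc (Suc m)) ((tau (Suc m) ^^ k) v)"
    using assms(2) unfolding CM_eq by auto
  have "coinvariant (Suc m) ((tau m ^^ l) (mulT (Suc m) j v))" for l
  proof -
    obtain i k where "i \<le> m" "(tau m ^^ l) (mulT (Suc m) j v) = mulT (Suc m) i ((tau (Suc m) ^^ k) v)"
      using tau_power_mulT[OF assms(1), of l] v(1) by blast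
    then show ?thesis
      using v by (simp add: coinvariant_mulT)
  qed
  then show ?thesis
    using v assms(1) unfolding CM_eq by simp
qed

lemma CM_faceT:
  "\<lbrakk>j \<le> Suc m; v \<in> CM K B Y \<rho>Y X act \<rho>X (Suc m)\<rbrakk> \<Longrightarrow> faceT (Suc m) j v \<in> CM K B Y \<rho>Y X act \<rho>X m"
  unfolding faceT_def by (auto intro: CM_mulT CM_tau)

lemma CM_tau_power:
  assumes "v \<in> CM K B Y \<rho>Y X act \<rho>X n"
  shows "(tau n ^^ Suc n) v = v"
proof -
  have v: "v \<in> carrier (T (Suc n))" "coinvariant (Suc n) v"
    using assms unfolding CM_def PCM_eq commuting_part_def TT_eq by (auto simp: coact_eq_coT)
  then show ?thesis
    by (simp add: tau_power linear_simps actT_one del: funpow.simps)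
qed

lemma cyclic_CM:
  "cyclic K (\<lambda>n. (TT K Y X n)\<lparr>carrier := CM K B Y \<rho>Y X act \<rho>X n\<rparr>)
     (face K Y \<rho>Y X act) (cyc K Y \<rho>Y X act)"
proof -
  let ?C = "CM K B Y \<rho>Y X act \<rho>X"
  have T: "v \<in> carrier (T (Suc n))" if "v \<in> ?C n" for v n
    using that unfolding CM_eq by auto
  have tau: "cyc K Y \<rho>Y X act n v = tau n v" if "v \<in> ?C n" for n v
    using T[OF that] by (rule cyc_eq_tau)
  have pow_in: "(tau n ^^ j) v \<in> ?C n" if "v \<in> ?C n" for n v j
    by (induction j) (use that CM_tau in auto)
  have pow: "(cyc K Y \<rho>Y X act n ^^ j) v = (tau n ^^ j) v" if "v \<in> ?C n" for n v j
    using T[OF that] by (rule cyc_power_eq)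
  have "weak_para_cyclic K (\<lambda>n. (TT K Y X n)\<lparr>carrier := ?C n\<rparr>) (face K Y \<rho>Y X act) (cyc K Y \<rho>Y X act)"
  proof (rule weak_para_cyclic_restrict[OF weak_para_cyclic_T])
    show "submodule (?C n) K (TT K Y X n)" for n
      unfolding TT_eq by (rule CM_submodule)
    show "cyc K Y \<rho>Y X act n v \<in> ?C n" if "v \<in> ?C n" for n v
      using CM_tau[OF that] tau[OF that] by simp
    fix n j v assume *: "1 \<le> n" "j \<le> n" "v \<in> ?C n"
    then obtain m where "n = Suc m" by (cases n) auto
    with * show "face K Y \<rho>Y X act n j v \<in> ?C (n - 1)"
      by (simp add: face_eq_faceT T CM_faceT)
  qed
  \<comment> \<open>Invertibility comes from cyclicity: \<open>tau n ^^ n\<close> is the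
    inverse.\<close>
  moreover have "bij_betw (cyc K Y \<rho>Y X act n) (?C n) (?C n)" for n
    by (rule bij_betw_byWitness[where f' = "tau n ^^ n"])
      (use CM_tau_power[of _ n] CM_tau pow_in in \<open>auto simp: tau simp flip: funpow_swap1\<close>)
  ultimately show ?thesis
    using CM_tau_power unfolding cyclic_def para_cyclic_def by (simp add: pow del: funpow.simps)
qed

end

section \<open>The antipode and the inverse of the cyclic operator\<close>

locale hopf_comodule_data = comodule_data K B \<Delta> \<epsilon> Y \<rho>Y X act \<rho>X
  for K :: "'k ring" (structure)
    and B :: "('k, 'b) module" and \<Delta> :: "'b \<Rightarrow> ('k, 'b, 'b) tens" and \<epsilon> :: "'b \<Rightarrow> 'k"
    and Y :: "('k, 'y) module" and \<rho>Y :: "'y \<Rightarrow> ('k, 'y, 'b) tens"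
    and X :: "('k, 'x) module" and act :: "'b \<Rightarrow> 'x \<Rightarrow> 'x" and \<rho>X :: "'x \<Rightarrow> ('k, 'x, 'b) tens" +
  fixes S :: "'b \<Rightarrow> 'b"
  assumes hopf: "hopf_algebra K B \<Delta> \<epsilon> S" and bij: "bij_betw S (carrier B) (carrier B)"
begin

lemma antipode_linear [simp]: "linear_map K B B S"
  by (rule hopf_algebra.antipode_linear[OF hopf])

lemma antipode_simps [simp]:
  "b \<in> carrier B \<Longrightarrow> S b \<in> carrier B"
  "linear_map K V B f \<Longrightarrow> linear_map K V B (\<lambda>v. S (f v))"
  by (rule linear_closed[OF antipode_linear], assumption)
    (erule linear_compose[OF _ antipode_linear])

abbreviation "BB \<equiv> tensor K B B"

lemma counit_unit_image:
  assumes "linear_map K B N f" "b \<in> carrier B"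
  shows "f (\<epsilon> b \<odot>\<^bsub>B\<^esub> \<one>\<^bsub>B\<^esub>) = \<epsilon> b \<odot>\<^bsub>N\<^esub> f \<one>\<^bsub>B\<^esub>"
  using assms by (simp add: linear_smult[OF assms(1)])

lemma antipode_laws:
  assumes b: "b \<in> carrier B" and f: "linear_map K B N f" and [simp]: "module K N"
  shows antipode_left_law: "bnd B B N (\<Delta> b) (\<lambda>b1 b2. f (S b1 \<otimes>\<^bsub>B\<^esub> b2)) = \<epsilon> b \<odot>\<^bsub>N\<^esub> f \<one>\<^bsub>B\<^esub>"
    and antipode_right_law: "bnd B B N (\<Delta> b) (\<lambda>b1 b2. f (b1 \<otimes>\<^bsub>B\<^esub> S b2)) = \<epsilon> b \<odot>\<^bsub>N\<^esub> f \<one>\<^bsub>B\<^esub>"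
proof -
  have bil: "bilinear B B B (\<lambda>b1 b2. S b1 \<otimes>\<^bsub>B\<^esub> b2)" "bilinear B B B (\<lambda>b1 b2. b1 \<otimes>\<^bsub>B\<^esub> S b2)"
    by (simp_all add: linear_simps)
  have "bnd B B B (\<Delta> b) (\<lambda>b1 b2. S b1 \<otimes>\<^bsub>B\<^esub> b2) = \<epsilon> b \<odot>\<^bsub>B\<^esub> \<one>\<^bsub>B\<^esub>"
    using hopf_algebra.antipode_left[OF hopf b] b
    by (subst (asm) lin_ext_eq_bnd[OF _ _ _ bil(1)]) auto
  moreover have "bnd B B B (\<Delta> b) (\<lambda>b1 b2. b1 \<otimes>\<^bsub>B\<^esub> S b2) = \<epsilon> b \<odot>\<^bsub>B\<^esub> \<one>\<^bsub>B\<^esub>"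
    using hopf_algebra.antipode_right[OF hopf b] b
    by (subst (asm) lin_ext_eq_bnd[OF _ _ _ bil(2)]) auto
  ultimately show "bnd B B N (\<Delta> b) (\<lambda>b1 b2. f (S b1 \<otimes>\<^bsub>B\<^esub> b2)) = \<epsilon> b \<odot>\<^bsub>N\<^esub> f \<one>\<^bsub>B\<^esub>"
    "bnd B B N (\<Delta> b) (\<lambda>b1 b2. f (b1 \<otimes>\<^bsub>B\<^esub> S b2)) = \<epsilon> b \<odot>\<^bsub>N\<^esub> f \<one>\<^bsub>B\<^esub>"
    using linear_image_bnd[OF _ _ _ _ f bil(1), of "\<Delta> b"] linear_image_bnd[OF _ _ _ _ f bil(2), of "\<Delta> b"]
      b counit_unit_image[OF f b] by simp_all
qed

text \<open>Apply the counit to the left antipode law. Sweedler sums take values in a module, which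
  the field is not, so the counit is carried along as a multiple of the unit of B and read off at
  the end.\<close>

lemma counit_antipode:
  assumes b: "b \<in> carrier B"
  shows "\<epsilon> (S b) = \<epsilon> b"
proof -
  let ?f = "\<lambda>b. \<epsilon> b \<odot>\<^bsub>B\<^esub> \<one>\<^bsub>B\<^esub>"
  interpret B: module K B by simp
  have f: "linear_map K B B ?f"
    by (simp add: linear_simps)
  have \<epsilon>: "\<epsilon> (c \<odot>\<^bsub>B\<^esub> \<one>\<^bsub>B\<^esub>) = c" if "c \<in> carrier K" for c
    using that coalgebra.counit_smult[OF coalgebra_B] counit_one by simp
  have "?f (S b) = bnd B B B (\<Delta> b) (\<lambda>b1 b2. \<epsilon> b2 \<odot>\<^bsub>B\<^esub> ?f (S b1))"
    using b by (intro comodule_counit_law[OF right_comodule_self[OF coalgebra_B], symmetric]) simp_all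
  also have "\<dots> = bnd B B B (\<Delta> b) (\<lambda>b1 b2. ?f (S b1 \<otimes>\<^bsub>B\<^esub> b2))"
    by (intro bnd_cong refl) (simp add: counit_mult B.smult_assoc1 m_comm)
  also have "\<dots> = \<epsilon> b \<odot>\<^bsub>B\<^esub> ?f \<one>\<^bsub>B\<^esub>"
    using b f by (intro antipode_left_law) simp_all
  also have "\<dots> = ?f b"
    by (simp only: counit_one B.smult_one algebra_B_simps(4))
  finally show ?thesis
    using \<epsilon> b coalgebra_B_simps(4) antipode_simps(1) by metis
qed

text \<open>The product of B \<otimes> B in Sweedler form, the target algebra of the convolution
  product used to compute \<open>\<Delta>\<close> on antipodes.\<close>

definition mulBB :: "('k, 'b, 'b) tens \<Rightarrow> ('k, 'b, 'b) tens \<Rightarrow> ('k, 'b, 'b) tens" where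
  "mulBB s t = bnd B B BB s (\<lambda>a b. bnd B B BB t (\<lambda>a' b'. pure K B B (a \<otimes>\<^bsub>B\<^esub> a') (b \<otimes>\<^bsub>B\<^esub> b')))"

lemma mulBB_simps [simp]:
  "\<lbrakk>s \<in> carrier BB; t \<in> carrier BB\<rbrakk> \<Longrightarrow> mulBB s t \<in> carrier BB"
  "\<lbrakk>linear_map K V BB f; t \<in> carrier BB\<rbrakk> \<Longrightarrow> linear_map K V BB (\<lambda>v. mulBB (f v) t)"
  "\<lbrakk>linear_map K V BB f; s \<in> carrier BB\<rbrakk> \<Longrightarrow> linear_map K V BB (\<lambda>v. mulBB s (f v))"
proof -
  have "linear_map K BB BB (\<lambda>t. mulBB s t)" if "s \<in> carrier BB"
    unfolding mulBB_def using that by (simp add: linear_simps)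
  then show "\<lbrakk>linear_map K V BB f; s \<in> carrier BB\<rbrakk> \<Longrightarrow> linear_map K V BB (\<lambda>v. mulBB s (f v))"
    by (blast intro: linear_compose)
qed (simp_all add: mulBB_def linear_simps)

lemma mulBB_assoc:
  assumes "s \<in> carrier BB" "t \<in> carrier BB" "u \<in> carrier BB"
  shows "mulBB (mulBB s t) u = mulBB s (mulBB t u)"
  using assms unfolding mulBB_def by (simp add: linear_simps bnd_image_simps)

lemma mulBB_one:
  assumes "s \<in> carrier BB"
  shows "mulBB s (pure K B B \<one>\<^bsub>B\<^esub> \<one>\<^bsub>B\<^esub>) = s" "mulBB (pure K B B \<one>\<^bsub>B\<^esub> \<one>\<^bsub>B\<^esub>) s = s"
  using assms unfolding mulBB_def by (simp_all add: linear_simps bnd_pure_self)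

lemma mulBB_smult:
  assumes "c \<in> carrier K" "s \<in> carrier BB" "t \<in> carrier BB"
  shows "mulBB s (c \<odot>\<^bsub>BB\<^esub> t) = c \<odot>\<^bsub>BB\<^esub> mulBB s t" "mulBB (c \<odot>\<^bsub>BB\<^esub> s) t = c \<odot>\<^bsub>BB\<^esub> mulBB s t"
  by (rule linear_smult[where f = "\<lambda>u. mulBB s u"] linear_smult[where f = "\<lambda>u. mulBB u t"];
      simp add: assms linear_ident)+

lemma mulBB_bnd:
  assumes "t \<in> carrier BB" "bilinear B B BB \<phi>" "s \<in> carrier BB"
  shows "mulBB s (bnd B B BB t \<phi>) = bnd B B BB t (\<lambda>a b. mulBB s (\<phi> a b))"
    and "mulBB (bnd B B BB t \<phi>) s = bnd B B BB t (\<lambda>a b. mulBB (\<phi> a b) s)"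
  by (rule linear_image_bnd[where g = "\<lambda>u. mulBB s u"] linear_image_bnd[where g = "\<lambda>u. mulBB u s"];
      simp add: assms linear_ident)+

lemmas comult_coassoc = comodule_coassoc_law[OF right_comodule_self[OF coalgebra_B]]
lemmas comult_counit = comodule_counit_law[OF right_comodule_self[OF coalgebra_B]]

text \<open>Both \<open>\<Delta> \<circ> S\<close> and \<open>b \<mapsto> S b\<^sub>2 \<otimes> S b\<^sub>1\<close> are convolution inverse to \<open>\<Delta>\<close>.\<close>

lemma comult_antipode:
  assumes b: "b \<in> carrier B"
  shows "\<Delta> (S b) = bnd B B BB (\<Delta> b) (\<lambda>b1 b2. pure K B B (S b2) (S b1))"
proof -
  define G where "G = (\<lambda>b. bnd B B BB (\<Delta> b) (\<lambda>b1 b2. pure K B B (S b2) (S b1)))"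
  let ?I = "pure K B B \<one>\<^bsub>B\<^esub> \<one>\<^bsub>B\<^esub>"
  have G: "linear_map K B BB G" 
    unfolding G_def by (simp add: linear_simps)
  note [simp] = linear_closed[OF G] linear_compose[OF _ G]
  have left: "bnd B B BB (\<Delta> c) (\<lambda>c1 c2. mulBB (\<Delta> (S c1)) (\<Delta> c2)) = \<epsilon> c \<odot>\<^bsub>BB\<^esub> ?I"
    if "c \<in> carrier B" for c
  proof -
    have "bnd B B BB (\<Delta> c) (\<lambda>c1 c2. mulBB (\<Delta> (S c1)) (\<Delta> c2)) = bnd B B BB (\<Delta> c) (\<lambda>c1 c2. \<Delta> (S c1 \<otimes>\<^bsub>B\<^esub> c2))"
      by (intro bnd_cong refl) (simp add: comult_mult mulBB_def)
    also have "\<dots> = \<epsilon> c \<odot>\<^bsub>BB\<^esub> \<Delta> \<one>\<^bsub>B\<^esub>"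
      using that by (intro antipode_left_law) simp_all
    finally show ?thesis
      by (simp add: comult_one)
  qed
  have right: "bnd B B BB (\<Delta> c) (\<lambda>c1 c2. mulBB (\<Delta> c1) (G c2)) = \<epsilon> c \<odot>\<^bsub>BB\<^esub> ?I"
    if c: "c \<in> carrier B" for c
  proof -
    \<comment> \<open>Coassociativity makes d1 and the antipode next to it the two legs of one
      element, so that they cancel; the factor with \<open>a\<close> is not involved.\<close>
    have inner: "bnd B B BB (\<Delta> d) (\<lambda>d1 d2. bnd B B BB (\<Delta> d2) (\<lambda>e1 e2. pure K B B (a \<otimes>\<^bsub>B\<^esub> S e2) (d1 \<otimes>\<^bsub>B\<^esub> S e1))) =
        pure K B B (a \<otimes>\<^bsub>B\<^esub> S d) \<one>\<^bsub>B\<^esub>" if "a \<in> carrier B" "d \<in> carrier B" for a d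
    proof -
      have "bnd B B BB (\<Delta> d) (\<lambda>d1 d2. bnd B B BB (\<Delta> d2) (\<lambda>e1 e2. pure K B B (a \<otimes>\<^bsub>B\<^esub> S e2) (d1 \<otimes>\<^bsub>B\<^esub> S e1))) =
          bnd B B BB (\<Delta> d) (\<lambda>d1 d2. bnd B B BB (\<Delta> d1) (\<lambda>e1 e2. pure K B B (a \<otimes>\<^bsub>B\<^esub> S d2) (e1 \<otimes>\<^bsub>B\<^esub> S e2)))"
        using that by (intro comult_coassoc[symmetric]) (simp_all add: linear_simps)
      also have "\<dots> = bnd B B BB (\<Delta> d) (\<lambda>d1 d2. \<epsilon> d1 \<odot>\<^bsub>BB\<^esub> pure K B B (a \<otimes>\<^bsub>B\<^esub> S d2) \<one>\<^bsub>B\<^esub>)"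
        using that by (intro bnd_cong refl antipode_right_law) (simp_all add: linear_simps)
      also have "\<dots> = pure K B B (a \<otimes>\<^bsub>B\<^esub> S d) \<one>\<^bsub>B\<^esub>"
        using that by (intro counit_law_left[OF coalgebra_B]) (simp_all add: linear_simps)
      finally show ?thesis .
    qed
    have "bnd B B BB (\<Delta> c) (\<lambda>c1 c2. mulBB (\<Delta> c1) (G c2)) =
        bnd B B BB (\<Delta> c) (\<lambda>c1 c2. bnd B B BB (\<Delta> c1) (\<lambda>a d1. bnd B B BB (\<Delta> c2) (\<lambda>e1 e2. pure K B B (a \<otimes>\<^bsub>B\<^esub> S e2) (d1 \<otimes>\<^bsub>B\<^esub> S e1))))"
      unfolding mulBB_def G_def
      by (rule bnd_cong[OF refl refl refl refl]) (simp add: linear_simps bnd_image_simps)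
    also have "\<dots> = bnd B B BB (\<Delta> c) (\<lambda>a d. bnd B B BB (\<Delta> d) (\<lambda>d1 d2. bnd B B BB (\<Delta> d2) (\<lambda>e1 e2. pure K B B (a \<otimes>\<^bsub>B\<^esub> S e2) (d1 \<otimes>\<^bsub>B\<^esub> S e1))))"
      using c by (intro comult_coassoc) (simp_all add: linear_simps)
    also have "\<dots> = bnd B B BB (\<Delta> c) (\<lambda>a d. pure K B B (a \<otimes>\<^bsub>B\<^esub> S d) \<one>\<^bsub>B\<^esub>)"
      by (intro bnd_cong refl inner)
    also have "\<dots> = \<epsilon> c \<odot>\<^bsub>BB\<^esub> ?I"
      using c by (intro antipode_right_law) (simp_all add: linear_simps)
    finally show ?thesis .
  qed
  have "\<Delta> (S b) = bnd B B BB (\<Delta> b) (\<lambda>b1 b2. \<epsilon> b2 \<odot>\<^bsub>BB\<^esub> \<Delta> (S b1))"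
    using b by (intro comult_counit[symmetric]) (simp_all add: linear_ident)
  also have "\<dots> = bnd B B BB (\<Delta> b) (\<lambda>b1 b2. mulBB (\<Delta> (S b1)) (\<epsilon> b2 \<odot>\<^bsub>BB\<^esub> ?I))"
    by (intro bnd_cong refl) (simp add: mulBB_smult mulBB_one)
  also have "\<dots> = bnd B B BB (\<Delta> b) (\<lambda>b1 b2. mulBB (\<Delta> (S b1)) (bnd B B BB (\<Delta> b2) (\<lambda>c1 c2. mulBB (\<Delta> c1) (G c2))))"
    by (intro bnd_cong refl) (simp add: right)
  also have "\<dots> = bnd B B BB (\<Delta> b) (\<lambda>b1 b2. bnd B B BB (\<Delta> b2) (\<lambda>c1 c2. mulBB (mulBB (\<Delta> (S b1)) (\<Delta> c1)) (G c2)))"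
    by (intro bnd_cong refl) (simp add: mulBB_bnd mulBB_assoc linear_simps)
  \<comment> \<open>The usual uniqueness argument for inverses: after associativity in B \<otimes>
    B, coassociativity regroups the three legs so that the left inverse cancels.\<close>
  also have "\<dots> = bnd B B BB (\<Delta> b) (\<lambda>b1 b2. bnd B B BB (\<Delta> b1) (\<lambda>c1 c2. mulBB (mulBB (\<Delta> (S c1)) (\<Delta> c2)) (G b2)))"
    using b by (intro comult_coassoc[symmetric]) (simp_all add: linear_simps)
  also have "\<dots> = bnd B B BB (\<Delta> b) (\<lambda>b1 b2. mulBB (bnd B B BB (\<Delta> b1) (\<lambda>c1 c2. mulBB (\<Delta> (S c1)) (\<Delta> c2))) (G b2))"
    by (intro bnd_cong refl) (simp add: mulBB_bnd linear_simps)
  also have "\<dots> = bnd B B BB (\<Delta> b) (\<lambda>b1 b2. \<epsilon> b1 \<odot>\<^bsub>BB\<^esub> G b2)"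
    by (intro bnd_cong refl) (simp add: left mulBB_smult mulBB_one)
  also have "\<dots> = G b"
    by (rule counit_law_left[OF coalgebra_B b G]) simp
  finally show ?thesis
    unfolding G_def .
qed

abbreviation "Sinv \<equiv> inv_into (carrier B) S"

lemma Sinv_simps [simp]:
  assumes "b \<in> carrier B"
  shows "Sinv b \<in> carrier B" "S (Sinv b) = b" "Sinv (S b) = b"
  using assms bij bij_betw_inv_into_left[OF bij] bij_betw_inv_into_right[OF bij]
    bij_betwE[OF bij_betw_inv_into[OF bij]] by auto

lemma Sinv_linear [simp]: "linear_map K B B Sinv"
proof (rule linearI)
  note inj = inj_onD[OF bij_betw_imp_inj_on[OF bij]]
  fix x assume x: "x \<in> carrier B"
  show "Sinv (x \<oplus>\<^bsub>B\<^esub> y) = Sinv x \<oplus>\<^bsub>B\<^esub> Sinv y" if "y \<in> carrier B" for y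
    by (rule inj) (use x that in \<open>simp_all add: linear_add[OF antipode_linear]\<close>)
  show "Sinv (c \<odot>\<^bsub>B\<^esub> x) = c \<odot>\<^bsub>B\<^esub> Sinv x" if "c \<in> carrier K" for c
    by (rule inj) (use x that in \<open>simp_all add: linear_smult[OF antipode_linear]\<close>)
qed simp

lemma linear_Sinv [simp]: "linear_map K V B f \<Longrightarrow> linear_map K V B (\<lambda>v. Sinv (f v))"
  by (erule linear_compose[OF _ Sinv_linear])

lemma counit_Sinv: "b \<in> carrier B \<Longrightarrow> \<epsilon> (Sinv b) = \<epsilon> b"
  using counit_antipode[of "Sinv b"] by simp

text \<open>Evaluate \<open>comult_antipode\<close> at \<open>Sinv b\<close> and apply
  \<open>Sinv\<close> to both legs with a flip; the antipodes cancel and \<Delta>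
  (\<open>Sinv b\<close>) is left.\<close>

lemma comult_Sinv:
  assumes "b \<in> carrier B"
  shows "\<Delta> (Sinv b) = bnd B B BB (\<Delta> b) (\<lambda>b1 b2. pure K B B (Sinv b2) (Sinv b1))"
proof -
  have "bnd B B BB (\<Delta> (S (Sinv b))) (\<lambda>b1 b2. pure K B B (Sinv b2) (Sinv b1)) =
      bnd B B BB (\<Delta> (Sinv b)) (\<lambda>b1 b2. pure K B B b1 b2)"
    using assms by (subst comult_antipode) (simp_all add: linear_simps bnd_image_simps)
  then show ?thesis
    using assms by (simp add: bnd_pure_self)
qed

section \<open>The left module-comodule obtained from X by the inverse antipode\<close>

abbreviation "\<kappa> \<equiv> op_coaction K B S X \<rho>X"

lemma op_coaction_eq:
  "x \<in> carrier X \<Longrightarrow> \<kappa> x = bnd X B (tensor K B X) (\<rho>X x) (\<lambda>x0 x1. pure K B X (Sinv x1) x0)"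
  unfolding op_coaction_def by (rule lin_ext_eq_bnd) (simp_all add: linear_simps)

lemma op_coaction_linear: "linear_map K X (tensor K B X) \<kappa>"
proof -
  have "linear_map K X (tensor K B X) (\<lambda>x. bnd X B (tensor K B X) (\<rho>X x) (\<lambda>x0 x1. pure K B X (Sinv x1) x0))"
    by (simp add: linear_simps)
  from linear_cong[OF this] show ?thesis
    by (simp add: op_coaction_eq)
qed

lemma op_coaction_bnd:
  assumes "x \<in> carrier X" "module K N" "bilinear B X N \<phi>"
  shows "bnd B X N (\<kappa> x) \<phi> = bnd X B N (\<rho>X x) (\<lambda>x0 x1. \<phi> (Sinv x1) x0)"
  using assms by (simp add: op_coaction_eq linear_simps bnd_image_simps)

text \<open>The inverse antipode reverses the coproduct, which is what turns a right coaction into a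
  left one.\<close>

lemma left_comodule_op: "left_comodule K B \<Delta> \<epsilon> X \<kappa>"
proof -
  let ?BX = "tensor K B X" and ?N = "tensor K B (tensor K B X)"
  note [simp] = linear_closed[OF op_coaction_linear] linear_compose[OF _ op_coaction_linear]
  interpret coalgebra K B \<Delta> \<epsilon> by (rule coalgebra_B)
  interpret X: module K X by simp
  show ?thesis
  proof unfold_locales
    show "linear_map K X (tensor K B X) \<kappa>"
      by (rule op_coaction_linear)
    fix m assume m: "m \<in> carrier X"
    let ?\<phi> = "\<lambda>x0 b1 b2. pure K B ?BX (Sinv b2) (pure K B X (Sinv b1) x0)"
    have "tensor_map K BB X \<Delta> id (\<kappa> m) = bnd X B (tensor K BB X) (\<rho>X m) (\<lambda>x0 x1. pure K BB X (\<Delta> (Sinv x1)) x0)"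
      using m by (simp add: tensor_map_eq_bnd[where V = B and W = X] linear_ident coalgebra_B_simps(1) op_coaction_bnd linear_simps)
    also have "tensor_assoc K B B X \<dots> = bnd X B ?N (\<rho>X m) (\<lambda>x0 x1. bnd B B ?N (\<Delta> (Sinv x1)) (\<lambda>u v. pure K B ?BX u (pure K B X v x0)))"
      using m by (subst tensor_assoc_eq_bnd) (simp_all add: linear_simps bnd_image_simps)
    also have "\<dots> = bnd X B ?N (\<rho>X m) (\<lambda>x0 x1. bnd B B ?N (\<Delta> x1) (\<lambda>b1 b2. ?\<phi> x0 b1 b2))"
      by (rule bnd_cong[OF refl refl refl refl]) (simp add: comult_Sinv linear_simps bnd_image_simps)
    also have "\<dots> = bnd X B ?N (\<rho>X m) (\<lambda>x0 b2. bnd X B ?N (\<rho>X x0) (\<lambda>x00 b1. ?\<phi> x00 b1 b2))"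
      using m by (intro comodule_coassoc_law[OF right_comodule, symmetric]) (simp_all add: linear_simps)
    also have "\<dots> = bnd X B ?N (\<rho>X m) (\<lambda>x0 b. pure K B ?BX (Sinv b) (\<kappa> x0))"
      by (rule bnd_cong[OF refl refl refl refl]) (simp add: op_coaction_eq linear_simps bnd_image_simps)
    also have "\<dots> = tensor_map K B ?BX id \<kappa> (\<kappa> m)"
      using m op_coaction_linear
      by (simp add: tensor_map_eq_bnd[where V = B and W = X] linear_ident op_coaction_bnd linear_simps)
    finally show "tensor_assoc K B B X (tensor_map K BB X \<Delta> id (\<kappa> m)) = tensor_map K B ?BX id \<kappa> (\<kappa> m)" .
    have bil: "bilinear B X X (\<lambda>b m0. \<epsilon> b \<odot>\<^bsub>X\<^esub> m0)"
      by (simp add: linear_simps)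
    have "lin_ext K X (\<lambda>(b, m0). \<epsilon> b \<odot>\<^bsub>X\<^esub> m0) (\<kappa> m) = bnd B X X (\<kappa> m) (\<lambda>b m0. \<epsilon> b \<odot>\<^bsub>X\<^esub> m0)"
      using m bil by (intro lin_ext_eq_bnd) simp_all
    also have "\<dots> = bnd X B X (\<rho>X m) (\<lambda>x0 b. \<epsilon> b \<odot>\<^bsub>X\<^esub> x0)"
      using m bil by (simp add: op_coaction_bnd counit_Sinv)
    also have "\<dots> = m"
      using m by (intro comodule_counit_law[OF right_comodule _ linear_ident(1)]) simp_all
    finally show "lin_ext K X (\<lambda>(b, m0). \<epsilon> b \<odot>\<^bsub>X\<^esub> m0) (\<kappa> m) = m" .
  qed
qed

text \<open>\<open>S\<close> cancels the inverse antipode in the coaction, leaving the stability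
  condition on X.\<close>

lemma one_stable_op: "one_stable K B \<Delta> \<epsilon> S X act \<kappa>"
proof -
  interpret hopf_algebra K B \<Delta> \<epsilon> S by (rule hopf)
  interpret left_module K B X act by (rule left_module)
  interpret left_comodule K B \<Delta> \<epsilon> X \<kappa> by (rule left_comodule_op)
  show ?thesis
  proof unfold_locales
    fix x assume x: "x \<in> carrier X"
    have bil: "bilinear B X X (\<lambda>b x0. act (S b) x0)"
      by (simp add: linear_simps)
    have "lin_ext K X (\<lambda>(b, x0). act (S b) x0) (\<kappa> x) = bnd B X X (\<kappa> x) (\<lambda>b x0. act (S b) x0)"
      using x bil by (intro lin_ext_eq_bnd) (simp_all add: linear_closed[OF op_coaction_linear])
    also have "\<dots> = bnd X B X (\<rho>X x) (\<lambda>x0 x1. act x1 x0)"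
      using x bil by (simp add: op_coaction_bnd)
    finally show "lin_ext K X (\<lambda>(b, x0). act (S b) x0) (\<kappa> x) = x"
      using x by (simp add: stable_bnd)
  qed
qed

lemma coact_left_eq_coT:
  assumes "t \<in> carrier (T (Suc n))"
  shows "coact_left K B S Y \<rho>Y X \<kappa> n t = coT (Suc n) t"
  unfolding coact_left_def coT_def Let_def TT_def
proof (simp, rule lin_ext_mtens_cong)
  fix ys :: "'y list" and x
  assume *: "set ys \<subseteq> carrier Y" "length ys = Suc n" "x \<in> carrier X"
  show "sweedler_list K B (TB (Suc n)) \<rho>Y (\<lambda>zs b. lin_ext K (TB (Suc n))
      (\<lambda>(xm1, x0). pure K (T (Suc n)) B (mpure K Y X (Suc n) zs x0) (b \<otimes>\<^bsub>B\<^esub> S xm1)) (\<kappa> x)) ys =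
      coact_pure ys x"
  proof (rule sweedler_list_coact_pure[where L = "\<lambda>u. u"])
    fix zs b assume zs: "set zs \<subseteq> carrier Y" "length zs = length ys" "b \<in> carrier B"
    have bil: "bilinear B X (TB (Suc n)) (\<lambda>xm1 x0. pure K (T (Suc n)) B (mpure K Y X (Suc n) zs x0) (b \<otimes>\<^bsub>B\<^esub> S xm1))"
      using zs * by (simp add: linear_simps)
    have "lin_ext K (TB (Suc n))
      (\<lambda>(xm1, x0). pure K (T (Suc n)) B (mpure K Y X (Suc n) zs x0) (b \<otimes>\<^bsub>B\<^esub> S xm1)) (\<kappa> x) =
      bnd B X (TB (Suc n)) (\<kappa> x) (\<lambda>xm1 x0. pure K (T (Suc n)) B (mpure K Y X (Suc n) zs x0) (b \<otimes>\<^bsub>B\<^esub> S xm1))"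
      using * bil by (intro lin_ext_eq_bnd) (simp_all add: linear_closed[OF op_coaction_linear])
    then show "lin_ext K (TB (Suc n))
      (\<lambda>(xm1, x0). pure K (T (Suc n)) B (mpure K Y X (Suc n) zs x0) (b \<otimes>\<^bsub>B\<^esub> S xm1)) (\<kappa> x) =
      bnd X B (TB (length ys)) (\<rho>X x)
        (\<lambda>x0 x1. pure K (T (length ys)) B (mpure K Y X (length ys) zs x0) (b \<otimes>\<^bsub>B\<^esub> x1))"
      using * bil by (simp add: op_coaction_bnd)
  qed (use * in \<open>auto simp: linear_ident\<close>)
qed (use assms in \<open>auto intro: coact_pure_multilinear\<close>)

section \<open>The inverse of the cyclic operator\<close>

lemma linear_mpure_snoc:
  assumes "set ys \<subseteq> carrier Y" "length ys = n" "x \<in> carrier X" "linear_map K V Y f"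
  shows "linear_map K V (T (Suc n)) (\<lambda>v. mpure K Y X (Suc n) (ys @ [f v]) x)"
proof -
  have "linear_map K Y (T (Suc n)) (\<lambda>y. mpure K Y X (Suc n) ((ys @ [\<zero>\<^bsub>Y\<^esub>])[n := y]) x)"
    using assms by (intro multilinearD(2)[OF mpure_multilinear]) auto
  with assms show ?thesis
    by (auto simp: list_update_append intro: linear_compose[OF assms(4)])
qed

definition cyc_inv_pure :: "nat \<Rightarrow> 'y list \<Rightarrow> 'x \<Rightarrow> ('k, 'y, 'x) mtens" where
  "cyc_inv_pure n ys x = bnd Y B (T (Suc n)) (\<rho>Y (hd ys))
     (\<lambda>y0 y1. mpure K Y X (Suc n) (tl ys @ [y0]) (act (S y1) x))"

lemma cyc_inv_pure_multilinear: "multilinear Y X (T (Suc n)) (Suc n) (cyc_inv_pure n)"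
proof (rule multilinearI)
  fix ys :: "'y list" assume "set ys \<subseteq> carrier Y" "length ys = Suc n"
  then obtain z zs where ys: "ys = z # zs" "set zs \<subseteq> carrier Y" "length zs = n" "z \<in> carrier Y"
    by (cases ys) auto
  show "linear_map K X (T (Suc n)) (\<lambda>x. cyc_inv_pure n ys x)"
    unfolding cyc_inv_pure_def using ys by (simp add: linear_simps linear_mpure_snoc)
  fix i x assume i: "i < Suc n" "x \<in> carrier X"
  show "linear_map K Y (T (Suc n)) (\<lambda>y. cyc_inv_pure n (ys[i := y]) x)"
  proof (cases i)
    case 0
    with i ys show ?thesis
      unfolding cyc_inv_pure_def by (simp add: linear_simps linear_mpure_snoc)
  next
    case (Suc k)
    have "linear_map K Y (T (Suc n)) (\<lambda>y. mpure K Y X (Suc n) (zs[k := y] @ [y0]) x')"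
      if "y0 \<in> carrier Y" "x' \<in> carrier X" for y0 x'
      using multilinearD(2)[OF mpure_multilinear, of Y X "zs @ [y0]" "Suc n" k x'] i Suc ys that
      by (simp add: list_update_append)
    with i Suc ys show ?thesis
      unfolding cyc_inv_pure_def by (simp add: linear_simps linear_mpure_snoc)
  qed
qed

definition tau_inv :: "nat \<Rightarrow> ('k, 'y, 'x) mtens \<Rightarrow> ('k, 'y, 'x) mtens" where
  "tau_inv n = lin_ext K (T (Suc n)) (\<lambda>(ys, x). cyc_inv_pure n ys x)"

lemma tau_inv_linear: "linear_map K (T (Suc n)) (T (Suc n)) (tau_inv n)"
  unfolding tau_inv_def by (rule multilinear_lift) (auto intro: cyc_inv_pure_multilinear)

lemma tau_inv_mpure:
  "\<lbrakk>set ys \<subseteq> carrier Y; length ys = n; x \<in> carrier X; y \<in> carrier Y\<rbrakk> \<Longrightarrow>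
    tau_inv n (mpure K Y X (Suc n) (y # ys) x) =
    bnd Y B (T (Suc n)) (\<rho>Y y) (\<lambda>y0 y1. mpure K Y X (Suc n) (ys @ [y0]) (act (S y1) x))"
  unfolding tau_inv_def by (subst multilinear_lift(2)) (auto intro: cyc_inv_pure_multilinear simp: cyc_inv_pure_def)

lemma tau_inv_closed [simp]: "t \<in> carrier (T (Suc n)) \<Longrightarrow> tau_inv n t \<in> carrier (T (Suc n))"
  by (rule linear_closed[OF tau_inv_linear])

lemma linear_tau_inv [simp]:
  "linear_map K V (T (Suc n)) f \<Longrightarrow> linear_map K V (T (Suc n)) (\<lambda>v. tau_inv n (f v))"
  by (erule linear_compose[OF _ tau_inv_linear])

text \<open>Moving a factor to the end and back leaves y_(0)(0) with coefficient y_(0)(1) S(y_(1))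
  on x. Coassociativity turns this into the two legs of one coefficient, and the right antipode law
  removes it.\<close>

lemma tau_tau_inv:
  assumes "t \<in> carrier (T (Suc n))"
  shows "tau n (tau_inv n t) = t"
proof (rule mtens_ext[OF _ _ assms, where M = "T (Suc n)" and g = "\<lambda>t. t"])
  fix ys :: "'y list" and x assume "set ys \<subseteq> carrier Y" "length ys = Suc n" and x: "x \<in> carrier X"
  then obtain z zs where ys: "ys = z # zs" "set zs \<subseteq> carrier Y" "length zs = n" "z \<in> carrier Y"
    by (cases ys) auto
  let ?N = "T (Suc n)" and ?f = "\<lambda>y b. tcons Y X n y (mpure K Y X n zs (act b x))"
  have f: "linear_map K B ?N (?f y)" if "y \<in> carrier Y" for y
    using ys x that by (simp add: linear_simps)
  have "tau n (tau_inv n (mpure K Y X (Suc n) ys x)) =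
      bnd Y B ?N (\<rho>Y z) (\<lambda>y0 y1. bnd Y B ?N (\<rho>Y y0) (\<lambda>y00 y01. ?f y00 (y01 \<otimes>\<^bsub>B\<^esub> S y1)))"
    using ys x by (simp add: tau_inv_mpure tau_bnd linear_simps linear_mpure_snoc tau_mpure)
  also have "\<dots> = bnd Y B ?N (\<rho>Y z) (\<lambda>y0 b. bnd B B ?N (\<Delta> b) (\<lambda>b1 b2. ?f y0 (b1 \<otimes>\<^bsub>B\<^esub> S b2)))"
    using ys x by (intro comodule_coassoc_law[OF comodule_Y]) (simp_all add: linear_simps)
  also have "\<dots> = bnd Y B ?N (\<rho>Y z) (\<lambda>y0 b. \<epsilon> b \<odot>\<^bsub>?N\<^esub> ?f y0 \<one>\<^bsub>B\<^esub>)"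
    by (intro bnd_cong refl antipode_right_law f) simp_all
  also have "\<dots> = ?f z \<one>\<^bsub>B\<^esub>"
    using ys x by (intro comodule_counit_law[OF comodule_Y]) (simp_all add: linear_simps)
  finally show "tau n (tau_inv n (mpure K Y X (Suc n) ys x)) = mpure K Y X (Suc n) ys x"
    using ys x by (simp add: mpure_Cons)
qed (simp_all add: linear_simps)

text \<open>In this order the inverse acts second, so its antipode stands on the left and the left
  antipode law applies.\<close>

lemma tau_inv_tau:
  assumes "t \<in> carrier (T (Suc n))"
  shows "tau_inv n (tau n t) = t"
proof (rule mtens_snoc_ext[OF assms, where M = "T (Suc n)" and g = "\<lambda>t. t"])
  fix ys :: "'y list" and z x
  assume *: "set ys \<subseteq> carrier Y" "length ys = n" "z \<in> carrier Y" "x \<in> carrier X"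
  let ?N = "T (Suc n)" and ?f = "\<lambda>y b. mpure K Y X (Suc n) (ys @ [y]) (act b x)"
  have f: "linear_map K B ?N (?f y)" if "y \<in> carrier Y" for y
    using * that by (simp add: linear_simps)
  have "tau_inv n (tau n (mpure K Y X (Suc n) (ys @ [z]) x)) =
      bnd Y B ?N (\<rho>Y z) (\<lambda>y0 y1. tau_inv n (tcons Y X n y0 (mpure K Y X n ys (act y1 x))))"
    using * by (simp add: tau_mpure, intro linear_image_bnd) (simp_all add: linear_simps)
  also have "\<dots> = bnd Y B ?N (\<rho>Y z) (\<lambda>y0 y1. bnd Y B ?N (\<rho>Y y0) (\<lambda>y00 y01. ?f y00 (S y01 \<otimes>\<^bsub>B\<^esub> y1)))"
    using * by (simp add: tcons_mpure tau_inv_mpure)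
  also have "\<dots> = bnd Y B ?N (\<rho>Y z) (\<lambda>y0 b. bnd B B ?N (\<Delta> b) (\<lambda>b1 b2. ?f y0 (S b1 \<otimes>\<^bsub>B\<^esub> b2)))"
    using * by (intro comodule_coassoc_law[OF comodule_Y]) (simp_all add: linear_simps linear_mpure_snoc)
  also have "\<dots> = bnd Y B ?N (\<rho>Y z) (\<lambda>y0 b. \<epsilon> b \<odot>\<^bsub>?N\<^esub> ?f y0 \<one>\<^bsub>B\<^esub>)"
    by (intro bnd_cong refl antipode_left_law f) simp_all
  also have "\<dots> = ?f z \<one>\<^bsub>B\<^esub>"
    using * by (intro comodule_counit_law[OF comodule_Y]) (simp_all add: linear_simps linear_mpure_snoc)
  finally show "tau_inv n (tau n (mpure K Y X (Suc n) (ys @ [z]) x)) = mpure K Y X (Suc n) (ys @ [z]) x"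
    using * by simp
qed (simp_all add: linear_simps)

lemma tau_bij: "bij_betw (tau n) (carrier (T (Suc n))) (carrier (T (Suc n)))"
  by (rule bij_betw_byWitness[where f' = "tau_inv n"]) (auto simp: tau_tau_inv tau_inv_tau)

lemma para_cyclic_T: "para_cyclic K (TT K Y X) (face K Y \<rho>Y X act) (cyc K Y \<rho>Y X act)"
  using weak_para_cyclic_T tau_bij bij_betw_cong[of _ "cyc K Y \<rho>Y X act _" "tau _"] unfolding para_cyclic_def TT_eq
  by (metis cyc_eq_tau)

end

section \<open>Restriction to the para-cyclic comodule\<close>

context linear_algebra
begin

text \<open>The coaction defined through the left comodule is identified with \<open>coT\<close> on
  the carrier only.\<close>

lemma right_comodule_cong:
  assumes com: "right_comodule K B \<Delta> \<epsilon> M \<rho>" and eq: "\<And>v. v \<in> carrier M \<Longrightarrow> \<rho>' v = \<rho> v"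
  shows "right_comodule K B \<Delta> \<epsilon> M \<rho>'"
proof -
  interpret right_comodule K B \<Delta> \<epsilon> M \<rho> by (rule com)
  have lin: "linear_map K M (tensor K M B) \<rho>'"
    by (rule linear_cong[OF coact_linear M.module_axioms eq])
  note laws = comodule_coassoc_bnd[OF coalgebra_axioms M.module_axioms]
  show ?thesis
  proof (rule right_comoduleI[OF coalgebra_axioms M.module_axioms lin])
    fix m assume m: "m \<in> carrier M"
    let ?N = "tensor K M (tensor K B B)"
    have "bnd M B ?N (\<rho>' m) (\<lambda>m0 b. bnd M B ?N (\<rho>' m0) (\<lambda>m00 b1. pure K M (tensor K B B) m00 (pure K B B b1 b))) =
        bnd M B ?N (\<rho> m) (\<lambda>m0 b. bnd M B ?N (\<rho> m0) (\<lambda>m00 b1. pure K M (tensor K B B) m00 (pure K B B b1 b)))"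
      by (simp add: eq m)
    then show "bnd M B ?N (\<rho>' m) (\<lambda>m0 b. bnd M B ?N (\<rho>' m0) (\<lambda>m00 b1. pure K M (tensor K B B) m00 (pure K B B b1 b))) =
        bnd M B ?N (\<rho>' m) (\<lambda>m0 b. pure K M (tensor K B B) m0 (\<Delta> b))"
      using coact_coassoc[OF m] laws[OF coact_linear m] by (simp add: eq m)
    show "bnd M B M (\<rho>' m) (\<lambda>m0 b. \<epsilon> b \<odot>\<^bsub>M\<^esub> m0) = m"
      using comodule_counit_law[OF com m linear_ident(1) M.module_axioms] by (simp add: eq m)
  qed
qed

text \<open>Here g itself need not be colinear. It is enough that each h \<circ> g factors as a
  colinear c after some h' in \<open>HM\<close>: at v the coaction commutes with h' by assumption
  and with c everywhere. The identity is included among the h to obtain colinearity of g at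
  v.\<close>

lemma commuting_part_image:
  assumes M: "right_comodule K B \<Delta> \<epsilon> M \<rho>M" and N: "right_comodule K B \<Delta> \<epsilon> N \<rho>N"
    and HM: "\<And>h. h \<in> HM \<Longrightarrow> linear_map K M M h" and HN: "\<And>h. h \<in> HN \<Longrightarrow> linear_map K N N h"
    and g: "linear_map K M N g"
    and factor: "\<And>h. h \<in> insert (\<lambda>v. v) HN \<Longrightarrow> \<exists>c h'. linear_map K M N c \<and>
      (\<forall>v\<in>carrier M. \<rho>N (c v) = bnd M B (tensor K N B) (\<rho>M v) (\<lambda>m b. pure K N B (c m) b)) \<and>
      h' \<in> HM \<and> (\<forall>v\<in>carrier M. h (g v) = c (h' v))"
    and v: "v \<in> commuting_part B M \<rho>M HM"
  shows "g v \<in> commuting_part B N \<rho>N HN"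
    and "\<rho>N (g v) = bnd M B (tensor K N B) (\<rho>M v) (\<lambda>m b. pure K N B (g m) b)"
proof -
  note [simp] = coalgebra_facts(1)[OF right_comodule_facts(1)[OF M]] right_comodule_facts(2-)[OF M] right_comodule_facts(2-)[OF N]
  have vM [simp]: "v \<in> carrier M" and com: "\<And>h. h \<in> HM \<Longrightarrow>
      \<rho>M (h v) = bnd M B (tensor K M B) (\<rho>M v) (\<lambda>m b. pure K M B (h m) b)"
    using v unfolding commuting_part_def by auto
  have eq: "\<rho>N (h (g v)) = bnd M B (tensor K N B) (\<rho>M v) (\<lambda>m b. pure K N B (h (g m)) b)"
    if h: "h \<in> insert (\<lambda>v. v) HN" for h
  proof -
    obtain c h' where c: "linear_map K M N c"
      "\<forall>v\<in>carrier M. \<rho>N (c v) = bnd M B (tensor K N B) (\<rho>M v) (\<lambda>m b. pure K N B (c m) b)"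
      and h': "h' \<in> HM" "\<forall>v\<in>carrier M. h (g v) = c (h' v)"
      using factor[OF h] by blast
    note [simp] = linear_closed[OF HM[OF h'(1)]] linear_closed[OF c(1)] HM[OF h'(1)] c(1) linear_compose[OF _ c(1)]
    have "\<rho>N (h (g v)) = bnd M B (tensor K N B) (bnd M B (tensor K M B) (\<rho>M v) (\<lambda>m b. pure K M B (h' m) b)) (\<lambda>m b. pure K N B (c m) b)"
      using h' c by (simp add: com)
    also have "\<dots> = bnd M B (tensor K N B) (\<rho>M v) (\<lambda>m b. pure K N B (c (h' m)) b)"
      by (simp add: bnd_image_simps linear_simps)
    also have "\<dots> = bnd M B (tensor K N B) (\<rho>M v) (\<lambda>m b. pure K N B (h (g m)) b)"
      using h'(2) by (intro bnd_cong refl) simp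
    finally show ?thesis .
  qed
  note [simp] = linear_closed[OF g] g
  show *: "\<rho>N (g v) = bnd M B (tensor K N B) (\<rho>M v) (\<lambda>m b. pure K N B (g m) b)"
    using eq[of "\<lambda>v. v"] by simp
  have "\<rho>N (h (g v)) = bnd N B (tensor K N B) (\<rho>N (g v)) (\<lambda>m b. pure K N B (h m) b)" if "h \<in> HN" for h
    using HN[OF that] linear_closed[OF HN[OF that]]
    unfolding * eq[OF insertI2[OF that]] by (simp add: bnd_image_simps linear_simps)
  then show "g v \<in> commuting_part B N \<rho>N HN"
    unfolding commuting_part_def by simp
qed

text \<open>Colinearity is asked for at the vectors of \<open>W\<close>, which is all that the last
  face and \<tau> provide. The restricted coactions are compared after the injective inclusion into
  N \<otimes> B.\<close>

lemma comodule_map_restrict: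
  assumes M: "right_comodule K B \<Delta> \<epsilon> M \<rho>M" and N: "right_comodule K B \<Delta> \<epsilon> N \<rho>N"
    and W: "submodule W K M" "coaction_restricts K B M \<rho>M W"
    and W': "submodule W' K N" "coaction_restricts K B N \<rho>N W'"
    and f: "linear_map K M N f" "\<And>w. w \<in> W \<Longrightarrow> f w \<in> W'"
    and colinear: "\<And>w. w \<in> W \<Longrightarrow>
      \<rho>N (f w) = bnd M B (tensor K N B) (\<rho>M w) (\<lambda>m b. pure K N B (f m) b)"
  shows "comodule_map K B (M\<lparr>carrier := W\<rparr>) (restrict_coaction K B M \<rho>M W)
    (N\<lparr>carrier := W'\<rparr>) (restrict_coaction K B N \<rho>N W') f"
proof -
  define M' N' where "M' = M\<lparr>carrier := W\<rparr>" and "N' = N\<lparr>carrier := W'\<rparr>"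
  note B [simp] = coalgebra_facts(1)[OF right_comodule_facts(1)[OF M]]
  note [simp] = right_comodule_facts(2-)[OF M] right_comodule_facts(2-)[OF N]
  have [simp]: "module K M'" "module K N'"
    unfolding M'_def N'_def using W W' by (auto intro: submodule_module)
  have carr: "carrier M' = W" "carrier N' = W'"
    unfolding M'_def N'_def by auto
  have f': "linear_map K M' N' f"
    unfolding M'_def N'_def
    by (rule linear_map_restrict[OF f(1) submoduleD(1)[OF W(1)] f(2)]) auto
  note [simp] = linear_closed[OF f'] linear_compose[OF _ f']
  note [simp] = linear_closed[OF f(1)] linear_compose[OF _ f(1)]
  note L = tensor_incl_linear[OF right_comodule_facts(2)[OF N] B W'(1), folded N'_def]
  note Lp = tensor_incl_pure[OF right_comodule_facts(2)[OF N] B W'(1), folded N'_def carr]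
  note inj = inj_onD[OF tensor_incl_inj[OF right_comodule_facts(2)[OF N] B W'(1), folded N'_def]]
  have "restrict_coaction K B N \<rho>N W' (f w) = tensor_map K N' B f id (restrict_coaction K B M \<rho>M W w)"
    if w: "w \<in> W" for w
  proof -
    note r = restrict_coaction_facts[OF M W w, folded M'_def]
    note r' = restrict_coaction_facts[OF N W' f(2)[OF w], folded N'_def]
    have [simp]: "w \<in> carrier M'"
      using w carr by simp
    note [simp] = r(1)
    have bil: "bilinear M B (tensor K N B) (\<lambda>m b. pure K N B (f m) b)"
      using f(1) by (simp add: linear_simps)
    have tm: "tensor_map K N' B f id (restrict_coaction K B M \<rho>M W w) =
        bnd M' B (tensor K N' B) (restrict_coaction K B M \<rho>M W w) (\<lambda>m b. pure K N' B (f m) b)"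
      using f' by (simp add: tensor_map_eq_bnd[where V = M' and W = B] linear_ident)
    have bil': "bilinear M' B (tensor K N' B) (\<lambda>m b. pure K N' B (f m) b)"
      using f' by (simp add: linear_simps)
    have "tensor_incl K N B (bnd M' B (tensor K N' B) (restrict_coaction K B M \<rho>M W w) (\<lambda>m b. pure K N' B (f m) b)) =
        bnd M' B (tensor K N B) (restrict_coaction K B M \<rho>M W w) (\<lambda>m b. pure K N B (f m) b)"
      using bil' by (simp add: linear_image_bnd[OF _ _ _ _ L] Lp)
    also have "\<dots> = bnd M B (tensor K N B) (\<rho>M w) (\<lambda>m b. pure K N B (f m) b)"
      unfolding M'_def by (rule bnd_restrict_coaction[OF M W _ bil w]) simp
    also have "\<dots> = tensor_incl K N B (restrict_coaction K B N \<rho>N W' (f w))"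
      by (simp add: r'(2) colinear[OF w])
    finally show ?thesis
      unfolding tm by (rule inj[symmetric]) (use r'(1) bil' in \<open>simp_all add: bnd_closed\<close>)
  qed
  with f' show ?thesis
    unfolding comodule_map_def M'_def[symmetric] N'_def[symmetric] carr by simp
qed

text \<open>Both the restricted coaction of w and w \<otimes> 1 are determined by their images in M
  \<otimes> B.\<close>

lemma coinvariants_restrict:
  assumes M: "right_comodule K B \<Delta> \<epsilon> M \<rho>" and "bialgebra K B \<Delta> \<epsilon>"
    and W: "submodule W K M" "coaction_restricts K B M \<rho> W"
  shows "coinvariants K B (M\<lparr>carrier := W\<rparr>) (restrict_coaction K B M \<rho> W) =
    {w \<in> W. \<rho> w = pure K M B w \<one>\<^bsub>B\<^esub>}"
proof -
  note B [simp] = unital_algebra_facts[OF bialgebra.axioms(1)[OF assms(2)]]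
  note M' [simp] = right_comodule_facts(2)[OF M]
  note inj = inj_onD[OF tensor_incl_inj[OF M' B(1) W(1)]]
  have "restrict_coaction K B M \<rho> W w = pure K (M\<lparr>carrier := W\<rparr>) B w \<one>\<^bsub>B\<^esub> \<longleftrightarrow> \<rho> w = pure K M B w \<one>\<^bsub>B\<^esub>"
    if w: "w \<in> W" for w
    using restrict_coaction_facts[OF M W w] inj[of "restrict_coaction K B M \<rho> W w" "pure K (M\<lparr>carrier := W\<rparr>) B w \<one>\<^bsub>B\<^esub>"]
      w tensor_incl_pure[OF M' B(1) W(1) w B(4)] submodule_module[OF M' W(1)] by auto
  then show ?thesis
    unfolding coinvariants_def by auto
qed

end

context hopf_comodule_data
begin

abbreviation "coL n \<equiv> coact_left K B S Y \<rho>Y X \<kappa> n"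

lemma right_comodule_coL: "right_comodule K B \<Delta> \<epsilon> (T (Suc n)) (coL n)"
  by (rule right_comodule_cong[OF right_comodule_T coact_left_eq_coT])

section \<open>Integer powers of the cyclic operator\<close>

definition tau_int :: "nat \<Rightarrow> int \<Rightarrow> ('k, 'y, 'x) mtens \<Rightarrow> ('k, 'y, 'x) mtens" where
  "tau_int n j = (if j \<ge> 0 then tau n ^^ nat j else tau_inv n ^^ nat (- j))"

lemma tau_int_linear: "linear_map K (T (Suc n)) (T (Suc n)) (tau_int n j)"
  unfolding tau_int_def by (auto intro: linear_funpow tau_linear tau_inv_linear)

lemma tau_int_closed [simp]: "t \<in> carrier (T (Suc n)) \<Longrightarrow> tau_int n j t \<in> carrier (T (Suc n))"
  by (rule linear_closed[OF tau_int_linear])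

lemma tau_int_tau:
  assumes "v \<in> carrier (T (Suc n))"
  shows "tau_int n j (tau n v) = tau_int n (j + 1) v"
proof (cases "j \<ge> 0")
  case True
  then have "nat (j + 1) = Suc (nat j)" by simp
  with True show ?thesis
    unfolding tau_int_def by (simp add: funpow_swap1)
next
  case False
  define k where "k = nat (- j) - 1"
  have k: "nat (- j) = Suc k" "j + 1 = - int k"
    using False unfolding k_def by auto
  have "(tau_inv n ^^ Suc k) (tau n v) = (tau_inv n ^^ k) v"
    using assms by (simp add: funpow_swap1 tau_inv_tau)
  moreover have "tau_int n j = tau_inv n ^^ Suc k"
    using False k(1) unfolding tau_int_def by simp
  \<comment> \<open>For \<open>k = 0\<close> the exponent is 0 and falls into the nonnegative branch
    of the definition, where both powers are the identity.\<close>
  moreover have "tau_int n (j + 1) = tau_inv n ^^ k"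
    unfolding k(2) tau_int_def by (cases "k = 0") simp_all
  ultimately show ?thesis
    by (simp only:)
qed

lemma tau_int_tau_inv:
  "v \<in> carrier (T (Suc n)) \<Longrightarrow> tau_int n j (tau_inv n v) = tau_int n (j - 1) v"
  using tau_int_tau[of "tau_inv n v" n "j - 1"] by (simp add: tau_tau_inv)

text \<open>The choice made by \<open>inv_into\<close> agrees with \<open>tau_inv\<close> on the
  carrier by injectivity, and the iteration never leaves the carrier.\<close>

lemma int_iter_cyc:
  assumes "v \<in> carrier (T (Suc n))"
  shows "int_iter (carrier (T (Suc n))) (cyc K Y \<rho>Y X act n) j v = tau_int n j v"
proof -
  have inv: "inv_into (carrier (T (Suc n))) (cyc K Y \<rho>Y X act n) w = tau_inv n w"
    if "w \<in> carrier (T (Suc n))" for w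
    using that cyc_eq_tau[of "tau_inv n w" n] bij_betw_imp_inj_on[OF tau_bij]
    by (intro inv_into_f_eq) (auto simp: tau_tau_inv cyc_eq_tau inj_on_def)
  have inv_pow: "(tau_inv n ^^ k) v \<in> carrier (T (Suc n))" for k
    using assms by (induction k) auto
  have "(inv_into (carrier (T (Suc n))) (cyc K Y \<rho>Y X act n) ^^ k) v = (tau_inv n ^^ k) v" for k
    by (induction k) (simp_all add: inv inv_pow)
  with assms show ?thesis
    unfolding int_iter_def tau_int_def by (simp add: cyc_power_eq)
qed

abbreviation "PL n \<equiv> PCM_left K B S Y \<rho>Y X act \<kappa> n"

lemma PCM_left_eq: "PL n = commuting_part B (T (Suc n)) (coL n) (range (tau_int n))"
  unfolding PCM_left_def TT_eq
  by (subst commuting_part_Inter[symmetric], simp)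
    (intro INF_cong refl equalizer_eq_commuting_part[OF right_comodule_coL], auto simp: tau_int_linear int_iter_cyc)

lemma PL_submodule: "submodule (PL n) K (T (Suc n))"
  unfolding PCM_left_eq by (rule commuting_part_submodule[OF right_comodule_coL]) (auto simp: tau_int_linear)

lemma PL_restricts: "coaction_restricts K B (T (Suc n)) (coL n) (PL n)"
  unfolding PCM_left_eq by (rule commuting_part_restricts[OF right_comodule_coL]) (auto simp: tau_int_linear)

lemma PL_carrier: "v \<in> PL n \<Longrightarrow> v \<in> carrier (T (Suc n))"
  unfolding PCM_left_eq commuting_part_def by simp

text \<open>The relations for \<tau> read backwards: the multiplied position goes down by one, and
  from 0 it wraps around to m at the cost of two inverse powers.\<close>

lemma tau_inv_mulT:
  assumes "j \<le> m"
  shows "\<exists>i k. i \<le> m \<and> (\<forall>w\<in>carrier (T (Suc (Suc m))).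
    tau_inv m (mulT (Suc m) j w) = mulT (Suc m) i (tau_int (Suc m) k w))"
proof (cases j)
  case 0
  have "tau_inv m (mulT (Suc m) 0 w) = mulT (Suc m) m (tau_int (Suc m) (- 2) w)"
    if w: "w \<in> carrier (T (Suc (Suc m)))" for w
  proof -
    let ?u = "tau_inv (Suc m) (tau_inv (Suc m) w)"
    have "mulT (Suc m) 0 w = tau m (mulT (Suc m) m ?u)"
      using w mulT_tau_tau[of ?u m] by (simp add: tau_tau_inv)
    moreover have "tau_int (Suc m) (- 2) w = ?u"
      unfolding tau_int_def by (simp add: numeral_2_eq_2)
    ultimately show ?thesis
      using w by (simp add: tau_inv_tau)
  qed
  with 0 show ?thesis
    by auto
next
  case (Suc i)
  have "tau_inv m (mulT (Suc m) j w) = mulT (Suc m) i (tau_int (Suc m) (- 1) w)"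
    if w: "w \<in> carrier (T (Suc (Suc m)))" for w
  proof -
    let ?u = "tau_inv (Suc m) w"
    have "mulT (Suc m) j w = tau m (mulT (Suc m) i ?u)"
      using assms w Suc mulT_tau_Suc[of i m ?u] by (simp add: tau_tau_inv)
    moreover have "tau_int (Suc m) (- 1) w = ?u"
      unfolding tau_int_def by simp
    ultimately show ?thesis
      using w assms Suc by (simp add: tau_inv_tau)
  qed
  moreover have "i \<le> m"
    using assms Suc by simp
  ultimately show ?thesis
    by blast
qed

lemma tau_int_add:
  assumes "v \<in> carrier (T (Suc n))"
  shows "tau_int n i (tau_int n j v) = tau_int n (i + j) v"
proof (induction j arbitrary: i rule: int_induct[where k = 0])
  case base
  then show ?case by (simp add: tau_int_def)
next
  case (step1 j)
  have "tau_int n (j + 1) v = tau n (tau_int n j v)"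
    using step1.hyps unfolding tau_int_def by (simp add: nat_add_distrib)
  with assms step1 show ?case
    by (simp add: tau_int_tau algebra_simps)
next
  case (step2 j)
  have "nat (- (j - 1)) = Suc (nat (- j))"
    using step2.hyps by simp
  then have "tau_int n (j - 1) v = tau_inv n (tau_int n j v)"
    using step2.hyps unfolding tau_int_def by (cases "j = 0") simp_all
  with assms step2 show ?case
    by (simp add: tau_int_tau_inv algebra_simps)
qed

lemma tau_int_mulT:
  assumes "j \<le> m"
  shows "\<exists>i k. i \<le> m \<and> (\<forall>v\<in>carrier (T (Suc (Suc m))).
    tau_int m l (mulT (Suc m) j v) = mulT (Suc m) i (tau_int (Suc m) k v))"
proof (cases "l \<ge> 0")
  case True
  obtain i k where "i \<le> m" "\<forall>v\<in>carrier (T (Suc (Suc m))).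
      (tau m ^^ nat l) (mulT (Suc m) j v) = mulT (Suc m) i ((tau (Suc m) ^^ k) v)"
    using tau_power_mulT[OF assms] by blast
  with True show ?thesis
    by (intro exI[of _ i] exI[of _ "int k"]) (simp add: tau_int_def)
next
  case False
  have "\<exists>i k. i \<le> m \<and> (\<forall>v\<in>carrier (T (Suc (Suc m))).
      (tau_inv m ^^ p) (mulT (Suc m) j v) = mulT (Suc m) i (tau_int (Suc m) k v))" for p
  proof (induction p)
    case 0
    show ?case
      using assms by (intro exI[of _ j] exI[of _ 0]) (simp add: tau_int_def)
  next
    case (Suc p)
    then obtain i k where "i \<le> m" and 1: "\<forall>v\<in>carrier (T (Suc (Suc m))).
        (tau_inv m ^^ p) (mulT (Suc m) j v) = mulT (Suc m) i (tau_int (Suc m) k v)"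
      by blast
    moreover from this obtain i' k' where "i' \<le> m" and 2: "\<forall>w\<in>carrier (T (Suc (Suc m))).
        tau_inv m (mulT (Suc m) i w) = mulT (Suc m) i' (tau_int (Suc m) k' w)"
      using tau_inv_mulT[of i m] by auto
    ultimately show ?case
      by (intro exI[of _ i'] exI[of _ "k' + k"]) (simp add: tau_int_add)
  qed
  with False show ?thesis
    by (simp add: tau_int_def)
qed

text \<open>The rotation contained in the last face is absorbed into the integer power, so every
  face behaves like an inner one here.\<close>

lemma tau_int_faceT:
  assumes "j \<le> Suc m"
  shows "\<exists>i k. i \<le> m \<and> (\<forall>v\<in>carrier (T (Suc (Suc m))).
    tau_int m l (faceT (Suc m) j v) = mulT (Suc m) i (tau_int (Suc m) k v))"
proof (cases "j < Suc m")
  case True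
  then show ?thesis
    using tau_int_mulT[of j m l] by (simp add: faceT_def)
next
  case False
  obtain i k where "i \<le> m" "\<forall>v\<in>carrier (T (Suc (Suc m))).
      tau_int m l (mulT (Suc m) 0 v) = mulT (Suc m) i (tau_int (Suc m) k v)"
    using tau_int_mulT[of 0 m l] by auto
  with False show ?thesis
    by (intro exI[of _ i] exI[of _ "k + 1"]) (simp add: faceT_def tau_int_tau)
qed

lemma PL_image:
  assumes g: "linear_map K (T (Suc n)) (T (Suc m)) g"
    and factor: "\<And>l. \<exists>c k. linear_map K (T (Suc n)) (T (Suc m)) c \<and>
      (\<forall>t\<in>carrier (T (Suc n)). coT (Suc m) (c t) =
        bnd (T (Suc n)) B (TB (Suc m)) (coT (Suc n) t) (\<lambda>t b. pure K (T (Suc m)) B (c t) b)) \<and>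
      (\<forall>t\<in>carrier (T (Suc n)). tau_int m l (g t) = c (tau_int n k t))"
    and v: "v \<in> PL n"
  shows "g v \<in> PL m"
    and "coL m (g v) = bnd (T (Suc n)) B (TB (Suc m)) (coL n v) (\<lambda>t b. pure K (T (Suc m)) B (g t) b)"
proof -
  have "\<exists>c h'. linear_map K (T (Suc n)) (T (Suc m)) c \<and>
      (\<forall>t\<in>carrier (T (Suc n)). coL m (c t) =
        bnd (T (Suc n)) B (TB (Suc m)) (coL n t) (\<lambda>t b. pure K (T (Suc m)) B (c t) b)) \<and>
      h' \<in> range (tau_int n) \<and> (\<forall>t\<in>carrier (T (Suc n)). h (g t) = c (h' t))"
    if "h \<in> insert (\<lambda>v. v) (range (tau_int m))" for h
  proof -
    \<comment> \<open>The identity is the power with exponent 0, so \<open>factor\<close> covers the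
      extra case as well.\<close>
    have "tau_int m 0 = (\<lambda>v. v)"
      unfolding tau_int_def by auto
    then obtain l where "h = tau_int m l"
      using \<open>h \<in> _\<close> by (metis insertE rangeE)
    moreover obtain c k where c: "linear_map K (T (Suc n)) (T (Suc m)) c"
      "\<forall>t\<in>carrier (T (Suc n)). coT (Suc m) (c t) =
        bnd (T (Suc n)) B (TB (Suc m)) (coT (Suc n) t) (\<lambda>t b. pure K (T (Suc m)) B (c t) b)"
      "\<forall>t\<in>carrier (T (Suc n)). tau_int m l (g t) = c (tau_int n k t)"
      using factor[of l] by blast
    ultimately show ?thesis
      by (intro exI[of _ c] exI[of _ "tau_int n k"]) (simp add: coact_left_eq_coT linear_closed[OF c(1)])
  qed
  note image = commuting_part_image[OF right_comodule_coL right_comodule_coL _ _ g this v[unfolded PCM_left_eq]]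
  show "g v \<in> PL m"
    unfolding PCM_left_eq by (rule image(1)) (auto simp: tau_int_linear)
  show "coL m (g v) = bnd (T (Suc n)) B (TB (Suc m)) (coL n v) (\<lambda>t b. pure K (T (Suc m)) B (g t) b)"
    by (rule image(2)) (auto simp: tau_int_linear)
qed

text \<open>For maps that only shift the exponent, such as \<tau> and its inverse, the colinear map
  in the factorization is the identity.\<close>

lemma tau_int_shift_factor:
  assumes "\<And>t. t \<in> carrier (T (Suc n)) \<Longrightarrow> tau_int n l (g t) = tau_int n k t"
  shows "\<exists>c k. linear_map K (T (Suc n)) (T (Suc n)) c \<and>
    (\<forall>t\<in>carrier (T (Suc n)). coT (Suc n) (c t) =
      bnd (T (Suc n)) B (TB (Suc n)) (coT (Suc n) t) (\<lambda>t b. pure K (T (Suc n)) B (c t) b)) \<and>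
    (\<forall>t\<in>carrier (T (Suc n)). tau_int n l (g t) = c (tau_int n k t))"
  using assms
  by (intro exI[of _ "\<lambda>v. v"] exI[of _ k] conjI ballI linear_ident) (simp_all add: bnd_pure_self)

lemmas PL_tau = PL_image[OF tau_linear tau_int_shift_factor[OF tau_int_tau]]

lemmas PL_tau_inv = PL_image(1)[OF tau_inv_linear tau_int_shift_factor[OF tau_int_tau_inv]]

lemma PL_faceT:
  assumes j: "j \<le> Suc m" and v: "v \<in> PL (Suc m)"
  shows "faceT (Suc m) j v \<in> PL m"
    and "coL m (faceT (Suc m) j v) = bnd (T (Suc (Suc m))) B (TB (Suc m)) (coL (Suc m) v)
      (\<lambda>t b. pure K (T (Suc m)) B (faceT (Suc m) j t) b)"
proof -
  \<comment> \<open>The colinear map is an inner face, also when \<open>j\<close> is the last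
    face.\<close>
  have "\<exists>c k. linear_map K (T (Suc (Suc m))) (T (Suc m)) c \<and>
      (\<forall>t\<in>carrier (T (Suc (Suc m))). coT (Suc m) (c t) =
        bnd (T (Suc (Suc m))) B (TB (Suc m)) (coT (Suc (Suc m)) t) (\<lambda>t b. pure K (T (Suc m)) B (c t) b)) \<and>
      (\<forall>t\<in>carrier (T (Suc (Suc m))). tau_int m l (faceT (Suc m) j t) = c (tau_int (Suc m) k t))" for l
  proof -
    obtain i k where "i \<le> m" "\<forall>t\<in>carrier (T (Suc (Suc m))).
        tau_int m l (faceT (Suc m) j t) = mulT (Suc m) i (tau_int (Suc m) k t)"
      using tau_int_faceT[OF j] by blast
    then show ?thesis
      by (intro exI[of _ "mulT (Suc m) i"] exI[of _ k]) (simp add: mulT_linear coT_mulT)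
  qed
  note image = PL_image[OF faceT_linear this v]
  show "faceT (Suc m) j v \<in> PL m"
    "coL m (faceT (Suc m) j v) = bnd (T (Suc (Suc m))) B (TB (Suc m)) (coL (Suc m) v)
      (\<lambda>t b. pure K (T (Suc m)) B (faceT (Suc m) j t) b)"
    by (rule image; simp)+
qed

abbreviation "PLT n \<equiv> (TT K Y X n)\<lparr>carrier := PL n\<rparr>"

lemma para_cyclic_PL: "para_cyclic K PLT (face K Y \<rho>Y X act) (cyc K Y \<rho>Y X act)"
proof -
  have tau: "cyc K Y \<rho>Y X act n v = tau n v" if "v \<in> PL n" for n v
    using PL_carrier[OF that] by (rule cyc_eq_tau)
  have "weak_para_cyclic K PLT (face K Y \<rho>Y X act) (cyc K Y \<rho>Y X act)"
  proof (rule weak_para_cyclic_restrict[OF weak_para_cyclic_T])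
    show "submodule (PL n) K (TT K Y X n)" for n
      unfolding TT_eq by (rule PL_submodule)
    show "cyc K Y \<rho>Y X act n v \<in> PL n" if "v \<in> PL n" for n v
      using PL_tau(1)[OF _ that] tau[OF that] by simp
    fix n j v assume *: "1 \<le> n" "j \<le> n" "v \<in> PL n"
    then obtain m where "n = Suc m" by (cases n) auto
    with * show "face K Y \<rho>Y X act n j v \<in> PL (n - 1)"
      by (simp add: face_eq_faceT PL_carrier PL_faceT)
  qed
  moreover have "bij_betw (cyc K Y \<rho>Y X act n) (PL n) (PL n)" for n
    by (rule bij_betw_byWitness[where f' = "tau_inv n"])
      (auto simp: tau tau_tau_inv tau_inv_tau PL_carrier PL_tau(1) PL_tau_inv)
  ultimately show ?thesis
    unfolding para_cyclic_def by simp
qed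

lemma para_cyclic_comodule_PL:
  "para_cyclic_comodule K B \<Delta> \<epsilon> PLT (PCM_left_coact K B S Y \<rho>Y X act \<kappa>)
    (face K Y \<rho>Y X act) (cyc K Y \<rho>Y X act)"
proof -
  note restrict = comodule_map_restrict[OF right_comodule_coL right_comodule_coL
      PL_submodule PL_restricts PL_submodule PL_restricts]
  have pc: "linear_map K (T (Suc (Suc m))) (T (Suc m)) (face K Y \<rho>Y X act (Suc m) j)" if "j \<le> Suc m" for m j
    by (rule linear_cong[OF faceT_linear]) (use that in \<open>auto simp: face_eq_faceT\<close>)
  have face: "comodule_map K B ((T (Suc (Suc m)))\<lparr>carrier := PL (Suc m)\<rparr>)
      (restrict_coaction K B (T (Suc (Suc m))) (coL (Suc m)) (PL (Suc m)))
      ((T (Suc m))\<lparr>carrier := PL m\<rparr>) (restrict_coaction K B (T (Suc m)) (coL m) (PL m))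
      (face K Y \<rho>Y X act (Suc m) j)" if j: "j \<le> Suc m" for m j
    by (rule restrict[OF pc[OF j]]) (use j in \<open>simp_all add: face_eq_faceT PL_carrier PL_faceT\<close>)
  have "linear_map K (T (Suc n)) (T (Suc n)) (cyc K Y \<rho>Y X act n)" for n
    by (rule linear_cong[OF tau_linear]) (auto simp: cyc_eq_tau)
  then have tau: "comodule_map K B ((T (Suc n))\<lparr>carrier := PL n\<rparr>)
      (restrict_coaction K B (T (Suc n)) (coL n) (PL n))
      ((T (Suc n))\<lparr>carrier := PL n\<rparr>) (restrict_coaction K B (T (Suc n)) (coL n) (PL n))
      (cyc K Y \<rho>Y X act n)" for n
    by (rule restrict) (simp_all add: cyc_eq_tau PL_carrier PL_tau)
  show ?thesis
    unfolding para_cyclic_comodule_def PCM_left_coact_def TT_eq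
  proof (intro conjI allI impI)
    show "para_cyclic K (\<lambda>n. (T (Suc n))\<lparr>carrier := PL n\<rparr>) (face K Y \<rho>Y X act) (cyc K Y \<rho>Y X act)"
      using para_cyclic_PL unfolding TT_eq .
    fix n
    show "right_comodule K B \<Delta> \<epsilon> ((T (Suc n))\<lparr>carrier := PL n\<rparr>)
        (restrict_coaction K B (T (Suc n)) (coL n) (PL n))"
      by (rule right_comodule_restrict[OF right_comodule_coL PL_submodule PL_restricts])
    fix j :: nat assume "1 \<le> n" "j \<le> n"
    then obtain m where "n = Suc m" by (cases n) auto
    with face[of j m] \<open>j \<le> n\<close> show "comodule_map K B ((T (Suc n))\<lparr>carrier := PL n\<rparr>)
        (restrict_coaction K B (T (Suc n)) (coL n) (PL n))
        ((T (Suc (n - 1)))\<lparr>carrier := PL (n - 1)\<rparr>)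
        (restrict_coaction K B (T (Suc (n - 1))) (coL (n - 1)) (PL (n - 1))) (face K Y \<rho>Y X act n j)"
      by simp
  qed (rule tau)
qed

text \<open>On this submodule \<tau>^(n+1) = id turns the inverse into \<tau>^n, so negative powers
  are positive ones.\<close>

lemma CM_tau_int:
  assumes v: "v \<in> CM K B Y \<rho>Y X act \<rho>X n"
  shows "tau_int n j v \<in> CM K B Y \<rho>Y X act \<rho>X n"
proof -
  have pow: "(tau n ^^ k) w \<in> CM K B Y \<rho>Y X act \<rho>X n" if "w \<in> CM K B Y \<rho>Y X act \<rho>X n" for w k
    by (induction k) (use that CM_tau in auto)
  have "tau_inv n w = (tau n ^^ n) w" if w: "w \<in> CM K B Y \<rho>Y X act \<rho>X n" for w
  proof -
    have wT: "w \<in> carrier (T (Suc n))"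
      using w unfolding CM_eq by simp
    have "tau_inv n w = tau_inv n ((tau n ^^ Suc n) w)"
      by (simp only: CM_tau_power[OF w])
    also have "\<dots> = (tau n ^^ n) w"
      using wT by (simp add: tau_inv_tau)
    finally show ?thesis .
  qed
  then have "(tau_inv n ^^ k) v \<in> CM K B Y \<rho>Y X act \<rho>X n" for k
    by (induction k) (use v pow in auto)
  then show ?thesis
    using pow[OF v] unfolding tau_int_def by simp
qed

text \<open>Integer exponents include the natural ones, which settles one inclusion. For the other,
  all integer powers of a vector of CM stay in CM and are coinvariant, and for a coinvariant vector
  this is the commutation demanded.\<close>

lemma CM_eq_coinvariants:
  "CM K B Y \<rho>Y X act \<rho>X n = coinvariants K B (PLT n) (PCM_left_coact K B S Y \<rho>Y X act \<kappa> n)"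
proof -
  have coinv: "coinvariants K B (PLT n) (PCM_left_coact K B S Y \<rho>Y X act \<kappa> n) =
      {v \<in> PL n. coL n v = pure K (T (Suc n)) B v \<one>\<^bsub>B\<^esub>}"
    unfolding PCM_left_coact_def TT_eq
    by (rule coinvariants_restrict[OF right_comodule_coL bialgebra PL_submodule PL_restricts])
  show ?thesis
    unfolding coinv
  proof (rule equalityI; rule subsetI)
    fix v assume v: "v \<in> CM K B Y \<rho>Y X act \<rho>X n"
    have co: "w \<in> carrier (T (Suc n))" "coinvariant (Suc n) w" if "w \<in> CM K B Y \<rho>Y X act \<rho>X n" for w
      using that coact_eq_coT unfolding CM_def PCM_eq commuting_part_def TT_eq by auto
    have "coL n v = pure K (T (Suc n)) B v \<one>\<^bsub>B\<^esub>"
      using co[OF v] by (simp add: coact_left_eq_coT)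
    moreover have "coT (Suc n) (tau_int n j v) =
        bnd (T (Suc n)) B (TB (Suc n)) (coT (Suc n) v) (\<lambda>t b. pure K (T (Suc n)) B (tau_int n j t) b)" for j
      using co(2)[OF CM_tau_int[OF v]] coinvariant_image[OF tau_int_linear co[OF v]] by metis
    then have "v \<in> PL n"
      unfolding PCM_left_eq commuting_part_def using co(1)[OF v] by (simp add: coact_left_eq_coT)
    ultimately show "v \<in> {v \<in> PL n. coL n v = pure K (T (Suc n)) B v \<one>\<^bsub>B\<^esub>}"
      by simp
  next
    fix v assume "v \<in> {v \<in> PL n. coL n v = pure K (T (Suc n)) B v \<one>\<^bsub>B\<^esub>}"
    then have v: "v \<in> carrier (T (Suc n))" "coL n v = pure K (T (Suc n)) B v \<one>\<^bsub>B\<^esub>" and com: "\<And>j. coL n (tau_int n j v) =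
        bnd (T (Suc n)) B (TB (Suc n)) (coL n v) (\<lambda>t b. pure K (T (Suc n)) B (tau_int n j t) b)"
      unfolding PCM_left_eq commuting_part_def by auto
    have "tau_int n (int k) = tau n ^^ k" for k
      unfolding tau_int_def by simp
    then have "coL n ((tau n ^^ k) v) =
        bnd (T (Suc n)) B (TB (Suc n)) (coL n v) (\<lambda>t b. pure K (T (Suc n)) B ((tau n ^^ k) t) b)" for k
      using com[of "int k"] by simp
    then show "v \<in> CM K B Y \<rho>Y X act \<rho>X n"
      using v unfolding CM_def PCM_eq commuting_part_def TT_eq by (simp add: coact_left_eq_coT coact_eq_coT)
  qed
qed

end

text \<open>The conjunct with \<open>coaction_restricts\<close> gives \<open>PCM_left_coact\<close>
  its meaning: \<open>restrict_coaction\<close> is an \<open>inv_into\<close>, which recovers the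
  coaction only when the latter takes values in the image of W \<otimes> B.\<close>

theorem theorem4p7:
  fixes K :: "'k ring"
    and B :: "('k, 'b) module" and \<Delta> :: "'b \<Rightarrow> ('k, 'b, 'b) tens" and \<epsilon> :: "'b \<Rightarrow> 'k"
    and Y :: "('k, 'y) module" and \<rho>Y :: "'y \<Rightarrow> ('k, 'y, 'b) tens"
    and X :: "('k, 'x) module" and act :: "'b \<Rightarrow> 'x \<Rightarrow> 'x" and \<rho>X :: "'x \<Rightarrow> ('k, 'x, 'b) tens"
  assumes "field K"
    and "bialgebra K B \<Delta> \<epsilon>"
    and "right_comodule_algebra K B \<Delta> \<epsilon> Y \<rho>Y"
    and "left_module K B X act"
    and "right_comodule K B \<Delta> \<epsilon> X \<rho>X"
    and "\<And>x. x \<in> carrier X \<Longrightarrow> lin_ext K X (\<lambda>(x0, x1). act x1 x0) (\<rho>X x) = x"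
  shows
    "weak_para_cyclic K (TT K Y X) (face K Y \<rho>Y X act) (cyc K Y \<rho>Y X act) \<and>
     (\<forall>S. hopf_algebra K B \<Delta> \<epsilon> S \<and> bij_betw S (carrier B) (carrier B) \<longrightarrow>
        one_stable K B \<Delta> \<epsilon> S X act (op_coaction K B S X \<rho>X) \<and>
        para_cyclic K (TT K Y X) (face K Y \<rho>Y X act) (cyc K Y \<rho>Y X act) \<and>
        (\<forall>n. coaction_restricts K B (TT K Y X n)
               (coact_left K B S Y \<rho>Y X (op_coaction K B S X \<rho>X) n)
               (PCM_left K B S Y \<rho>Y X act (op_coaction K B S X \<rho>X) n)) \<and>
        para_cyclic_comodule K B \<Delta> \<epsilon>
          (\<lambda>n. (TT K Y X n)\<lparr>carrier := PCM_left K B S Y \<rho>Y X act (op_coaction K B S X \<rho>X) n\<rparr>)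
          (PCM_left_coact K B S Y \<rho>Y X act (op_coaction K B S X \<rho>X))
          (face K Y \<rho>Y X act) (cyc K Y \<rho>Y X act)) \<and>
     cyclic K (\<lambda>n. (TT K Y X n)\<lparr>carrier := CM K B Y \<rho>Y X act \<rho>X n\<rparr>)
       (face K Y \<rho>Y X act) (cyc K Y \<rho>Y X act) \<and>
     (\<forall>S. hopf_algebra K B \<Delta> \<epsilon> S \<and> bij_betw S (carrier B) (carrier B) \<longrightarrow>
        (\<forall>n. CM K B Y \<rho>Y X act \<rho>X n =
           coinvariants K B
             ((TT K Y X n)\<lparr>carrier := PCM_left K B S Y \<rho>Y X act (op_coaction K B S X \<rho>X) n\<rparr>)
             (PCM_left_coact K B S Y \<rho>Y X act (op_coaction K B S X \<rho>X) n)))"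
proof -
  interpret comodule_data K B \<Delta> \<epsilon> Y \<rho>Y X act \<rho>X
    using assms by (simp add: comodule_data_def linear_algebra_def comodule_data_axioms_def)
  have H: "hopf_comodule_data K B \<Delta> \<epsilon> Y \<rho>Y X act \<rho>X S"
    if "hopf_algebra K B \<Delta> \<epsilon> S \<and> bij_betw S (carrier B) (carrier B)" for S
    using that by (intro hopf_comodule_data.intro comodule_data_axioms hopf_comodule_data_axioms.intro) auto
  show ?thesis
    using weak_para_cyclic_T cyclic_CM hopf_comodule_data.one_stable_op[OF H]
      hopf_comodule_data.para_cyclic_T[OF H] hopf_comodule_data.PL_restricts[OF H, folded TT_eq]
      hopf_comodule_data.para_cyclic_comodule_PL[OF H] hopf_comodule_data.CM_eq_coinvariants[OF H]
    by simp
qed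

end
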